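(* Let $k,m\ge 2$ be integers. The monoid $\mathcal{POI}_{k\times m}$ is defined by the monoid presentation $\langle B\cup C\cup X\mid U\cup W\cup U'\rangle$ on $3k$ generators and $\frac12\left(9k^2+(2m+7)k-4\right)$ relations, where $B=\{b_1,\dots,b_k\}$, $C=\{c_1,\dots,c_k\}$, $X=\{x_0,\dots,x_{k-1}\}$ and $U$, $W$, $U'$ are the sets of relations listed in the context; that is, $\mathcal{POI}_{k\times m}\cong (B\cup C\cup X)^*/\rho$, where $\rho$ is the smallest congruence on the free monoid $(B\cup C\cup X)^*$ containing $U\cup W\cup U'$.
   Context: Maps are written on the right and composed from left to right. Let $n=km$, $\Omega_n=\{1,\dots,n\}$ and $I_i=\{(i-1)m+1,\dots,im\}$ for $1\le i\le k$. For $x\in\Omega_n$ let $i_x$ denote the index with $x\in I_{i_x}$. $\mathcal{POI}_{k\times m}$ is the monoid, under composition, of all injective partial maps $\alpha$ from $\Omega_n$ to $\Omega_n$ (the empty map included) such that: (stability) for all $x\in\mathrm{Dom}(\alpha)$, $I_{i_x}\subseteq\mathrm{Dom}(\alpha)$ and $I_{i_x}\alpha=I_{i_{x\alpha}}$; (order preservation) for all $x,y\in\mathrm{Dom}(\alpha)$, $i_x\le i_y$ implies $i_{x\alpha}\le i_{y\alpha}$. In the lists, a chain $u=v=w$ stands for the two relations $u=v$ and $v=w$. $U$ consists of: $(c_ib_i^{m-1})^2=1$, $b_i^m=1$, $(b_ic_ib_i^{m-1})^{m-1}=1$, $(c_ib_i^{m-2}c_i)^3=1$ for $1\le i\le k$;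 $(c_ib_i^{m-j-1}c_ib_i^{j-1})^2=1$ for $2\le j\le m-2$, $1\le i\le k$; $b_ib_j=b_jb_i$ and $c_ic_j=c_jc_i$ for $1\le i<j\le k$; $b_ic_j=c_jb_i$ for $1\le i,j\le k$, $i\ne j$. $W$ consists of: $x_ix_0=x_0x_{i+1}$, $1\le i\le k-2$; $x_jx_i=x_ix_j$, $2\le i+1<j\le k-1$; $x_0^2x_1=x_0^2=x_{k-1}x_0^2$; $x_{i+1}x_ix_{i+1}=x_{i+1}x_i=x_ix_{i+1}x_i$, $1\le i\le k-2$; $x_ix_{i+1}\cdots x_{k-1}x_0x_1\cdots x_{i-1}x_i=x_i$, $0\le i\le k-1$; $x_{i+1}\cdots x_{k-1}x_0x_1\cdots x_{i-1}x_i^2=x_i^2$, $1\le i\le k-1$. $U'$ consists of: $c_1b_1^{m-1}x_0=x_0$, $b_1x_0=x_0$; $x_0c_ib_i^{m-1}=c_{i+1}b_{i+1}^{m-1}x_0$, $x_0b_i=b_{i+1}x_0$, $1\le i\le k-1$; $x_ic_{k-i}b_{k-i}^{m-1}=x_i$, $x_ib_{k-i}=x_i$, $0\le i\le k-1$; $c_ib_i^{m-1}x_{k-i+1}=x_{k-i+1}$, $b_ix_{k-i+1}=x_{k-i+1}$, $2\le i\le k$; $x_ic_{k-i+1}b_{k-i+1}^{m-1}=c_{k-i}b_{k-i}^{m-1}x_i$, $x_ib_{k-i+1}=b_{k-i}x_i$, $1\le i\le k-1$; $x_ic_jb_j^{m-1}=c_jb_j^{m-1}x_i$, $x_ib_j=b_jx_i$,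 $1\le i\le k-1$, $1\le j\le k$, $j\notin\{k-i,k-i+1\}$.
   Formalization: For m=2 the stated number of relations is false (k=m=2 gives 29 relations, the formula 27); the formal theorem asserts the stated count for m≥3 and the stated count plus k for m=2, with the isomorphism and the 3k generators for all k,m≥2. *)

theory Defs
  imports Complex_Main "HOL-Algebra.Group"
begin

section \<open>The monoid \<open>POI\<^sub>k\<^sub>\<times>\<^sub>m\<close>\<close>

definition block :: "nat \<Rightarrow> nat \<Rightarrow> nat set"
  where "block m i = {(i - 1) * m + 1 .. i * m}"

definition block_index :: "nat \<Rightarrow> nat \<Rightarrow> nat \<Rightarrow> nat"
  where "block_index k m x = (THE i. i \<in> {1..k} \<and> x \<in> block m i)"

definition POI_carrier :: "nat \<Rightarrow> nat \<Rightarrow> (nat \<rightharpoonup> nat) set"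
  where "POI_carrier k m =
    {\<alpha>. dom \<alpha> \<subseteq> {1..k * m} \<and> ran \<alpha> \<subseteq> {1..k * m} \<and> inj_on \<alpha> (dom \<alpha>) \<and>
        (\<forall>x\<in>dom \<alpha>. block m (block_index k m x) \<subseteq> dom \<alpha> \<and>
           (\<lambda>y. the (\<alpha> y)) ` block m (block_index k m x) =
             block m (block_index k m (the (\<alpha> x)))) \<and>
        (\<forall>x\<in>dom \<alpha>. \<forall>y\<in>dom \<alpha>. block_index k m x \<le> block_index k m y \<longrightarrow>
           block_index k m (the (\<alpha> x)) \<le> block_index k m (the (\<alpha> y)))}"

text \<open>Maps act on the right: the product of \<open>\<alpha>\<close> and \<open>\<beta>\<close> applies \<open>\<alpha>\<close> first.\<close>

definition POI :: "nat \<Rightarrow> nat \<Rightarrow> (nat \<rightharpoonup> nat) monoid"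
  where "POI k m =
    \<lparr>carrier = POI_carrier k m,
     monoid.mult = (\<lambda>\<alpha> \<beta>. \<beta> \<circ>\<^sub>m \<alpha>),
     one = (\<lambda>x. if x \<in> {1..k * m} then Some x else None)\<rparr>"


section \<open>Monoid presentations\<close>

text \<open>The free monoid on \<open>A\<close> is \<open>lists A\<close> under \<open>@\<close>; a relation \<open>u = v\<close> is the pair \<open>(u, v)\<close>.\<close>

definition word_congruence :: "'a set \<Rightarrow> ('a list \<times> 'a list) set \<Rightarrow> bool"
  where "word_congruence A r \<longleftrightarrow> equiv (lists A) r \<and>
    (\<forall>u u' v v'. (u, u') \<in> r \<longrightarrow> (v, v') \<in> r \<longrightarrow> (u @ v, u' @ v') \<in> r)"

text \<open>This is meant for \<open>R \<subseteq> lists A \<times> lists A\<close>; otherwise the family that is intersected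
  is empty.\<close>

definition generated_congruence :: "'a set \<Rightarrow> ('a list \<times> 'a list) set \<Rightarrow> ('a list \<times> 'a list) set"
  where "generated_congruence A R = \<Inter>{r. word_congruence A r \<and> R \<subseteq> r}"

definition presented_monoid :: "'a set \<Rightarrow> ('a list \<times> 'a list) set \<Rightarrow> 'a list set monoid"
  where "presented_monoid A R =
    \<lparr>carrier = lists A // generated_congruence A R,
     monoid.mult = (\<lambda>P Q. \<Union>u\<in>P. \<Union>v\<in>Q. generated_congruence A R `` {u @ v}),
     one = generated_congruence A R `` {[]}\<rparr>"

lemma word_congruence_generated:
  assumes "R \<subseteq> lists A \<times> lists A"
  shows "word_congruence A (generated_congruence A R)"
proof -
  have full: "word_congruence A (lists A \<times> lists A)"
    by (auto simp: word_congruence_def equiv_def refl_on_def sym_on_def trans_on_def)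
  let ?F = "{r. word_congruence A r \<and> R \<subseteq> r}"
  have F: "lists A \<times> lists A \<in> ?F" using full assms by simp
  have eq: "equiv (lists A) r" if "r \<in> ?F" for r
    using that by (simp add: word_congruence_def)
  have "equiv (lists A) (\<Inter>?F)"
  proof (rule equivI)
    show "\<Inter>?F \<subseteq> lists A \<times> lists A" using F by blast
    show "refl_on (lists A) (\<Inter>?F)"
      using eq by (auto simp: equiv_def refl_on_def)
    show "sym (\<Inter>?F)"
      by (rule symI) (use eq in \<open>blast elim: equivE dest: symD\<close>)
    show "trans (\<Inter>?F)"
      by (rule transI) (use eq in \<open>blast elim: equivE dest: transD\<close>)
  qed
  moreover have "(u @ v, u' @ v') \<in> \<Inter>?F" if "(u, u') \<in> \<Inter>?F" "(v, v') \<in> \<Inter>?F" for u u' v v'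
    using that by (auto simp: word_congruence_def)
  ultimately show ?thesis
    unfolding generated_congruence_def word_congruence_def by blast
qed

lemma generated_congruence_contains: "R \<subseteq> generated_congruence A R"
  by (auto simp: generated_congruence_def)

lemma generated_congruence_least:
  "word_congruence A r \<Longrightarrow> R \<subseteq> r \<Longrightarrow> generated_congruence A R \<subseteq> r"
  by (auto simp: generated_congruence_def)


section \<open>Generators and relations\<close>

datatype gen = B nat | C nat | X nat

definition gens :: "nat \<Rightarrow> gen set"
  where "gens k = B ` {1..k} \<union> C ` {1..k} \<union> X ` {0..k - 1}"

definition word_power :: "'a list \<Rightarrow> nat \<Rightarrow> 'a list"  (infixr \<open>\<up>\<close> 80)
  where "w \<up> n = concat (replicate n w)"

definition rels_U :: "nat \<Rightarrow> nat \<Rightarrow> (gen list \<times> gen list) set"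
  where "rels_U k m =
    {(([C i] @ [B i] \<up> (m - 1)) \<up> 2, []) | i. 1 \<le> i \<and> i \<le> k} \<union>
    {([B i] \<up> m, []) | i. 1 \<le> i \<and> i \<le> k} \<union>
    {(([B i] @ [C i] @ [B i] \<up> (m - 1)) \<up> (m - 1), []) | i. 1 \<le> i \<and> i \<le> k} \<union>
    {(([C i] @ [B i] \<up> (m - 2) @ [C i]) \<up> 3, []) | i. 1 \<le> i \<and> i \<le> k} \<union>
    {(([C i] @ [B i] \<up> (m - j - 1) @ [C i] @ [B i] \<up> (j - 1)) \<up> 2, []) | i j.
        2 \<le> j \<and> j \<le> m - 2 \<and> 1 \<le> i \<and> i \<le> k} \<union>
    {([B i, B j], [B j, B i]) | i j. 1 \<le> i \<and> i < j \<and> j \<le> k} \<union>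
    {([C i, C j], [C j, C i]) | i j. 1 \<le> i \<and> i < j \<and> j \<le> k} \<union>
    {([B i, C j], [C j, B i]) | i j. 1 \<le> i \<and> i \<le> k \<and> 1 \<le> j \<and> j \<le> k \<and> i \<noteq> j}"

text \<open>In the last two families, \<open>x\<^sub>0 \<cdots> x\<^sub>i\<^sub>-\<^sub>1\<close> is empty for \<open>i = 0\<close> and
  \<open>x\<^sub>i\<^sub>+\<^sub>1 \<cdots> x\<^sub>k\<^sub>-\<^sub>1\<close> is empty for \<open>i = k - 1\<close>.\<close>

definition rels_W :: "nat \<Rightarrow> (gen list \<times> gen list) set"
  where "rels_W k =
    {([X i, X 0], [X 0, X (i + 1)]) | i. 1 \<le> i \<and> i \<le> k - 2} \<union>
    {([X j, X i], [X i, X j]) | i j. 2 \<le> i + 1 \<and> i + 1 < j \<and> j \<le> k - 1} \<union>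
    {([X 0, X 0, X 1], [X 0, X 0]), ([X 0, X 0], [X (k - 1), X 0, X 0])} \<union>
    {([X (i + 1), X i, X (i + 1)], [X (i + 1), X i]) | i. 1 \<le> i \<and> i \<le> k - 2} \<union>
    {([X (i + 1), X i], [X i, X (i + 1), X i]) | i. 1 \<le> i \<and> i \<le> k - 2} \<union>
    {(map X [i..<k] @ map X [0..<i] @ [X i], [X i]) | i. i \<le> k - 1} \<union>
    {(map X [i + 1..<k] @ map X [0..<i] @ [X i, X i], [X i, X i]) | i. 1 \<le> i \<and> i \<le> k - 1}"

definition rels_U' :: "nat \<Rightarrow> nat \<Rightarrow> (gen list \<times> gen list) set"
  where "rels_U' k m =
    {([C 1] @ [B 1] \<up> (m - 1) @ [X 0], [X 0]), ([B 1, X 0], [X 0])} \<union>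
    {([X 0, C i] @ [B i] \<up> (m - 1), [C (i + 1)] @ [B (i + 1)] \<up> (m - 1) @ [X 0]) | i.
        1 \<le> i \<and> i \<le> k - 1} \<union>
    {([X 0, B i], [B (i + 1), X 0]) | i. 1 \<le> i \<and> i \<le> k - 1} \<union>
    {([X i, C (k - i)] @ [B (k - i)] \<up> (m - 1), [X i]) | i. i \<le> k - 1} \<union>
    {([X i, B (k - i)], [X i]) | i. i \<le> k - 1} \<union>
    {([C i] @ [B i] \<up> (m - 1) @ [X (k - i + 1)], [X (k - i + 1)]) | i. 2 \<le> i \<and> i \<le> k} \<union>
    {([B i, X (k - i + 1)], [X (k - i + 1)]) | i. 2 \<le> i \<and> i \<le> k} \<union>
    {([X i, C (k - i + 1)] @ [B (k - i + 1)] \<up> (m - 1),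
      [C (k - i)] @ [B (k - i)] \<up> (m - 1) @ [X i]) | i. 1 \<le> i \<and> i \<le> k - 1} \<union>
    {([X i, B (k - i + 1)], [B (k - i), X i]) | i. 1 \<le> i \<and> i \<le> k - 1} \<union>
    {([X i, C j] @ [B j] \<up> (m - 1), [C j] @ [B j] \<up> (m - 1) @ [X i]) | i j.
        1 \<le> i \<and> i \<le> k - 1 \<and> 1 \<le> j \<and> j \<le> k \<and> j \<notin> {k - i, k - i + 1}} \<union>
    {([X i, B j], [B j, X i]) | i j.
        1 \<le> i \<and> i \<le> k - 1 \<and> 1 \<le> j \<and> j \<le> k \<and> j \<notin> {k - i, k - i + 1}}"

text \<open>The family of \<open>rels_U\<close> with \<open>2 \<le> j \<le> m - 2\<close> has \<open>(m - 3) * k\<close> members for \<open>m \<ge> 3\<close>, but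
  none (rather than \<open>- k\<close>) for \<open>m = 2\<close>, so a count of the relations that is polynomial in \<open>m\<close>
  is off by \<open>k\<close> there.\<close>

definition rels :: "nat \<Rightarrow> nat \<Rightarrow> (gen list \<times> gen list) set"
  where "rels k m = rels_U k m \<union> rels_W k \<union> rels_U' k m"

lemma set_word_power: "set (w \<up> n) \<subseteq> set w"
  by (induction n) (auto simp: word_power_def)

lemma rels_subset_lists:
  assumes "k \<ge> 2"
  shows "rels k m \<subseteq> lists (gens k) \<times> lists (gens k)"
proof -
  have g: "B i \<in> gens k \<longleftrightarrow> 1 \<le> i \<and> i \<le> k" "C i \<in> gens k \<longleftrightarrow> 1 \<le> i \<and> i \<le> k"
      "X i \<in> gens k \<longleftrightarrow> i < k" for i
    using assms by (auto simp: gens_def)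
  have "rels_U k m \<subseteq> lists (gens k) \<times> lists (gens k)"
    unfolding rels_U_def
    by (intro Un_least) (auto simp: g dest!: set_word_power[THEN subsetD])
  moreover have "rels_W k \<subseteq> lists (gens k) \<times> lists (gens k)"
    unfolding rels_W_def using assms
    by (intro Un_least) (auto simp: g)
  moreover have "rels_U' k m \<subseteq> lists (gens k) \<times> lists (gens k)"
    unfolding rels_U'_def using assms
    by (intro Un_least) (auto simp: g dest!: set_word_power[THEN subsetD])
  ultimately show ?thesis unfolding rels_def by blast
qed

end

theory Submission
  imports Defs "HOL-Combinatorics.Permutations"
begin

text \<open>Write \<open>y\<^sub>p\<close> for \<open>x\<^sub>k\<^sub>-\<^sub>p\<close>, which moves block \<open>p\<close> to block \<open>p + 1\<close>. The relations \<open>W\<close> yield idempotents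
  \<open>e\<^sub>q\<close> that omit block \<open>q\<close>. These, like the generators of the symmetric groups on the blocks, slide
  through a word \<open>w\<close> in \<open>X\<close> from the image of a block under \<open>w\<close> to the block itself, and are absorbed by \<open>w\<close>
  at blocks outside its domain or image. Hence every word equals \<open>h\<^sub>1 \<cdots> h\<^sub>k w\<close> with \<open>h\<^sub>i\<close> a word in
  \<open>b\<^sub>i\<close>, \<open>c\<^sub>i\<close> and \<open>w\<close> a word in \<open>X\<close>, and \<open>h\<^sub>i\<close> matters only if \<open>w\<close> is defined on block \<open>i\<close>.

  Two words in \<open>X\<close> with the same partial map on blocks are equal: restricted to a domain \<open>D\<close>, any word that
  is defined on \<open>D\<close> followed by the moves that push its image to the top is equal to the moves that push
  \<open>D\<close> to the top, and these moves can be undone. Two words in \<open>b\<^sub>i\<close>, \<open>c\<^sub>i\<close> with the same permutation are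
  equal because \<open>U\<close> contains Moore's relations, which imply the Coxeter relations. So words with the same
  map are equal; conversely the relations hold for maps, and every map comes from a word.\<close>

section \<open>Words in \<open>X\<close>\<close>

text \<open>The calculations are done in an arbitrary \<open>monoid_mult\<close>, although the
  presented monoid depends on \<open>k\<close> and \<open>m\<close> and so is not a type. They are
  used twice: for the maps themselves, where they show which maps come from words, and for the right
  regular action of the presented monoid, where they show that words with equal maps are congruent.
  Neither the idempotents nor the inverse moves are letters. The inverse of \<open>y_p\<close>,
  which takes block \<open>p + 1\<close> back to \<open>p\<close>, is a word \<open>z_p\<close>, and
  the rule that \<open>e_p\<close> and \<open>e_(p+1)\<close> slide through \<open>y_p\<close> rests
  on \<open>z_p^2 = y_p^2\<close>. Pushing a set to the top suits the moves \<open>y_p\<close> but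
  not \<open>x_0\<close>, the only letter that moves blocks down. It is undone by
  \<open>y_(k-1) ... y_1\<close>: the product is \<open>e_1\<close>, which does nothing when block 1
  is unoccupied, so the case of \<open>x_0\<close> follows from that of the other letters. Only the
  domain and image of a word enter this argument, because an order-preserving injection is
  determined by them.\<close>

definition down :: "(nat \<Rightarrow> 'a::monoid_mult) \<Rightarrow> nat \<Rightarrow> nat \<Rightarrow> 'a"
  where "down g i j = prod_list (map g (rev [i..<j]))"

lemma down_refl [simp]: "j \<le> i \<Longrightarrow> down g i j = 1"
  by (simp add: down_def)

lemma down_Suc: "i \<le> j \<Longrightarrow> down g i (Suc j) = g j * down g i j"
  by (simp add: down_def)

lemma down_split: "i \<le> l \<Longrightarrow> l \<le> j \<Longrightarrow> down g i j = down g l j * down g i l"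
  using upt_add_eq_append[of i l "j - l"] by (simp add: down_def)

lemma down_last: "i < j \<Longrightarrow> down g i j = down g (Suc i) j * g i"
  using down_split[of i "Suc i" j g] by (simp add: down_Suc)

lemma commute_down:
  assumes "\<And>p. i \<le> p \<Longrightarrow> p < j \<Longrightarrow> u * g p = g p * u"
  shows "u * down g i j = down g i j * u"
  using assms
proof (induction j)
  case (Suc j)
  show ?case
  proof (cases "i \<le> j")
    case True
    have "u * down g i j = down g i j * u" using Suc by simp
    moreover have "u * g j = g j * u" using Suc.prems True by simp
    ultimately show ?thesis using True by (metis down_Suc mult.assoc)
  qed simp
qed simp

lemma assoc2: "u * v = w \<Longrightarrow> u * (v * t) = w * (t::'a::semigroup_mult)"
  by (simp add: mult.assoc[symmetric])

lemma assoc3: "u * (v * s) = w \<Longrightarrow> u * (v * (s * t)) = w * (t::'a::semigroup_mult)"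
  by (metis mult.assoc)

text \<open>The relations \<open>W\<close>, with \<open>g 0\<close> for \<open>x\<^sub>0\<close> and \<open>g p\<close> for \<open>x\<^sub>k\<^sub>-\<^sub>p\<close>, which moves \<open>p\<close> to \<open>p + 1\<close>.\<close>

locale order_relations =
  fixes k :: nat and g :: "nat \<Rightarrow> 'a::monoid_mult"
  assumes k: "2 \<le> k"
    and shift: "\<lbrakk>1 \<le> p; Suc p < k\<rbrakk> \<Longrightarrow> g (Suc p) * g 0 = g 0 * g p"
    and far: "\<lbrakk>1 \<le> p; Suc p < q; q < k\<rbrakk> \<Longrightarrow> g q * g p = g p * g q"
    and sq_right: "g 0 * g 0 * g (k - 1) = g 0 * g 0"
    and sq_left: "g 1 * g 0 * g 0 = g 0 * g 0"
    and near1: "\<lbrakk>1 \<le> p; Suc p < k\<rbrakk> \<Longrightarrow> g p * g (Suc p) * g p = g p * g (Suc p)"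
    and near2: "\<lbrakk>1 \<le> p; Suc p < k\<rbrakk> \<Longrightarrow> g (Suc p) * g p * g (Suc p) = g p * g (Suc p)"
    and gap1: "\<lbrakk>1 \<le> p; p < k\<rbrakk> \<Longrightarrow> down g 1 (Suc p) * g 0 * down g p k = g p"
    and gap0: "g 0 * down g 1 k * g 0 = g 0"
    and gap2: "\<lbrakk>1 \<le> p; p < k\<rbrakk> \<Longrightarrow> down g 1 p * g 0 * down g p k * g p = g p * g p"
begin

lemma far': "\<lbrakk>1 \<le> p; 1 \<le> q; p < k; q < k; Suc p < q \<or> Suc q < p\<rbrakk> \<Longrightarrow> g q * g p = g p * g q"
  using far[of p q] far[of q p] by auto

lemma commute_down': "\<lbrakk>1 \<le> c; c < k; 1 \<le> i; j \<le> k; j < c \<or> Suc c < i\<rbrakk>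
    \<Longrightarrow> g c * down g i j = down g i j * g c"
  by (rule commute_down) (use far' in auto)

text \<open>Together \<open>near1\<close> and \<open>near2\<close> give the braid relation for
  \<open>g c\<close> and \<open>g (Suc c)\<close>, which carries \<open>g c\<close> across the two
  factors with these indices and turns it into \<open>g (Suc c)\<close>. All other factors are far
  from the letter that passes them.\<close>

lemma down_shift:
  assumes "1 \<le> i" "i \<le> c" "Suc c < j" "j \<le> k"
  shows "g c * down g i j = down g i j * g (Suc c)"
proof -
  have d: "down g i j = down g (Suc (Suc c)) j * (g (Suc c) * (g c * down g i c))"
    using assms down_split[of i "Suc (Suc c)" j g] by (simp add: down_Suc)
  have 1: "g c * down g (Suc (Suc c)) j = down g (Suc (Suc c)) j * g c"
    using assms by (intro commute_down') auto
  have 2: "g (Suc c) * down g i c = down g i c * g (Suc c)"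
    using assms by (intro commute_down') auto
  have 3: "g c * (g (Suc c) * g c) = g c * g (Suc c)" "g (Suc c) * (g c * g (Suc c)) = g c * g (Suc c)"
    using near1[of c] near2[of c] assms by (auto simp: mult.assoc)
  have "g c * down g i j = down g (Suc (Suc c)) j * (g c * g (Suc c)) * down g i c"
    unfolding d by (simp del: One_nat_def add: mult.assoc assoc2[OF 1] assoc3[OF 3(1)])
  also have "\<dots> = down g (Suc (Suc c)) j * (g (Suc c) * (g c * (down g i c * g (Suc c))))"
    by (simp del: One_nat_def add: mult.assoc 2[symmetric] assoc3[OF 3(2)])
  also have "\<dots> = down g i j * g (Suc c)" unfolding d by (simp add: mult.assoc)
  finally show ?thesis .
qed

lemma down_zero: "\<lbrakk>1 \<le> i; j < k\<rbrakk> \<Longrightarrow> down g (Suc i) (Suc j) * g 0 = g 0 * down g i j"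
proof (induction j)
  case (Suc j)
  show ?case
  proof (cases "i \<le> j")
    case True
    have "g (Suc j) * g 0 = g 0 * g j" using Suc.prems True by (intro shift) auto
    moreover have "down g (Suc i) (Suc j) * g 0 = g 0 * down g i j" using Suc by auto
    ultimately show ?thesis using True by (simp add: down_Suc) (metis mult.assoc)
  qed (simp)
qed (simp)

text \<open>By \<open>down_shift\<close>, each factor \<open>g c\<close> of the left product turns
  into \<open>g (Suc c)\<close> as it passes \<open>down g p k\<close>.\<close>

lemma down_down:
  assumes "1 \<le> p" "j < k" "p \<le> j"
  shows "down g p j * down g p k = down g p k * down g (Suc p) (Suc j)"
  using assms
proof (induction j)
  case (Suc j)
  show ?case
  proof (cases "p \<le> j")
    case True
    have "g j * down g p k = down g p k * g (Suc j)" using Suc.prems True by (intro down_shift) auto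
    moreover have "down g p j * down g p k = down g p k * down g (Suc p) (Suc j)" using Suc True by auto
    ultimately show ?thesis using True by (simp add: down_Suc) (metis mult.assoc)
  next
    case False
    with Suc.prems have "p = Suc j" by simp
    then show ?thesis by simp
  qed
qed simp

lemma sq_down: "1 \<le> p \<Longrightarrow> p < k \<Longrightarrow> g 0 * g 0 * down g p k = g 0 * g 0 * down g p (k - 1)"
  using down_Suc[of p "k - 1" g] k sq_right by (simp add: mult.assoc[symmetric])

lemma down_sq: "1 \<le> p \<Longrightarrow> down g 1 (Suc p) * g 0 * g 0 = down g 2 (Suc p) * g 0 * g 0"
  using down_last[of 1 "Suc p" g] sq_left by (simp del: One_nat_def add: mult.assoc numeral_2_eq_2)

section \<open>Idempotents omitting one block and partial inverses of the moves\<close>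

text \<open>In terms of blocks, \<open>down g 1 q\<close> moves those below \<open>q\<close> up by
  one and omits \<open>q\<close>, then \<open>g 0\<close> moves all remaining ones down, and
  \<open>down g q k\<close> returns those above \<open>q\<close> to their places.\<close>

definition e :: "nat \<Rightarrow> 'a" where "e q = down g 1 q * g 0 * down g q k"
text \<open>The word of \<open>e p\<close> without its last letter \<open>g p\<close>. It takes
  block \<open>p + 1\<close> to \<open>p\<close>, omits \<open>p\<close> and fixes the other
  blocks.\<close>

definition z :: "nat \<Rightarrow> 'a" where "z p = down g 1 p * g 0 * down g (Suc p) k"

lemma e_y: "1 \<le> p \<Longrightarrow> p < k \<Longrightarrow> e (Suc p) * g p = g p"
  using gap1[of p] down_last[of p k g] by (simp add: e_def mult.assoc)

lemma y_e: "1 \<le> p \<Longrightarrow> p < k \<Longrightarrow> g p * e p = g p"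
  using gap1[of p] by (simp add: e_def mult.assoc down_Suc)

lemma y_z: "1 \<le> p \<Longrightarrow> g p * z p = e (Suc p)"
  by (simp add: e_def z_def mult.assoc down_Suc)

lemma z_y: "p < k \<Longrightarrow> z p * g p = e p"
  by (simp add: e_def z_def mult.assoc down_last)

lemma e_y_sq: "1 \<le> p \<Longrightarrow> p < k \<Longrightarrow> e p * g p = g p * g p"
  using gap2 by (simp add: e_def)

lemma x_e_k: "g 0 * e k = g 0" and e_1_x: "e 1 * g 0 = g 0"
  using gap0 by (auto simp: e_def mult.assoc)

text \<open>The index of the moving letter changes twice and returns to \<open>c\<close>. For
  \<open>q < c\<close> it drops to \<open>c - 1\<close> at \<open>g 0\<close> and rises again in
  \<open>down g q k\<close>; for \<open>q > c + 1\<close> it rises in \<open>down g 1 q\<close> and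
  drops at \<open>g 0\<close>.\<close>

lemma y_e_other:
  assumes "1 \<le> c" "c < k" "1 \<le> q" "q \<le> k" "q \<noteq> c" "q \<noteq> Suc c"
  shows "g c * e q = e q * g c"
proof (cases "q < c")
  case True
  obtain d where d: "c = Suc d" using True by (cases c) auto
  have 1: "g c * down g 1 q = down g 1 q * g c" using assms True by (intro commute_down') auto
  have 2: "g c * g 0 = g 0 * g d" using shift[of d] d assms True by simp
  have 3: "g d * down g q k = down g q k * g c" using down_shift[of q d k] assms True d by simp
  show ?thesis unfolding e_def by (simp del: One_nat_def add: mult.assoc 3 assoc2[OF 1] assoc2[OF 2])
next
  case False
  then have q: "Suc c < q" using assms by linarith
  have 1: "g c * down g q k = down g q k * g c" using assms q by (intro commute_down') auto
  have 2: "g (Suc c) * g 0 = g 0 * g c" using shift[of c] assms q by simp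
  have 3: "g c * down g 1 q = down g 1 q * g (Suc c)" using down_shift[of 1 c q] assms q by simp
  show ?thesis unfolding e_def by (simp del: One_nat_def add: mult.assoc 1[symmetric] assoc2[OF 3] assoc2[OF 2[symmetric]])
qed

text \<open>The two letters \<open>g 0\<close> of \<open>z p * z p\<close> can be brought together.
  Then \<open>g p\<close> travels to the left and arrives next to \<open>g 0 * g 0\<close> as a
  factor \<open>g (k - 1)\<close>, which is absorbed there.\<close>

lemma z_z_y:
  assumes p: "1 \<le> p" "p < k"
  shows "z p * z p * g p = z p * z p"
proof -
  have c: "down g (Suc p) k * down g 1 p = down g 1 p * down g (Suc p) k"
    by (rule commute_down) (rule commute_down'[symmetric], use p in auto)
  have x1: "g 0 * down g 1 p = down g 2 (Suc p) * g 0"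
    using down_zero[of 1 p] p by (simp add: numeral_2_eq_2)
  have x2: "down g (Suc p) k * g 0 = g 0 * down g p (k - 1)"
    using down_zero[of p "k - 1"] p by simp
  have zz: "z p * z p = down g 1 p * down g 2 (Suc p) * (g 0 * g 0 * down g p (k - 1)) * down g (Suc p) k"
    unfolding z_def by (simp del: One_nat_def add: mult.assoc assoc2[OF c] assoc2[OF x1] assoc2[OF x2])
  have "down g p (k - 1) * (down g (Suc p) k * g p) = down g p k * down g (Suc p) k"
    using down_down[of p "k - 1"] p by (simp add: down_last[symmetric])
  then have "(g 0 * g 0 * down g p (k - 1)) * down g (Suc p) k * g p
      = (g 0 * g 0 * down g p k) * down g (Suc p) k"
    by (simp add: mult.assoc)
  also have "\<dots> = g 0 * g 0 * down g p (k - 1) * down g (Suc p) k" using sq_down p by simp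
  finally show ?thesis unfolding zz by (simp add: mult.assoc)
qed

text \<open>Evaluate \<open>z p * z p * g p * g p\<close> in two ways: \<open>z_z_y\<close> removes
  both factors \<open>g p\<close>, while \<open>z p * (g p * g p) = g p * g p\<close> removes both
  factors \<open>z p\<close>.\<close>

lemma z_z: assumes p: "1 \<le> p" "p < k" shows "z p * z p = g p * g p"
proof -
  have "z p * (g p * g p) = g p * g p"
    using e_y_sq[OF p] z_y[OF p(2)] by (simp add: mult.assoc[symmetric])
  then show ?thesis using z_z_y[OF p] by (metis mult.assoc)
qed

text \<open>Since the squares of \<open>g p\<close> and \<open>z p\<close> agree,
  \<open>g p * g p * z p\<close> and \<open>z p * g p * g p\<close> are both the cube of
  \<open>z p\<close>.\<close>

lemma y_e_Suc: assumes p: "1 \<le> p" "p < k" shows "g p * e (Suc p) = e p * g p"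
proof -
  have "g p * e (Suc p) = z p * z p * z p"
    using z_z[OF p] y_z[OF p(1)] by (metis mult.assoc)
  also have "\<dots> = z p * (g p * g p)" using z_z[OF p] by (metis mult.assoc)
  also have "\<dots> = e p * g p" using z_y[OF p(2)] by (simp add: mult.assoc[symmetric])
  finally show ?thesis .
qed

lemma e_y_ee: assumes p: "1 \<le> p" "p < k" shows "e p * g p = e p * e (Suc p)"
  using e_y_sq[OF p] y_e_Suc[OF p] y_z[OF p(1)] by (metis mult.assoc)

text \<open>Passing \<open>g 0\<close> across \<open>down g 1 i\<close> puts
  \<open>g 0 * g 0\<close> in the middle. This square supplies the missing factor \<open>g 1\<close>
  on its left and swallows the surplus factor \<open>g (k - 1)\<close> on its right.\<close>

lemma x_e: assumes "1 \<le> i" "i < k" shows "g 0 * e i = e (Suc i) * g 0"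
proof -
  have 1: "g 0 * down g 1 i = down g 2 (Suc i) * g 0"
    using down_zero[of 1 i] assms by (simp add: numeral_2_eq_2)
  have 2: "down g (Suc i) k * g 0 = g 0 * down g i (k - 1)"
    using down_zero[of i "k - 1"] assms by simp
  have "g 0 * e i = down g 2 (Suc i) * g 0 * g 0 * down g i k"
    unfolding e_def by (simp del: One_nat_def add: mult.assoc assoc2[OF 1])
  also have "\<dots> = down g 1 (Suc i) * (g 0 * g 0 * down g i k)" using down_sq[OF assms(1)] by (metis mult.assoc)
  also have "\<dots> = down g 1 (Suc i) * (g 0 * g 0 * down g i (k - 1))" using sq_down assms by simp
  also have "\<dots> = e (Suc i) * g 0" unfolding e_def using 2 by (simp add: mult.assoc)
  finally show ?thesis .
qed

text \<open>The behaviour of elements \<open>h c\<close> that act inside block \<open>c\<close>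
  only. One predicate serves both for the idempotents \<open>e c\<close> and for the symmetric
  groups on the blocks; by \<open>local_mult\<close> the latter need to be checked on generators
  only.\<close>

definition local :: "(nat \<Rightarrow> 'a) \<Rightarrow> bool"
  where "local h \<longleftrightarrow>
    (\<forall>p. 1 \<le> p \<longrightarrow> p < k \<longrightarrow> g p * h p = g p \<and> h (Suc p) * g p = g p \<and> g p * h (Suc p) = h p * g p) \<and>
    (\<forall>p c. 1 \<le> p \<longrightarrow> p < k \<longrightarrow> 1 \<le> c \<longrightarrow> c \<le> k \<longrightarrow> c \<noteq> p \<longrightarrow> c \<noteq> Suc p \<longrightarrow> g p * h c = h c * g p) \<and>
    g 0 * h k = g 0 \<and> h 1 * g 0 = g 0 \<and>
    (\<forall>i. 1 \<le> i \<longrightarrow> i < k \<longrightarrow> g 0 * h i = h (Suc i) * g 0)"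

lemma local_e: "local e"
  unfolding local_def
  using e_y y_e y_e_Suc y_e_other x_e_k e_1_x x_e by auto

lemma local_one: "local (\<lambda>_. 1)"
  by (simp add: local_def)

lemma local_mult:
  assumes "local h" "local h'"
  shows "local (\<lambda>c. h c * h' c)"
  unfolding local_def
proof (intro conjI allI impI)
  fix p assume p: "1 \<le> p" "p < k"
  show "g p * (h p * h' p) = g p"  "h (Suc p) * h' (Suc p) * g p = g p"
    "g p * (h (Suc p) * h' (Suc p)) = h p * h' p * g p"
    using assms p unfolding local_def by (metis mult.assoc)+
next
  fix p c assume p: "1 \<le> p" "p < k" "1 \<le> c" "c \<le> k" "c \<noteq> p" "c \<noteq> Suc p"
  then have 1: "g p * h c = h c * g p" and 2: "g p * h' c = h' c * g p"
    using assms unfolding local_def by simp_all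
  show "g p * (h c * h' c) = h c * h' c * g p"
    by (simp del: One_nat_def add: mult.assoc 2 assoc2[OF 1])
next
  show "g 0 * (h k * h' k) = g 0" "h 1 * h' 1 * g 0 = g 0"
    using assms unfolding local_def by (metis mult.assoc)+
next
  fix i assume p: "1 \<le> i" "i < k"
  then show "g 0 * (h i * h' i) = h (Suc i) * h' (Suc i) * g 0"
    using assms unfolding local_def by (metis mult.assoc)
qed

end

section \<open>Partial maps on block indices defined by words\<close>

text \<open>The letters are numbered as the arguments of \<open>g\<close>: \<open>0\<close> stands
  for \<open>x\<^sub>0\<close> and \<open>p\<close> for the move from \<open>p\<close> to
  \<open>p + 1\<close>. A letter is undefined outside \<open>{1..k}\<close>, whereas the empty word
  fixes every index.\<close>

fun step :: "nat \<Rightarrow> nat \<Rightarrow> nat option \<Rightarrow> nat option" where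
  "step k p None = None"
| "step k p (Some i) =
    (if i < 1 \<or> k < i then None
     else if p = 0 then (if i = 1 then None else Some (i - 1))
     else if i = p then Some (Suc p) else if i = Suc p then None else Some i)"

abbreviation run :: "nat \<Rightarrow> nat list \<Rightarrow> nat option \<Rightarrow> nat option"
  where "run k w \<equiv> fold (step k) w"

definition ev :: "('b \<Rightarrow> 'a::monoid_mult) \<Rightarrow> 'b list \<Rightarrow> 'a"
  where "ev g w = prod_list (map g w)"

lemma ev_simps [simp]: "ev g [] = 1" "ev g (p # w) = g p * ev g w" "ev g (u @ w) = ev g u * ev g w"
  by (simp_all add: ev_def)

definition image_run :: "nat \<Rightarrow> nat list \<Rightarrow> nat set \<Rightarrow> nat set"
  where "image_run k w D = {j. \<exists>i\<in>D. run k w (Some i) = Some j}"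

lemma run_None [simp]: "run k w None = None"
  by (induction w) auto

lemma step_SomeD: "p < k \<Longrightarrow> step k p (Some i) = Some j \<Longrightarrow> i \<in> {1..k} \<and> j \<in> {1..k}"
  by (auto split: if_splits)

lemma step_inj: "step k p (Some i) = Some j \<Longrightarrow> step k p (Some i') = Some j \<Longrightarrow> i = i'"
  by (auto split: if_splits)

lemma step_mono: "step k p (Some i) = Some j \<Longrightarrow> step k p (Some i') = Some j' \<Longrightarrow> i < i' \<Longrightarrow> j < j'"
  by (auto split: if_splits)

lemma run_mono: "run k w (Some i) = Some j \<Longrightarrow> run k w (Some i') = Some j' \<Longrightarrow> i < i' \<Longrightarrow> j < j'"
proof (induction w arbitrary: i i')
  case (Cons p w)
  obtain a where a: "step k p (Some i) = Some a" using Cons.prems(1)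
    by (cases "step k p (Some i)") (auto simp del: step.simps(2))
  obtain b where b: "step k p (Some i') = Some b" using Cons.prems(2)
    by (cases "step k p (Some i')") (auto simp del: step.simps(2))
  show ?case
    using Cons.IH[of a b] Cons.prems a b step_mono[OF a b] by (simp del: step.simps(2))
qed simp

lemma run_SomeD:
  "set w \<subseteq> {..<k} \<Longrightarrow> run k w (Some i) = Some j \<Longrightarrow> i \<in> {1..k} \<longleftrightarrow> j \<in> {1..k}"
proof (induction w arbitrary: i)
  case (Cons p w)
  obtain a where a: "step k p (Some i) = Some a" using Cons.prems
    by (cases "step k p (Some i)") (auto simp del: step.simps(2))
  show ?case
    using Cons.IH[of a] Cons.prems a step_SomeD[OF _ a] by (simp del: step.simps(2))
qed simp

lemma run_down:
  assumes "1 \<le> i" "j \<le> k" "c \<in> {1..k}"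
  shows "run k (rev [i..<j]) (Some c) =
    (if i < j then if c = j then None else if i \<le> c \<and> c < j then Some (Suc c) else Some c else Some c)"
  using assms
proof (induction j arbitrary: c)
  case (Suc j)
  then show ?case by (cases "i \<le> j") (auto split: if_splits)
qed auto

lemma ev_down: "ev g (rev [i..<j]) = down g i j"
  by (simp add: ev_def down_def)

text \<open>Moving the elements of a set up as far as possible leads to the top interval of the same size,
  and the choice of the moves does not matter: two applicable moves are far apart, so they commute.\<close>

inductive up :: "nat \<Rightarrow> nat set \<Rightarrow> nat list \<Rightarrow> bool" for k where
  up_Nil: "(\<And>p. 1 \<le> p \<Longrightarrow> p < k \<Longrightarrow> p \<in> D \<Longrightarrow> Suc p \<in> D) \<Longrightarrow> up k D []"
| up_Cons: "1 \<le> p \<Longrightarrow> p < k \<Longrightarrow> p \<in> D \<Longrightarrow> Suc p \<notin> D \<Longrightarrow> up k (insert (Suc p) (D - {p})) w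
    \<Longrightarrow> up k D (p # w)"

text \<open>Every move brings one element of \<open>D\<close> closer to \<open>k\<close>, so the sum
  of the remaining distances is a measure for inductions over moves.\<close>

definition height :: "nat \<Rightarrow> nat set \<Rightarrow> nat" where "height k D = (\<Sum>i\<in>D. k - i)"

lemma height_less:
  assumes "D \<subseteq> {1..k}" "p < k" "p \<in> D" "Suc p \<notin> D"
  shows "height k (insert (Suc p) (D - {p})) < height k D"
proof -
  have f: "finite D" using assms(1) finite_subset by blast
  have "height k D = (k - p) + (\<Sum>i\<in>D - {p}. k - i)"
    unfolding height_def using f assms by (simp add: sum.remove)
  moreover have "height k (insert (Suc p) (D - {p})) = (k - Suc p) + (\<Sum>i\<in>D - {p}. k - i)"
    unfolding height_def using f assms by simp
  ultimately show ?thesis using assms by simp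
qed

lemma up_exists: "D \<subseteq> {1..k} \<Longrightarrow> \<exists>u. up k D u \<and> set u \<subseteq> {1..<k}"
proof (induction "height k D" arbitrary: D rule: less_induct)
  case less
  show ?case
  proof (cases "\<exists>p. 1 \<le> p \<and> p < k \<and> p \<in> D \<and> Suc p \<notin> D")
    case True
    then obtain p where p: "1 \<le> p" "p < k" "p \<in> D" "Suc p \<notin> D" by blast
    have "insert (Suc p) (D - {p}) \<subseteq> {1..k}" using less.prems p by auto
    then obtain u where "up k (insert (Suc p) (D - {p})) u" "set u \<subseteq> {1..<k}"
      using less.hyps[OF height_less] less.prems p by blast
    then show ?thesis using p up_Cons[OF p] by (intro exI[of _ "p # u"]) auto
  next
    case False
    then have "up k D []" by (intro up_Nil) blast
    then show ?thesis by force
  qed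
qed

lemma image_run_Nil [simp]: "image_run k [] D = D"
  by (auto simp: image_run_def)

lemma image_run_Cons: "image_run k (p # w) D = image_run k w (image_run k [p] D)"
proof -
  have "(\<exists>i\<in>D. run k w (step k p (Some i)) = Some j) \<longleftrightarrow>
    (\<exists>i'. (\<exists>i\<in>D. step k p (Some i) = Some i') \<and> run k w (Some i') = Some j)" for j
    by (metis not_None_eq run_None)
  then show ?thesis by (auto simp: image_run_def simp del: step.simps(2))
qed

lemma image_run_y:
  "D \<subseteq> {1..k} \<Longrightarrow> 1 \<le> p \<Longrightarrow> Suc p \<notin> D \<Longrightarrow>
    image_run k [p] D = (if p \<in> D then insert (Suc p) (D - {p}) else D)"
proof -
  assume a: "D \<subseteq> {1..k}" "1 \<le> p" "Suc p \<notin> D"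
  then have "step k p (Some i) = Some (if i = p then Suc p else i)" if "i \<in> D" for i
    using that by auto
  then have "image_run k [p] D = (\<lambda>i. if i = p then Suc p else i) ` D"
    by (auto simp: image_run_def simp del: step.simps(2))
  then show ?thesis by auto
qed

lemma image_run_subset: "set w \<subseteq> {..<k} \<Longrightarrow> D \<subseteq> {1..k} \<Longrightarrow> image_run k w D \<subseteq> {1..k}"
  using run_SomeD by (fastforce simp: image_run_def)

section \<open>Passing local families through words\<close>

context order_relations
begin

lemma local_step:
  assumes "local h" "p < k" "step k p (Some c') = Some c"
  shows "g p * h c = h c' * g p"
  using assms by (cases "p = 0"; cases "c' = p") (auto simp: local_def split: if_splits dest: Suc_le_D)

lemma local_step_ran:
  assumes "local h" "p < k" "c \<in> {1..k}" "\<And>c'. step k p (Some c') \<noteq> Some c"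
  shows "g p * h c = g p"
proof -
  consider "p = 0" "c = k" | "1 \<le> p" "c = p"
    using assms(2,3) assms(4)[of c] assms(4)[of "c - 1"] assms(4)[of "Suc c"]
    by (cases "p = 0") (auto split: if_splits)
  then show ?thesis using assms(1,2) by cases (auto simp: local_def)
qed

lemma local_step_dom:
  assumes "local h" "p < k" "c \<in> {1..k}" "step k p (Some c) = None"
  shows "h c * g p = g p"
  using assms by (auto simp: local_def split: if_splits)

lemma local_run:
  assumes "local h" "set w \<subseteq> {..<k}" "run k w (Some c') = Some c"
  shows "ev g w * h c = h c' * ev g w"
  using assms(2,3)
proof (induction w arbitrary: c')
  case (Cons p w)
  obtain a where a: "step k p (Some c') = Some a" using Cons.prems
    by (cases "step k p (Some c')") (auto simp del: step.simps(2))
  have 1: "ev g w * h c = h a * ev g w" using Cons a by (simp del: step.simps(2))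
  have 2: "g p * h a = h c' * g p" using local_step[OF assms(1) _ a] Cons.prems by simp
  show ?case by (simp add: mult.assoc 1 assoc2[OF 2])
qed simp

lemma local_run_ran:
  assumes "local h" "set w \<subseteq> {..<k}" "c \<in> {1..k}" "\<And>c'. run k w (Some c') \<noteq> Some c"
  shows "ev g w * h c = ev g w"
  using assms(2,4)
proof (induction w)
  case Nil
  then show ?case using Nil.prems(2)[of c] by simp
next
  case (Cons p w)
  \<comment> \<open>Either \<open>w\<close> already misses \<open>c\<close>, or \<open>h c\<close>
    slides to the preimage \<open>a\<close> of \<open>c\<close> under \<open>w\<close>, and then the
    letter \<open>p\<close> misses \<open>a\<close>.\<close>
  show ?case
  proof (cases "\<exists>a. run k w (Some a) = Some c")
    case True
    then obtain a where a: "run k w (Some a) = Some c" by blast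
    have "step k p (Some c') \<noteq> Some a" for c' using Cons.prems(2)[of c'] a by (auto simp del: step.simps(2))
    moreover have "a \<in> {1..k}" using run_SomeD[OF _ a] Cons.prems assms(3) by simp
    ultimately have 2: "g p * h a = g p" using local_step_ran[OF assms(1)] Cons.prems by simp
    have 1: "ev g w * h c = h a * ev g w" using local_run[OF assms(1) _ a] Cons.prems by simp
    show ?thesis by (simp add: mult.assoc 1 assoc2[OF 2])
  next
    case False
    then show ?thesis using Cons by (simp add: mult.assoc)
  qed
qed

lemma local_run_dom:
  assumes "local h" "set w \<subseteq> {..<k}" "c \<in> {1..k}" "run k w (Some c) = None"
  shows "h c * ev g w = ev g w"
  using assms(2-4)
proof (induction w arbitrary: c)
  case (Cons p w)
  show ?case
  proof (cases "step k p (Some c)")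
    case None
    then show ?thesis using local_step_dom[OF assms(1) _ _ None] Cons.prems by (simp add: mult.assoc[symmetric])
  next
    case (Some a)
    then have 1: "h a * ev g w = ev g w" using Cons step_SomeD[OF _ Some] by (simp del: step.simps(2))
    have 2: "h c * g p = g p * h a" using local_step[OF assms(1) _ Some] Cons.prems by simp
    show ?thesis by (simp add: mult.assoc 1 assoc2[OF 2])
  qed
qed simp

section \<open>Restriction of words to a set of blocks\<close>

definition e_word :: "nat \<Rightarrow> nat list" where "e_word c = rev [1..<c] @ [0] @ rev [c..<k]"

lemma ev_e_word: "ev g (e_word c) = e c"
  by (simp add: e_word_def e_def ev_down mult.assoc del: One_nat_def)

lemma set_e_word: "c \<in> {1..k} \<Longrightarrow> set (e_word c) \<subseteq> {..<k}"
  by (auto simp: e_word_def)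

lemma run_e_word:
  assumes c: "c \<in> {1..k}"
  shows "run k (e_word c) (Some i) = (if i \<in> {1..k} \<and> i \<noteq> c then Some i else None)"
proof (cases "i \<in> {1..k}")
  case True
  show ?thesis
  proof (cases "i \<le> c")
    case True
    then show ?thesis unfolding e_word_def using c k \<open>i \<in> {1..k}\<close> by (auto simp: run_down)
  next
    case False
    then obtain d where "i = Suc d" "c \<le> d" by (cases i) auto
    then show ?thesis unfolding e_word_def using c k \<open>i \<in> {1..k}\<close> by (auto simp: run_down)
  qed
next
  case False
  have "set w \<subseteq> {..<k} \<Longrightarrow> w \<noteq> [] \<Longrightarrow> run k w (Some i) = None" for w
    using False by (cases w) auto
  from this[OF set_e_word[OF c]] show ?thesis using False by (auto simp: e_word_def)
qed

text \<open>Locality of \<open>e\<close> is applied to the word of an idempotent: \<open>e d\<close>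
  slides through \<open>e_word c\<close>, whose partial map fixes \<open>d\<close>.\<close>

lemma e_commute: "c \<in> {1..k} \<Longrightarrow> d \<in> {1..k} \<Longrightarrow> e c * e d = e d * e c"
  using local_run[OF local_e set_e_word[of c], of d d] local_run_dom[OF local_e set_e_word[of c], of c]
    local_run_ran[OF local_e set_e_word[of c], of c]
  by (cases "c = d") (auto simp: run_e_word ev_e_word)

lemma e_idem: "c \<in> {1..k} \<Longrightarrow> e c * e c = e c"
  using local_run_dom[OF local_e set_e_word[of c], of c] by (auto simp: run_e_word ev_e_word)

lemma prod_e_absorb:
  "set cs \<subseteq> {1..k} \<Longrightarrow> c \<in> set cs \<Longrightarrow> prod_list (map e cs) * e c = prod_list (map e cs)"
proof (induction cs)
  case (Cons d cs)
  show ?case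
  proof (cases "c \<in> set cs")
    case True
    then show ?thesis using Cons by (simp add: mult.assoc)
  next
    case False
    then have c: "c = d" using Cons by simp
    have "e d * prod_list (map e cs) = prod_list (map e cs) * e d" using Cons.prems(1)
    proof (induction cs)
      case (Cons a cs)
      have 1: "e d * e a = e a * e d" using Cons.prems by (intro e_commute) auto
      have 2: "e d * prod_list (map e cs) = prod_list (map e cs) * e d" using Cons by simp
      show ?case by (simp add: mult.assoc assoc2[OF 1] 2)
    qed simp
    moreover have "e d * e d = e d" using Cons.prems e_idem by simp
    ultimately show ?thesis unfolding c by (simp add: mult.assoc)
  qed
qed simp

lemma set_filter_upt: "set (filter (\<lambda>c. c \<notin> D) [1..<Suc k]) = {1..k} - D"
  by (auto simp: less_Suc_eq_le simp del: upt_Suc)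

definition restrict_word :: "nat set \<Rightarrow> nat list"
  where "restrict_word D = concat (map e_word (filter (\<lambda>c. c \<notin> D) [1..<Suc k]))"

lemma set_restrict_word: "set (restrict_word D) \<subseteq> {..<k}"
  using set_e_word by (fastforce simp: restrict_word_def)

lemma ev_restrict_word: "ev g (restrict_word D) = prod_list (map e (filter (\<lambda>c. c \<notin> D) [1..<Suc k]))"
proof -
  have "ev g (concat (map e_word cs)) = prod_list (map e cs)" for cs
    by (induction cs) (auto simp: ev_e_word)
  then show ?thesis by (simp add: restrict_word_def)
qed

lemma run_restrict_word: "i \<in> {1..k} \<Longrightarrow> run k (restrict_word D) (Some i) = (if i \<in> D then Some i else None)"
proof -
  assume i: "i \<in> {1..k}"
  have "set cs \<subseteq> {1..k} \<Longrightarrow>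
      run k (concat (map e_word cs)) (Some i) = (if i \<in> set cs then None else Some i)" for cs
    by (induction cs) (use i in \<open>auto simp: run_e_word\<close>)
  from this[of "filter (\<lambda>c. c \<notin> D) [1..<Suc k]"] show ?thesis
    using i unfolding restrict_word_def set_filter_upt by auto
qed

section \<open>Independence of the way in which a set is pushed to the top\<close>

text \<open>Expresses that the image of \<open>t\<close> is contained in \<open>D\<close>, in a form
  that makes sense for any monoid element.\<close>

definition ends :: "'a \<Rightarrow> nat set \<Rightarrow> bool"
  where "ends t D \<longleftrightarrow> (\<forall>c \<in> {1..k} - D. t * e c = t)"

lemma ends_restrict: "ends (ev g (restrict_word D)) D"
  unfolding ends_def ev_restrict_word by (auto simp del: upt_Suc intro!: prod_e_absorb)

lemma restrict_absorb:
  assumes "set w \<subseteq> {..<k}" "\<And>c. c \<in> {1..k} - D \<Longrightarrow> run k w (Some c) = None"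
  shows "ev g (restrict_word D) * ev g w = ev g w"
proof -
  have "set cs \<subseteq> {1..k} - D \<Longrightarrow> prod_list (map e cs) * ev g w = ev g w" for cs
    using local_run_dom[OF local_e assms(1)] assms(2) by (induction cs) (auto simp: mult.assoc)
  from this[OF eq_refl[OF set_filter_upt]] show ?thesis unfolding ev_restrict_word .
qed

lemma ends_run:
  assumes "ends t D" "set w \<subseteq> {..<k}"
  shows "ends (t * ev g w) (image_run k w D)"
  unfolding ends_def
proof
  fix c assume c: "c \<in> {1..k} - image_run k w D"
  show "t * ev g w * e c = t * ev g w"
  proof (cases "\<exists>c'. run k w (Some c') = Some c")
    case True
    then obtain c' where c': "run k w (Some c') = Some c" by blast
    then have "c' \<in> {1..k} - D" using c run_SomeD[OF assms(2) c'] by (auto simp: image_run_def)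
    then have 1: "t * e c' = t" using assms(1) by (simp add: ends_def)
    have 2: "ev g w * e c = e c' * ev g w" using local_run[OF local_e assms(2) c'] .
    show ?thesis by (simp add: mult.assoc 2 assoc2[OF 1])
  next
    case False
    then show ?thesis using local_run_ran[OF local_e assms(2)] c by (simp add: mult.assoc)
  qed
qed

text \<open>Once \<open>e p\<close> has been inserted, \<open>e_y_ee\<close> turns the move
  \<open>g p\<close> into \<open>e (Suc p)\<close>, and \<open>t\<close> absorbs both
  idempotents.\<close>

lemma ends_fixed:
  assumes "ends t D" "1 \<le> p" "p < k" "p \<notin> D" "Suc p \<notin> D"
  shows "t * g p = t"
proof -
  have 1: "t * e p = t" "t * e (Suc p) = t" using assms by (auto simp: ends_def)
  have "t * g p = t * (e p * g p)" using 1 by (simp add: mult.assoc[symmetric])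
  also have "\<dots> = t" using e_y_ee[of p] assms 1 by (simp add: mult.assoc[symmetric])
  finally show ?thesis .
qed

lemma up_unique:
  "D \<subseteq> {1..k} \<Longrightarrow> ends t D \<Longrightarrow> up k D u \<Longrightarrow> up k D w \<Longrightarrow> t * ev g u = t * ev g w"
proof (induction "height k D" arbitrary: D t u w rule: less_induct)
  case less
  let ?s = "\<lambda>p. insert (Suc p) (D - {p})"
  from less.prems(3) show ?case
  proof cases
    case up_Nil
    from less.prems(4) show ?thesis using up_Nil by cases auto
  next
    case p: (up_Cons p u')
    from less.prems(4) show ?thesis
    proof cases
      case up_Nil
      then show ?thesis using p by auto
    next
      case q: (up_Cons q w')
      have ends1: "ends (t * g p) (?s p)" if "1 \<le> p" "p < k" "p \<in> D" "Suc p \<notin> D" for p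
        using ends_run[OF less.prems(2), of "[p]"] image_run_y[OF less.prems(1), of p] that by simp
      have sub: "?s p \<subseteq> {1..k}" "?s q \<subseteq> {1..k}" using less.prems(1) p q by auto
      note hp = height_less[OF less.prems(1) p(3-5)] and hq = height_less[OF less.prems(1) q(3-5)]
      show ?thesis
      proof (cases "p = q")
        case True
        then show ?thesis
          using less.hyps[OF hp sub(1) ends1[OF p(2-5)] p(6), of w'] p q by (simp add: mult.assoc)
      next
        case False
        then have far: "Suc p < q \<or> Suc q < p" using p q by (metis linorder_neqE_nat Suc_lessI)
        \<comment> \<open>The set after both moves, in either order. Any continuation
          \<open>v\<close> from there joins the two given words.\<close>
        let ?E = "insert (Suc q) (?s p - {q})"
        have E: "?E = insert (Suc p) (?s q - {p})" using far by auto
        have "?E \<subseteq> {1..k}" using sub q by auto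
        then obtain v where v: "up k ?E v" using up_exists by blast
        have 1: "up k (?s p) (q # v)" using q far False by (intro up.up_Cons v) auto
        have 2: "up k (?s q) (p # v)" using p far False v unfolding E by (intro up.up_Cons) auto
        have c: "g p * g q = g q * g p" using far'[of q p] far p q by auto
        have "t * ev g u = t * g p * ev g (q # v)"
          using less.hyps[OF hp sub(1) ends1[OF p(2-5)] p(6) 1] p by (simp add: mult.assoc)
        also have "\<dots> = t * g q * ev g (p # v)"
          by (simp add: mult.assoc assoc2[OF c])
        also have "\<dots> = t * ev g w"
          using less.hyps[OF hq sub(2) ends1[OF q(2-5)] q(6) 2] q by (simp add: mult.assoc)
        finally show ?thesis .
      qed
    qed
  qed
qed

text \<open>The induction is needed twice: for the letters \<open>1, ..., k - 1\<close>, and then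
  for all letters, where the case of the letter \<open>0\<close> uses the first result.\<close>

lemma up_words:
  assumes S: "S \<subseteq> {..<k}"
    and letter: "\<And>p t D u v. \<lbrakk>p \<in> S; D \<subseteq> {1..k}; ends t D; \<forall>i\<in>D. step k p (Some i) \<noteq> None;
        up k D u; up k (image_run k [p] D) v\<rbrakk> \<Longrightarrow> t * g p * ev g v = t * ev g u"
  shows "\<lbrakk>set w \<subseteq> S; D \<subseteq> {1..k}; ends t D; \<forall>i\<in>D. run k w (Some i) \<noteq> None;
      up k D u; up k (image_run k w D) v\<rbrakk> \<Longrightarrow> t * ev g w * ev g v = t * ev g u"
proof (induction w arbitrary: t D u)
  case Nil
  then show ?case using up_unique[OF Nil.prems(2,3) _ Nil.prems(5), of v] by simp
next
  case (Cons p w)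
  let ?D = "image_run k [p] D"
  have p: "p < k" "p \<in> S" using Cons.prems S by auto
  have nn: "step k p (Some i) \<noteq> None" if "i \<in> D" for i
  proof -
    have "run k w (step k p (Some i)) \<noteq> None" using Cons.prems(4) that by (simp del: step.simps(2))
    then show ?thesis by (metis run_None)
  qed
  have D: "?D \<subseteq> {1..k}" using Cons.prems p by (intro image_run_subset) auto
  obtain u' where u': "up k ?D u'" using up_exists[OF D] by blast
  have 1: "t * g p * ev g u' = t * ev g u"
    using letter[OF p(2) Cons.prems(2,3) _ Cons.prems(5) u'] nn by blast
  have "ends (t * g p) ?D" using ends_run[OF Cons.prems(3), of "[p]"] p by simp
  moreover have "\<forall>i\<in>?D. run k w (Some i) \<noteq> None"
    using Cons.prems(4) by (auto simp: image_run_def simp del: step.simps(2))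
  moreover have "up k (image_run k w ?D) v" using Cons.prems(6) by (metis image_run_Cons)
  ultimately have "t * g p * ev g w * ev g v = t * g p * ev g u'"
    using Cons.IH[OF _ D] Cons.prems(1) u' by simp
  then show ?case using 1 by (simp add: mult.assoc)
qed

lemma up_letter_y:
  assumes "p \<in> {1..<k}" "D \<subseteq> {1..k}" "ends t D" "\<forall>i\<in>D. step k p (Some i) \<noteq> None"
    "up k D u" "up k (image_run k [p] D) v"
  shows "t * g p * ev g v = t * ev g u"
proof -
  have "Suc p \<notin> D" using assms(1,4) by auto
  show ?thesis
  proof (cases "p \<in> D")
    case True
    then have "up k D (p # v)"
      using assms image_run_y[OF assms(2), of p] \<open>Suc p \<notin> D\<close> by (intro up_Cons) auto
    from up_unique[OF assms(2,3) this assms(5)] show ?thesis by (simp add: mult.assoc)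
  next
    case False
    then have "image_run k [p] D = D" using assms image_run_y[OF assms(2), of p] \<open>Suc p \<notin> D\<close> by auto
    then have "up k D v" using assms(6) by simp
    moreover have "t * g p = t" using ends_fixed[OF assms(3)] assms(1) False \<open>Suc p \<notin> D\<close> by simp
    ultimately show ?thesis using up_unique[OF assms(2,3) _ assms(5)] by simp
  qed
qed

lemma up_run_y:
  assumes "set w \<subseteq> {1..<k}" "D \<subseteq> {1..k}" "ends t D" "\<forall>i\<in>D. run k w (Some i) \<noteq> None"
    "up k D u" "up k (image_run k w D) v"
  shows "t * ev g w * ev g v = t * ev g u"
  by (rule up_words[OF _ _ assms], force) (rule up_letter_y)

text \<open>The letter \<open>0\<close> can be applied to all of \<open>D\<close> only if
  \<open>1\<close> is not in \<open>D\<close>, and then \<open>t\<close> absorbs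
  \<open>e 1 = g 0 * down g 1 k\<close>. So \<open>rev [1..<k]\<close>, a word without
  \<open>0\<close>, leads from the image back to \<open>D\<close>, and \<open>up_run_y\<close>
  applies to it.\<close>

lemma up_letter:
  assumes "p \<in> {..<k}" "D \<subseteq> {1..k}" "ends t D" "\<forall>i\<in>D. step k p (Some i) \<noteq> None"
    "up k D u" "up k (image_run k [p] D) v"
  shows "t * g p * ev g v = t * ev g u"
proof (cases "p = 0")
  case False
  then show ?thesis using assms up_letter_y by auto
next
  case True
  let ?D = "image_run k [0] D" and ?w = "rev [1..<k]"
  have one: "1 \<notin> D"
  proof
    assume "1 \<in> D"
    then have "step k 0 (Some 1) \<noteq> None" using assms(4) True by blast
    then show False using k by simp
  qed
  have Dr: "?D \<subseteq> {1..k}" using assms k by (intro image_run_subset) auto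
  have e: "ends (t * g 0) ?D" using ends_run[OF assms(3), of "[0]"] k by simp
  have mem: "1 \<le> i \<and> i < k \<and> Suc i \<in> D" if "i \<in> ?D" for i
    using that assms(2) one by (force simp: image_run_def split: if_splits)
  have run: "run k ?w (Some i) = Some (Suc i)" if "i \<in> ?D" for i
    using mem[OF that] by (subst run_down) auto
  have "image_run k ?w ?D = Suc ` ?D" using run by (auto simp: image_run_def[of k ?w] simp del: One_nat_def)
  also have "\<dots> = D"
  proof -
    have "i \<in> Suc ` ?D" if i: "i \<in> D" for i
    proof -
      have "1 < i" "i \<le> k" using i assms(2) one by (metis atLeastAtMost_iff le_neq_implies_less subsetD, auto)
      then have "i - 1 \<in> ?D" using i by (auto simp: image_run_def intro!: bexI[of _ i])
      then show ?thesis using \<open>1 < i\<close> by (metis Suc_pred' image_eqI less_trans zero_less_one)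
    qed
    then show ?thesis using mem by auto
  qed
  finally have im: "image_run k ?w ?D = D" .
  have "t * g 0 * ev g ?w * ev g u = t * g 0 * ev g v"
    using up_run_y[of ?w ?D "t * g 0" v u] Dr e run im assms(5,6) True by simp
  moreover have "t * g 0 * ev g ?w = t * e 1"
    by (simp add: ev_down e_def mult.assoc)
  moreover have "t * e 1 = t" using assms(3) one k by (auto simp: ends_def)
  ultimately show ?thesis using True by simp
qed

lemma up_run:
  assumes "set w \<subseteq> {..<k}" "D \<subseteq> {1..k}" "ends t D" "\<forall>i\<in>D. run k w (Some i) \<noteq> None"
    "up k D u" "up k (image_run k w D) v"
  shows "t * ev g w * ev g v = t * ev g u"
  by (rule up_words[OF order_refl _ assms]) (rule up_letter)

text \<open>A move \<open>g p\<close> is undone by \<open>z p\<close>, spelt as the word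
  \<open>?z\<close>, because \<open>g p * z p = e (Suc p)\<close> and block \<open>p + 1\<close> is
  unoccupied before the move.\<close>

lemma up_inverse:
  "up k D u \<Longrightarrow> D \<subseteq> {1..k} \<Longrightarrow> \<exists>v. set v \<subseteq> {..<k} \<and> (\<forall>t. ends t D \<longrightarrow> t * ev g u * ev g v = t) \<and>
    (\<forall>i\<in>D. run k (u @ v) (Some i) = Some i)"
proof (induction rule: up.induct)
  case (up_Nil D)
  then show ?case by (intro exI[of _ "[]"]) auto
next
  case (up_Cons p D u)
  let ?E = "insert (Suc p) (D - {p})" and ?z = "rev [1..<p] @ [0] @ rev [Suc p..<k]"
  have E: "?E \<subseteq> {1..k}" using up_Cons by auto
  then obtain v where v: "set v \<subseteq> {..<k}" "\<And>t. ends t ?E \<Longrightarrow> t * ev g u * ev g v = t"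
    "\<And>i. i \<in> ?E \<Longrightarrow> run k (u @ v) (Some i) = Some i"
    using up_Cons.IH by metis
  have ez: "ev g ?z = z p" by (simp add: z_def ev_down mult.assoc del: One_nat_def)
  have z: "run k ?z (Some i) = (if i = Suc p then Some p else if i = p then None else Some i)"
    if "i \<in> {1..k}" for i
  proof (cases "i \<le> p")
    case True
    then show ?thesis using that up_Cons(1,2) by (auto simp: run_down)
  next
    case False
    then obtain d where "i = Suc d" "p \<le> d" by (cases i) auto
    then show ?thesis using that up_Cons(1,2) by (auto simp: run_down)
  qed
  show ?case
  proof (intro exI[of _ "v @ ?z"] conjI allI impI ballI)
    show "set (v @ ?z) \<subseteq> {..<k}" using v(1) up_Cons(1,2) by auto
  next
    fix t assume t: "ends t D"
    have "ends (t * g p) ?E"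
      using ends_run[OF t, of "[p]"] image_run_y[OF up_Cons.prems, of p] up_Cons by simp
    from v(2)[OF this] have "t * ev g (p # u) * ev g (v @ ?z) = t * g p * z p"
      unfolding ev_simps(3)[of g v] ez by (simp add: mult.assoc[symmetric])
    also have "\<dots> = t * e (Suc p)" using y_z[OF up_Cons(1)] by (simp add: mult.assoc)
    also have "\<dots> = t" using t up_Cons by (auto simp: ends_def)
    finally show "t * ev g (p # u) * ev g (v @ ?z) = t" .
  next
    fix i assume i: "i \<in> D"
    then have ik: "i \<in> {1..k}" "i \<noteq> Suc p" using up_Cons by auto
    define j where "j = (if i = p then Suc p else i)"
    have s: "step k p (Some i) = Some j" using ik up_Cons(1,2) by (auto simp: j_def)
    have j: "j \<in> ?E" "j \<in> {1..k}" using i E by (auto simp: j_def)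
    have "run k ((p # u) @ v @ ?z) (Some i) = run k ?z (run k (u @ v) (Some j))"
      using s by (simp del: step.simps(2))
    also have "\<dots> = run k ?z (Some j)" using v(3)[OF j(1)] by simp
    also have "\<dots> = Some i" using z[OF j(2)] ik by (auto simp: j_def)
    finally show "run k ((p # u) @ v @ ?z) (Some i) = Some i" .
  qed
qed

theorem run_complete:
  assumes u: "set u \<subseteq> {..<k}" and w: "set w \<subseteq> {..<k}"
    and eq: "\<And>i. i \<in> {1..k} \<Longrightarrow> run k u (Some i) = run k w (Some i)"
  shows "ev g u = ev g w"
proof -
  define D where "D = {i \<in> {1..k}. run k u (Some i) \<noteq> None}"
  define f where "f = ev g (restrict_word D)"
  let ?E = "image_run k u D"
  have im: "image_run k w D = ?E" using eq by (auto simp: image_run_def D_def)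
  have D: "D \<subseteq> {1..k}" by (auto simp: D_def)
  have E: "?E \<subseteq> {1..k}" using image_run_subset[OF u D] .
  obtain d where d: "up k D d" using up_exists[OF D] by blast
  obtain c where c: "up k ?E c" using up_exists[OF E] by blast
  obtain c' where c': "\<And>t. ends t ?E \<Longrightarrow> t * ev g c * ev g c' = t"
    using up_inverse[OF c E] by blast
  have f: "ends f D" unfolding f_def by (rule ends_restrict)
  \<comment> \<open>The right-hand side depends only on the domain \<open>D\<close> and the image
    \<open>?E\<close>, which \<open>u\<close> and \<open>w\<close> share.\<close>
  have key: "ev g v = f * ev g d * ev g c'"
    if v: "set v \<subseteq> {..<k}" "image_run k v D = ?E" "\<And>i. i \<in> {1..k} \<Longrightarrow> run k u (Some i) = run k v (Some i)" for v
  proof -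
    have "ev g v = f * ev g v"
      unfolding f_def using v(3) by (intro restrict_absorb[symmetric] v(1)) (auto simp: D_def)
    moreover have "ends (f * ev g v) ?E" using ends_run[OF f v(1)] v(2) by simp
    moreover have "\<forall>i\<in>D. run k v (Some i) \<noteq> None" by (auto simp: D_def v(3)[symmetric])
    then have "f * ev g v * ev g c = f * ev g d"
      using up_run[OF v(1) D f _ d, of c] v(2) c by simp
    ultimately show ?thesis using c' by metis
  qed
  show ?thesis using key[OF u] key[OF w im eq] by simp
qed

end

section \<open>Every strictly increasing partial map on blocks comes from a word\<close>

text \<open>At the first disagreement \<open>x\<close> the smaller of the two values must be taken
  by the other function as well, by monotonicity at an earlier point. There the functions agree, so
  one of them takes a value twice.\<close>

lemma strict_mono_on_image_unique:
  fixes f h :: "nat \<Rightarrow> nat"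
  assumes f: "strict_mono_on D f" and h: "strict_mono_on D h" and im: "f ` D = h ` D" and x: "x \<in> D"
  shows "f x = h x"
  using x
proof (induction x rule: less_induct)
  case (less x)
  have aux: "f x \<ge> h x"
    if f: "strict_mono_on D f" and h: "strict_mono_on D h" and im: "f ` D = h ` D"
      and IH: "\<And>y. y < x \<Longrightarrow> y \<in> D \<Longrightarrow> f y = h y" for f h :: "nat \<Rightarrow> nat"
  proof (rule ccontr)
    assume "\<not> f x \<ge> h x"
    moreover obtain y where y: "y \<in> D" "f x = h y" using im less.prems by blast
    ultimately have "h y < h x" by simp
    then have "y < x" using y(1) less.prems h by (metis linorder_less_linear order_less_asym strict_mono_onD)
    then show False using IH[OF _ y(1)] strict_mono_onD[OF f y(1) less.prems] y by simp
  qed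
  show ?case using aux[OF f h im] aux[OF h f im[symmetric]] less.IH by fastforce
qed

text \<open>A set that admits no further move is empty or an interval ending in \<open>k\<close>.
  Moves preserve the number of elements, so the final interval depends on \<open>card D\<close>
  only.\<close>

lemma up_run_terminal:
  "up k D u \<Longrightarrow> D \<subseteq> {1..k} \<Longrightarrow>
    (\<forall>i\<in>D. run k u (Some i) \<noteq> None) \<and> image_run k u D = {Suc k - card D..k}"
proof (induction rule: up.induct)
  case (up_Nil D)
  have f: "finite D" using up_Nil.prems finite_subset by blast
  show ?case
  proof (cases "D = {}")
    case False
    define l where "l = Min D"
    have l: "l \<in> D" "\<And>i. i \<in> D \<Longrightarrow> l \<le> i" using f False by (auto simp: l_def)
    have add: "l + i \<le> k \<Longrightarrow> l + i \<in> D" for i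
    proof (induction i)
      case 0
      then show ?case using l by simp
    next
      case (Suc i)
      then show ?case using up_Nil.hyps[of "l + i"] up_Nil.prems l(1) by force
    qed
    have "j \<in> D" if "l \<le> j" "j \<le> k" for j using add[of "j - l"] that by simp
    then have "D = {l..k}" using l(2) up_Nil.prems by auto
    moreover have "l \<le> k" using l up_Nil.prems by auto
    ultimately show ?thesis by auto
  qed simp
next
  case (up_Cons p D u)
  let ?E = "insert (Suc p) (D - {p})"
  have E: "?E \<subseteq> {1..k}" using up_Cons by auto
  have im: "image_run k [p] D = ?E" using image_run_y[OF up_Cons.prems] up_Cons by simp
  have "finite D" using up_Cons.prems finite_subset by blast
  then have "card ?E = card D" using up_Cons(3,4) card_Suc_Diff1[of D p] by simp
  then have "image_run k (p # u) D = {Suc k - card D..k}"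
    using up_Cons.IH[OF E] image_run_Cons[of k p u D] im by simp
  moreover have "run k (p # u) (Some i) \<noteq> None" if i: "i \<in> D" for i
  proof -
    have "i \<in> {1..k}" "i \<noteq> Suc p" using i up_Cons by auto
    then have "step k p (Some i) = Some (if i = p then Suc p else i)" using up_Cons(1) by auto
    moreover have "(if i = p then Suc p else i) \<in> ?E" using i by auto
    ultimately show ?thesis using up_Cons.IH[OF E] i by (auto simp del: step.simps(2) not_None_eq)
  qed
  ultimately show ?case by blast
qed

context order_relations
begin

text \<open>Push the domain to the top and undo the moves that push the image there. The two top
  intervals coincide since domain and image have equal size, and a strictly increasing map is
  determined by domain and image.\<close>

theorem run_surj:
  fixes \<beta> :: "nat \<Rightarrow> nat option"
  assumes dom: "dom \<beta> \<subseteq> {1..k}" and ran: "ran \<beta> \<subseteq> {1..k}"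
    and mono: "strict_mono_on (dom \<beta>) (\<lambda>i. the (\<beta> i))"
  obtains w where "set w \<subseteq> {..<k}" "\<And>i. i \<in> {1..k} \<Longrightarrow> run k w (Some i) = \<beta> i"
proof -
  let ?D = "dom \<beta>" and ?E = "ran \<beta>"
  obtain u where u: "up k ?D u" "set u \<subseteq> {1..<k}" using up_exists[OF dom] by blast
  obtain c where c: "up k ?E c" using up_exists[OF ran] by blast
  obtain c' where c': "set c' \<subseteq> {..<k}" "\<And>i. i \<in> ?E \<Longrightarrow> run k (c @ c') (Some i) = Some i"
    using up_inverse[OF c ran] by blast
  have ranE: "?E = (\<lambda>i. the (\<beta> i)) ` ?D" by (force simp: ran_def dom_def)
  then have "card ?E = card ?D" using mono by (simp add: card_image strict_mono_on_imp_inj_on)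
  then have T: "image_run k u ?D = image_run k c ?E"
    using up_run_terminal[OF u(1) dom] up_run_terminal[OF c ran] by simp
  let ?w = "restrict_word ?D @ u @ c'"
  define \<gamma> where "\<gamma> = (\<lambda>i. run k (u @ c') (Some i))"
  have \<gamma>1: "\<exists>j\<in>?E. \<gamma> i = Some j" if i: "i \<in> ?D" for i
  proof -
    obtain a where a: "run k u (Some i) = Some a" using up_run_terminal[OF u(1) dom] i by blast
    then have "a \<in> image_run k u ?D" using i unfolding image_run_def by blast
    then have "a \<in> image_run k c ?E" unfolding T .
    then obtain j where j: "j \<in> ?E" "run k c (Some j) = Some a" by (auto simp: image_run_def)
    then have "run k c' (Some a) = Some j" using c'(2)[of j] by simp
    then show ?thesis using a j by (simp add: \<gamma>_def)
  qed
  have \<gamma>2: "\<exists>i\<in>?D. \<gamma> i = Some j" if j: "j \<in> ?E" for j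
  proof -
    obtain a where a: "run k c (Some j) = Some a" using up_run_terminal[OF c ran] j by blast
    then have "a \<in> image_run k c ?E" using j unfolding image_run_def by blast
    then have "a \<in> image_run k u ?D" unfolding T .
    then obtain i where i: "i \<in> ?D" "run k u (Some i) = Some a" unfolding image_run_def by blast
    then have "\<gamma> i = Some j" using c'(2)[OF j] a by (simp add: \<gamma>_def)
    then show ?thesis using i by blast
  qed
  have "strict_mono_on ?D (\<lambda>i. the (\<gamma> i))"
  proof (rule strict_mono_onI)
    fix i i' assume i: "i \<in> ?D" "i' \<in> ?D" "i < i'"
    obtain j j' where "\<gamma> i = Some j" "\<gamma> i' = Some j'" using \<gamma>1 i by meson
    then show "the (\<gamma> i) < the (\<gamma> i')" using run_mono[of k "u @ c'" i j i' j'] i by (simp add: \<gamma>_def)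
  qed
  moreover have "(\<lambda>i. the (\<gamma> i)) ` ?D = (\<lambda>i. the (\<beta> i)) ` ?D"
    unfolding ranE[symmetric] using \<gamma>1 \<gamma>2 by (force simp: image_iff)
  ultimately have eq: "the (\<gamma> i) = the (\<beta> i)" if "i \<in> ?D" for i
    using strict_mono_on_image_unique[OF _ mono] that by blast
  have "run k ?w (Some i) = \<beta> i" if i: "i \<in> {1..k}" for i
  proof (cases "i \<in> ?D")
    case True
    then have "\<gamma> i = \<beta> i" using eq[OF True] \<gamma>1[OF True] by auto
    then show ?thesis using True i by (simp add: run_restrict_word \<gamma>_def)
  next
    case False
    then show ?thesis using i by (simp add: run_restrict_word domIff)
  qed
  moreover have "set ?w \<subseteq> {..<k}" using set_restrict_word u(2) c'(1) by fastforce
  ultimately show thesis using that by blast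
qed

end

section \<open>The symmetric groups\<close>

text \<open>Functions as a monoid; as everywhere here, the left factor is applied first.\<close>

typedef 'a endo = "UNIV :: ('a \<Rightarrow> 'a) set"
  morphisms app Endo by simp

instantiation endo :: (type) monoid_mult
begin

definition one_endo :: "'a endo" where "1 = Endo id"
definition times_endo :: "'a endo \<Rightarrow> 'a endo \<Rightarrow> 'a endo" where "f * g = Endo (app g \<circ> app f)"

instance
  by standard (simp_all add: one_endo_def times_endo_def Endo_inverse app_inverse comp_assoc)

end

lemma app_simps [simp]: "app 1 x = x" "app (f * g) x = app g (app f x)" "app (Endo h) x = h x"
  by (simp_all add: one_endo_def times_endo_def Endo_inverse)

lemma endo_eqI: "(\<And>x. app f x = app g x) \<Longrightarrow> f = g"
  by (metis app_inject ext)

text \<open>The \<open>n\<close> Coxeter generators belong to the symmetric group on the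
  \<open>n + 1\<close> points \<open>0, ..., n\<close>, where \<open>s i\<close> exchanges
  \<open>i\<close> and \<open>i + 1\<close>.\<close>

definition coxeter :: "nat \<Rightarrow> (nat \<Rightarrow> 'a::monoid_mult) \<Rightarrow> bool"
  where "coxeter n s \<longleftrightarrow> (\<forall>i<n. s i * s i = 1) \<and>
    (\<forall>i j. Suc i < j \<longrightarrow> j < n \<longrightarrow> s j * s i = s i * s j) \<and>
    (\<forall>i. Suc i < n \<longrightarrow> s i * s (Suc i) * s i = s (Suc i) * s i * s (Suc i))"

lemma coxeter_commute: "coxeter n s \<Longrightarrow> Suc i < j \<Longrightarrow> j < n \<Longrightarrow> s i * s j = s j * s i"
  by (simp add: coxeter_def)

lemma coxeter_less: "coxeter n s \<Longrightarrow> n' \<le> n \<Longrightarrow> coxeter n' s"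
  by (simp add: coxeter_def)

lemma coxeter_down_shift:
  assumes "coxeter n s" "j \<le> i" "Suc i < n"
  shows "down s j n * s (Suc i) = s i * down s j n"
proof -
  have d: "down s j n = down s (Suc (Suc i)) n * (s (Suc i) * (s i * down s j i))"
    using assms down_split[of j "Suc (Suc i)" n s] by (simp add: down_Suc)
  have 1: "s i * down s (Suc (Suc i)) n = down s (Suc (Suc i)) n * s i"
    by (rule commute_down, rule coxeter_commute[OF assms(1)]) auto
  have 2: "s (Suc i) * down s j i = down s j i * s (Suc i)"
    using assms by (intro commute_down) (auto simp: coxeter_def)
  have 3: "s (Suc i) * (s i * s (Suc i)) = s i * (s (Suc i) * s i)"
    using assms by (auto simp: coxeter_def mult.assoc)
  show ?thesis unfolding d
    by (simp add: mult.assoc 2[symmetric] assoc2[OF 1] assoc3[OF 3])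
qed

text \<open>The products \<open>down s j n\<close> represent the cosets of the subgroup generated by
  all generators but the last. Two families are treated at once so that the same \<open>w'\<close>
  and \<open>j\<close> serve for the abstract generators and for the transpositions.\<close>

lemma coxeter_reduce:
  assumes s: "coxeter n s" and t: "coxeter n t" and w: "set w \<subseteq> {..<n}"
  shows "\<exists>w' j. set w' \<subseteq> {..<n - 1} \<and> j \<le> n \<and>
    ev s w = ev s w' * down s j n \<and> ev t w = ev t w' * down t j n"
  using w
proof (induction w rule: rev_induct)
  case Nil
  show ?case by (rule exI[of _ "[]"], rule exI[of _ n]) simp
next
  case (snoc i w)
  then obtain w' j where w': "set w' \<subseteq> {..<n - 1}" "j \<le> n"
    "ev s w = ev s w' * down s j n" "ev t w = ev t w' * down t j n" by auto
  have i: "i < n" using snoc.prems by simp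
  \<comment> \<open>The new letter either commutes with the coset factor and joins
    \<open>w'\<close>, or lengthens the factor, or cancels its last letter, or passes through it
    with its index lowered by one.\<close>
  consider "Suc i < j" | "j = Suc i" | "i = j" | i' where "i = Suc i'" "j \<le> i'"
    by (cases "i < j"; cases i) force+
  then show ?case
  proof cases
    case 1
    have "s i * down s j n = down s j n * s i" "t i * down t j n = down t j n * t i"
      by (rule commute_down, use 1 in \<open>auto intro!: coxeter_commute[OF s] coxeter_commute[OF t]\<close>)+
    then show ?thesis using w' 1
      by (intro exI[of _ "w' @ [i]"] exI[of _ j]) (auto simp: mult.assoc)
  next
    case 2
    then show ?thesis using w' i down_last[of i n s] down_last[of i n t]
      by (intro exI[of _ w'] exI[of _ i]) (auto simp: mult.assoc)
  next
    case 3
    have "s i * s i = 1" "t i * t i = 1" using s t i by (auto simp: coxeter_def)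
    then show ?thesis using w' 3 i down_last[of i n s] down_last[of i n t]
      by (intro exI[of _ w'] exI[of _ "Suc i"]) (auto simp: mult.assoc)
  next
    case 4
    then show ?thesis
      using w' i coxeter_down_shift[OF s, of j i'] coxeter_down_shift[OF t, of j i']
      by (intro exI[of _ "w' @ [i']"] exI[of _ j]) (auto simp: mult.assoc)
  qed
qed

lemma ev_rev_inverse:
  "(\<And>i. i \<in> set w \<Longrightarrow> s i * s i = 1) \<Longrightarrow> ev s w * ev s (rev w) = 1"
proof (induction w)
  case (Cons i w)
  then have 1: "ev s w * ev s (rev w) = 1" and 2: "s i * s i = 1" by auto
  show ?case by (simp add: mult.assoc assoc2[OF 1] 2)
qed simp

definition swap :: "nat \<Rightarrow> nat endo" where "swap j = Endo (transpose j (Suc j))"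

lemma app_swap: "app (swap j) i = (if i = j then Suc j else if i = Suc j then j else i)"
  by (simp add: swap_def transpose_def)

lemma coxeter_swap: "coxeter n swap"
  unfolding coxeter_def swap_def
proof (intro conjI allI impI endo_eqI)
  fix i x :: nat
  show "app (Endo (transpose i (Suc i)) * Endo (transpose (Suc i) (Suc (Suc i))) *
      Endo (transpose i (Suc i))) x =
    app (Endo (transpose (Suc i) (Suc (Suc i))) * Endo (transpose i (Suc i)) *
      Endo (transpose (Suc i) (Suc (Suc i)))) x"
    by (cases "x = i"; cases "x = Suc i"; cases "x = Suc (Suc i)") simp_all
next
  fix i j x :: nat assume "Suc i < j"
  then show "app (Endo (transpose j (Suc j)) * Endo (transpose i (Suc i))) x =
      app (Endo (transpose i (Suc i)) * Endo (transpose j (Suc j))) x"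
    by (cases "x = i"; cases "x = Suc i"; cases "x = j"; cases "x = Suc j") simp_all
qed simp

lemma app_down_swap:
  "app (down swap j n) i = (if n \<le> j then i else if i = n then j else if j \<le> i \<and> i < n then Suc i else i)"
proof (induction n arbitrary: i)
  case (Suc n)
  show ?case
    by (cases "j \<le> n") (auto simp: down_Suc Suc.IH app_swap)
qed simp

lemma app_ev_swap_fixed: "set w \<subseteq> {..<n} \<Longrightarrow> n < i \<Longrightarrow> app (ev swap w) i = i"
  by (induction w) (auto simp: app_swap)

text \<open>The permutation sends the largest point to the index of the coset factor, so equal
  permutations have equal coset factors. Cancelling these leaves words in one generator
  fewer.\<close>

theorem coxeter_complete:
  "coxeter n s \<Longrightarrow> set u \<subseteq> {..<n} \<Longrightarrow> set w \<subseteq> {..<n} \<Longrightarrow> ev swap u = ev swap w \<Longrightarrow> ev s u = ev s w"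
proof (induction n arbitrary: u w)
  case (Suc n)
  obtain u' i where u: "set u' \<subseteq> {..<n}" "i \<le> Suc n" "ev s u = ev s u' * down s i (Suc n)"
      "ev swap u = ev swap u' * down swap i (Suc n)"
    using coxeter_reduce[OF Suc.prems(1) coxeter_swap Suc.prems(2)] by auto
  obtain w' j where w: "set w' \<subseteq> {..<n}" "j \<le> Suc n" "ev s w = ev s w' * down s j (Suc n)"
      "ev swap w = ev swap w' * down swap j (Suc n)"
    using coxeter_reduce[OF Suc.prems(1) coxeter_swap Suc.prems(3)] by auto
  have eq: "ev swap u' * down swap i (Suc n) = ev swap w' * down swap j (Suc n)"
    using Suc.prems u w by simp
  have "app (ev swap u' * down swap i (Suc n)) (Suc n) = i"
    using u by (auto simp: app_ev_swap_fixed app_down_swap)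
  moreover have "app (ev swap w' * down swap j (Suc n)) (Suc n) = j"
    using w by (auto simp: app_ev_swap_fixed app_down_swap)
  ultimately have ij: "i = j" using eq by simp
  have inv: "down swap j (Suc n) * ev swap [j..<Suc n] = 1"
    using ev_rev_inverse[of "rev [j..<Suc n]" swap] coxeter_swap[of "Suc n"]
    by (simp add: ev_down coxeter_def del: upt_Suc)
  have "ev swap u' = ev swap u' * down swap i (Suc n) * ev swap [j..<Suc n]"
    using inv by (simp add: ij mult.assoc del: upt_Suc)
  also have "\<dots> = ev swap w'" unfolding eq using inv by (simp add: mult.assoc del: upt_Suc)
  finally have "ev swap u' = ev swap w'" .
  then have "ev s u' = ev s w'"
    using Suc.IH[OF coxeter_less[OF Suc.prems(1)] u(1) w(1)] by simp
  then show ?case using u w ij by simp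
qed simp

section \<open>Moore's relations for a transposition and a full cycle\<close>

text \<open>These are the relations of \<open>U\<close> for a single block, written with
  \<open>a = c b^(m-1)\<close>, hence \<open>c = a b\<close>. The standard model on
  \<open>{..<m}\<close> is the transposition of \<open>0\<close> and \<open>1\<close> and the cycle
  \<open>j\<close> to \<open>j + 1\<close>.\<close>

definition moore :: "nat \<Rightarrow> 'a::monoid_mult \<Rightarrow> 'a \<Rightarrow> bool"
  where "moore m a b \<longleftrightarrow> a * a = 1 \<and> b ^ m = 1 \<and> (b * a) ^ (m - 1) = 1 \<and>
    (a * b ^ (m - 1) * a * b) ^ 3 = 1 \<and>
    (\<forall>j. 2 \<le> j \<longrightarrow> j \<le> m - 2 \<longrightarrow> (a * b ^ (m - j) * a * b ^ j) ^ 2 = 1)"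

text \<open>Take \<open>s i = b^(-i) a b^i\<close>, with \<open>B = b ^ (m - 1)\<close> as inverse
  of \<open>b\<close>. The relations with exponent 2 say that \<open>s 0\<close> commutes with
  \<open>s j\<close>, the one with exponent 3 is the braid relation of \<open>s 0\<close> and
  \<open>s 1\<close>, and conjugation by powers of \<open>b\<close> spreads both to all
  indices.\<close>

lemma moore_coxeter:
  fixes a b :: "'a::monoid_mult"
  assumes m: "m \<ge> 2" and moore: "moore m a b"
  obtains s where "coxeter (m - 1) s" "a = s 0" "b = down s 0 (m - 1)"
proof -
  have bm: "b ^ m = 1" and aa: "a * a = 1" and ba: "(b * a) ^ (m - 1) = 1"
    and X3: "(a * b ^ (m - 1) * a * b) ^ 3 = 1"
    and X2: "\<And>j. 2 \<le> j \<Longrightarrow> j \<le> m - 2 \<Longrightarrow> (a * b ^ (m - j) * a * b ^ j) ^ 2 = 1"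
    using moore by (auto simp: moore_def)
  define B where "B = b ^ (m - 1)"
  define s where "s i = B ^ i * (a * b ^ i)" for i
  have bB: "b * B = 1" using bm m by (metis B_def One_nat_def Suc_1 Suc_diff_1 Suc_le_lessD less_trans power_Suc zero_less_one)
  have Bb: "B * b = 1" using bB by (simp add: B_def power_commutes)
  have pow_cancel: "x ^ i * y ^ i = 1" if "x * y = 1" for x y :: 'a and i
  proof (induction i)
    case (Suc i)
    have "x ^ Suc i * y ^ Suc i = x ^ i * (x * y) * y ^ i"
      unfolding power_Suc2[of x] power_Suc[of y] by (simp only: mult.assoc)
    then show ?case using Suc that by simp
  qed simp
  note pow = pow_cancel[OF bB] and pow' = pow_cancel[OF Bb]
  have conj: "B ^ i * (x * b ^ i) * (B ^ i * (y * b ^ i)) = B ^ i * (x * y * b ^ i)" for i x y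
    by (simp add: mult.assoc assoc2[OF pow])
  have s_add: "s (i + d) = B ^ i * (s d * b ^ i)" for i d
  proof -
    have "b ^ (i + d) = b ^ d * b ^ i" by (simp add: power_add[symmetric] add.commute)
    then show ?thesis by (simp add: s_def power_add mult.assoc)
  qed
  have s0: "s 0 = a" by (simp add: s_def)
  have s_conj: "s (i + d) * s (i + d') = B ^ i * (s d * s d' * b ^ i)" for i d d'
    unfolding s_add conj ..
  have inv: "s i * s i = 1" for i
    using s_conj[of i 0 0] pow'[of i] aa by (simp add: s0)
  have Bpow: "b ^ (m - d) = B ^ d" if "d \<le> m" for d
  proof -
    have "b ^ (m - d) = b ^ (m - d) * (b ^ d * B ^ d)" using pow by simp
    also have "\<dots> = b ^ m * B ^ d" using that by (simp add: mult.assoc[symmetric] power_add[symmetric])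
    finally show ?thesis using bm by simp
  qed
  have comm0: "s d * a = a * s d" if "2 \<le> d" "d \<le> m - 2" for d
  proof -
    have "(a * s d) * (a * s d) = 1"
      using X2[OF that] Bpow[of d] that by (simp add: s_def power2_eq_square mult.assoc)
    then have "s d * a * ((a * s d) * (a * s d)) = s d * a" by simp
    moreover have "s d * a * ((a * s d) * (a * s d)) = a * s d"
      using inv[of d] by (simp add: mult.assoc assoc2[OF aa] assoc2[OF inv[of d]])
    ultimately show ?thesis by simp
  qed
  have comm: "s j * s i = s i * s j" if "Suc i < j" "j < m - 1" for i j
  proof -
    define d where "d = j - i"
    have d: "j = i + d" "2 \<le> d" "d \<le> m - 2" using that by (auto simp: d_def)
    have "s j * s i = B ^ i * (s d * a * b ^ i)" "s i * s j = B ^ i * (a * s d * b ^ i)"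
      using s_conj[of i d 0] s_conj[of i 0 d] d(1) by (simp_all add: s0)
    then show ?thesis using comm0[OF d(2,3)] by simp
  qed
  have braid0: "a * s 1 * a = s 1 * a * s 1"
  proof -
    have 1: "a * (s 1 * (a * (s 1 * (a * s 1)))) = 1"
      using X3 by (simp add: s_def B_def power3_eq_cube mult.assoc)
    have "a * s 1 * a = a * (s 1 * (a * (s 1 * (a * s 1)))) * (s 1 * a * s 1)"
      using inv[of 1] by (simp add: mult.assoc assoc2[OF aa] assoc2[OF inv[of 1]] del: One_nat_def)
    then show ?thesis using 1 by simp
  qed
  have braid: "s i * s (Suc i) * s i = s (Suc i) * s i * s (Suc i)" for i
  proof -
    have i: "s i = B ^ i * (a * b ^ i)" and Si: "s (Suc i) = B ^ i * (s 1 * b ^ i)"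
      using s_add[of i 0] s_add[of i 1] by (simp_all add: s0)
    show ?thesis unfolding i Si conj braid0 ..
  qed
  \<comment> \<open>The powers of \<open>b\<close> and \<open>B\<close> between neighbouring factors
    nearly cancel and leave one \<open>b\<close> each. For \<open>n = m - 1\<close> the second
    factor is \<open>1\<close> by Moore's relations, and \<open>B ^ (m - 1) = b\<close>.\<close>
  have down: "down s 0 n = B ^ n * (b * a) ^ n" for n
  proof (induction n)
    case (Suc n)
    have 1: "B ^ n * a = B ^ Suc n * (b * a)"
      using Bb by (simp add: power_Suc2 mult.assoc del: power_Suc) (simp add: mult.assoc[symmetric])
    have "down s 0 (Suc n) = B ^ n * a * (b ^ n * B ^ n) * (b * a) ^ n"
      unfolding down_Suc[OF le0] Suc by (simp add: s_def mult.assoc)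
    also have "\<dots> = B ^ Suc n * (b * a) ^ Suc n" unfolding pow 1 by (simp add: mult.assoc)
    finally show ?case .
  qed simp
  have "B ^ (m - 1) * B = 1"
  proof -
    have "B ^ (m - 1) * B = B ^ m" using m by (metis One_nat_def Suc_1 Suc_diff_1 Suc_le_lessD less_trans power_Suc2 zero_less_one)
    also have "\<dots> = (b ^ m) ^ (m - 1)" unfolding B_def by (metis mult.commute power_mult)
    finally show ?thesis using bm by simp
  qed
  then have "B ^ (m - 1) = b" using Bb by (metis mult.assoc mult.left_neutral mult.right_neutral)
  then have "b = down s 0 (m - 1)" unfolding down ba by simp
  moreover have "coxeter (m - 1) s" using inv comm braid by (simp add: coxeter_def)
  ultimately show thesis using that s0 by simp
qed

text \<open>Words in a transposition (\<open>False\<close>) and a full cycle (\<open>True\<close>).\<close>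

definition cycle :: "nat \<Rightarrow> nat endo"
  where "cycle m = Endo (\<lambda>j. if j < m then Suc j mod m else j)"

definition pick :: "'a \<Rightarrow> 'a \<Rightarrow> bool \<Rightarrow> 'a" where "pick a b l = (if l then b else a)"

text \<open>The same Coxeter word that \<open>moore_coxeter\<close> gives for \<open>b\<close>,
  evaluated at the adjacent transpositions.\<close>

lemma cycle_down: "m \<ge> 1 \<Longrightarrow> cycle m = down swap 0 (m - 1)"
  by (rule endo_eqI) (auto simp: cycle_def app_down_swap mod_Suc)

text \<open>Replacing both letters by Coxeter words, the same ones for the abstract elements and for
  the permutations, reduces this to \<open>coxeter_complete\<close>.\<close>

theorem moore_complete:
  assumes m: "m \<ge> 2" and moore: "moore m a b"
    and eq: "ev (pick (swap 0) (cycle m)) u = ev (pick (swap 0) (cycle m)) w"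
  shows "ev (pick a b) u = ev (pick a b) w"
proof -
  obtain s where s: "coxeter (m - 1) s" "a = s 0" "b = down s 0 (m - 1)"
    using moore_coxeter[OF m moore] .
  define f where "f l = (if l then rev [0..<m - 1] else [0])" for l
  have ev: "ev (pick (t 0) (down t 0 (m - 1))) v = ev t (concat (map f v))" for t :: "nat \<Rightarrow> 'b::monoid_mult" and v
    by (induction v) (auto simp: pick_def f_def ev_down)
  have "set (concat (map f v)) \<subseteq> {..<m - 1}" for v
    using m by (auto simp: f_def split: if_splits)
  moreover have "ev swap (concat (map f u)) = ev swap (concat (map f w))"
    using eq cycle_down[of m] m unfolding ev[symmetric] by simp
  ultimately have "ev s (concat (map f u)) = ev s (concat (map f w))"
    using coxeter_complete[OF s(1)] by blast
  then show ?thesis unfolding s(2,3) ev .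
qed

lemma app_cycle_power: "app (cycle m ^ n) j = (if j < m then (j + n) mod m else j)"
proof (induction n arbitrary: j)
  case (Suc n)
  then show ?case by (auto simp: cycle_def mod_simps)
qed simp

lemma swap_conj:
  assumes "Suc j < m"
  shows "cycle m ^ (m - j) * swap 0 * cycle m ^ j = swap j"
proof (rule endo_eqI)
  fix i
  consider "m \<le> i" | "i < j" | "i = j" | "i = Suc j" | "Suc j < i" "i < m" by linarith
  then show "app (cycle m ^ (m - j) * swap 0 * cycle m ^ j) i = app (swap j) i"
  proof cases
    case 2
    then have "(i + (m - j)) mod m = i + (m - j)" using assms by simp
    then show ?thesis using 2 assms by (auto simp: app_cycle_power app_swap)
  next
    case 5
    then have "(i + (m - j)) mod m = i - j" using assms by (simp add: mod_if)
    then show ?thesis using 5 assms by (auto simp: app_cycle_power app_swap)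
  next
    case 4
    then have "(i + (m - j)) mod m = 1" using assms by (simp add: mod_if)
    then show ?thesis using 4 assms by (auto simp: app_cycle_power app_swap)
  qed (use assms in \<open>auto simp: app_cycle_power app_swap\<close>)
qed

lemma moore_swap_cycle:
  assumes m: "m \<ge> 2"
  shows "moore m (swap 0) (cycle m)"
proof -
  let ?a = "swap 0" and ?b = "cycle m"
  note cox = coxeter_swap[of "Suc m", unfolded coxeter_def]
  have aa: "swap i * swap i = 1" for i using coxeter_swap[of "Suc i"] by (auto simp: coxeter_def)
  have bm: "?b ^ m = 1" by (rule endo_eqI) (simp add: app_cycle_power)
  \<comment> \<open>With the left factor applied first, \<open>?b * ?a\<close> fixes
    \<open>0\<close> and permutes \<open>1, ..., m - 1\<close> cyclically, so its order divides
    \<open>m - 1\<close>.\<close>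
  have ba1: "app (?b * ?a) j = (if 1 \<le> j \<and> j < m then Suc (j mod (m - 1)) else j)" for j
  proof -
    consider "j = 0" | "m \<le> j" | "1 \<le> j" "Suc j < m" | "1 \<le> j" "Suc j = m" by linarith
    then show ?thesis by cases (use m in \<open>auto simp: cycle_def app_swap\<close>)
  qed
  have ba: "app ((?b * ?a) ^ n) j = (if 1 \<le> j \<and> j < m then Suc ((j - 1 + n) mod (m - 1)) else j)" for n j
  proof (induction n arbitrary: j)
    case (Suc n)
    have "app ((?b * ?a) ^ Suc n) j = app ((?b * ?a) ^ n) (app (?b * ?a) j)" by simp
    also have "\<dots> = (if 1 \<le> j \<and> j < m then Suc ((j - 1 + Suc n) mod (m - 1)) else j)"
    proof (cases "1 \<le> j \<and> j < m")
      case True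
      then have "j mod (m - 1) < m - 1" using m by simp
      then have "Suc (j mod (m - 1)) < m" by linarith
      then show ?thesis unfolding ba1 Suc using True by (simp add: mod_simps)
    next
      case False
      then have "app (?b * ?a) j = j" unfolding ba1 by auto
      then show ?thesis using False by (simp only: Suc) auto
    qed
    finally show ?case .
  qed auto
  have "(j - 1 + (m - 1)) mod (m - 1) = j - 1" if "1 \<le> j \<and> j < m" for j
    unfolding mod_add_self2 using that by (intro mod_less) linarith
  then have "(?b * ?a) ^ (m - 1) = 1" by (intro endo_eqI) (simp only: ba, auto)
  \<comment> \<open>For \<open>m = 2\<close> there is no transposition of \<open>1\<close> and
    \<open>2\<close> inside \<open>{..<m}\<close>; the cycle is then the transposition
    itself.\<close>
  moreover have "(?a * ?b ^ (m - 1) * ?a * ?b) ^ 3 = 1"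
  proof (cases "m = 2")
    case True
    have "?b = ?a" using cycle_down[of m] True by (simp add: down_def)
    then show ?thesis using True by (simp add: aa mult.assoc)
  next
    case False
    then have "?b ^ (m - 1) * ?a * ?b = swap 1" using swap_conj[of 1 m] m by simp
    moreover have "?a * swap 1 * ?a = swap 1 * ?a * swap 1"
      using cox m by auto
    ultimately show ?thesis
      by (simp add: power3_eq_cube mult.assoc) (metis aa mult.assoc mult.left_neutral)
  qed
  moreover have "(?a * ?b ^ (m - j) * ?a * ?b ^ j) ^ 2 = 1" if j: "2 \<le> j" "j \<le> m - 2" for j
  proof -
    have "?b ^ (m - j) * ?a * ?b ^ j = swap j" using j m by (intro swap_conj) linarith
    moreover have "swap j * ?a = ?a * swap j" using cox j m by auto
    ultimately show ?thesis
      by (simp add: power2_eq_square mult.assoc) (metis aa mult.assoc mult.left_neutral)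
  qed
  ultimately show ?thesis using aa bm by (simp add: moore_def)
qed

text \<open>Permutations are products of transpositions, these are products of adjacent ones, and
  \<open>swap_conj\<close> spells an adjacent one in the two generators.\<close>

lemma swap_cycle_surj:
  assumes m: "m \<ge> 2" and p: "p permutes {..<m}"
  obtains w where "\<And>i. app (ev (pick (swap 0) (cycle m)) w) i = p i"
proof -
  let ?h = "pick (swap 0) (cycle m)"
  define P where "P p \<longleftrightarrow> (\<exists>w. \<forall>i. app (ev ?h w) i = p i)" for p
  have comp: "P (q \<circ> p)" if p: "P p" and q: "P q" for p q
  proof -
    obtain u w where "\<And>i. app (ev ?h u) i = p i" "\<And>i. app (ev ?h w) i = q i"
      using p q unfolding P_def by blast
    then show ?thesis unfolding P_def by (intro exI[of _ "u @ w"]) simp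
  qed
  have adj: "P (transpose j (Suc j))" if "Suc j < m" for j
  proof -
    have pw: "ev ?h (replicate n True) = cycle m ^ n" for n
      by (induction n) (auto simp: pick_def)
    have "ev ?h (replicate (m - j) True @ [False] @ replicate j True) = swap j"
      using swap_conj[OF that] unfolding ev_simps(3) pw by (simp add: pick_def mult.assoc)
    then show ?thesis unfolding P_def swap_def by (metis app_simps(3))
  qed
  have tr: "P (transpose x y)" if "x < y" "y < m" for x y
    using that
  proof (induction y)
    case (Suc y)
    show ?case
    proof (cases "x = y")
      case True
      then show ?thesis using adj Suc by simp
    next
      case False
      have "transpose x (Suc y) = transpose y (Suc y) \<circ> (transpose x y \<circ> transpose y (Suc y))"
        using False Suc.prems by (auto simp: transpose_def fun_eq_iff)
      moreover have "P (transpose x y)" using Suc False by simp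
      moreover have "P (transpose y (Suc y))" using adj Suc.prems by simp
      ultimately show ?thesis using comp by presburger
    qed
  qed simp
  have "P p"
    using p finite_lessThan
  proof (induction rule: permutes_induct)
    case id
    then show ?case unfolding P_def by (intro exI[of _ "[]"]) simp
  next
    case (swap x y q)
    then have "P (transpose x y)" using tr[of x y] tr[of y x] by (metis lessThan_iff linorder_neqE_nat transpose_commute)
    then show ?case using comp swap by blast
  qed
  then show thesis using that unfolding P_def by blast
qed

section \<open>Normal forms of words\<close>

lemma ball_family: "(\<forall>p\<in>{f i | i. P i}. R p) \<longleftrightarrow> (\<forall>i. P i \<longrightarrow> R (f i))"
  by blast

lemma ball_family2: "(\<forall>p\<in>{f i j | i j. P i j}. R p) \<longleftrightarrow> (\<forall>i j. P i j \<longrightarrow> R (f i j))"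
  by blast

lemma ball_pair: "(\<forall>p\<in>{x, y}. R p) \<longleftrightarrow> R x \<and> R y"
  by blast

lemmas ball_rels = ball_Un ball_pair ball_family ball_family2 fst_conv snd_conv

text \<open>Stated for an arbitrary \<open>Q\<close>, so that membership as \<open>Q\<close> turns
  the families into the introduction rules \<open>rels_U_mem\<close>.\<close>

lemma rels_U_all:
  assumes "\<forall>p\<in>rels_U k m. Q (fst p) (snd p)"
  shows "1 \<le> i \<Longrightarrow> i \<le> k \<Longrightarrow> Q (([C i] @ [B i] \<up> (m - 1)) \<up> 2) []"
    and "1 \<le> i \<Longrightarrow> i \<le> k \<Longrightarrow> Q ([B i] \<up> m) []"
    and "1 \<le> i \<Longrightarrow> i \<le> k \<Longrightarrow> Q (([B i] @ [C i] @ [B i] \<up> (m - 1)) \<up> (m - 1)) []"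
    and "1 \<le> i \<Longrightarrow> i \<le> k \<Longrightarrow> Q (([C i] @ [B i] \<up> (m - 2) @ [C i]) \<up> 3) []"
    and "2 \<le> j \<Longrightarrow> j \<le> m - 2 \<Longrightarrow> 1 \<le> i \<Longrightarrow> i \<le> k \<Longrightarrow>
      Q (([C i] @ [B i] \<up> (m - j - 1) @ [C i] @ [B i] \<up> (j - 1)) \<up> 2) []"
    and "1 \<le> i \<Longrightarrow> i < j \<Longrightarrow> j \<le> k \<Longrightarrow> Q [B i, B j] [B j, B i]"
    and "1 \<le> i \<Longrightarrow> i < j \<Longrightarrow> j \<le> k \<Longrightarrow> Q [C i, C j] [C j, C i]"
    and "1 \<le> i \<Longrightarrow> i \<le> k \<Longrightarrow> 1 \<le> j \<Longrightarrow> j \<le> k \<Longrightarrow> i \<noteq> j \<Longrightarrow> Q [B i, C j] [C j, B i]"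
  using assms unfolding rels_U_def ball_rels by fast+

lemma rels_W_all:
  assumes "\<forall>p\<in>rels_W k. Q (fst p) (snd p)"
  shows "1 \<le> i \<Longrightarrow> i \<le> k - 2 \<Longrightarrow> Q [X i, X 0] [X 0, X (i + 1)]"
    and "2 \<le> i + 1 \<Longrightarrow> i + 1 < j \<Longrightarrow> j \<le> k - 1 \<Longrightarrow> Q [X j, X i] [X i, X j]"
    and "Q [X 0, X 0, X 1] [X 0, X 0]" and "Q [X 0, X 0] [X (k - 1), X 0, X 0]"
    and "1 \<le> i \<Longrightarrow> i \<le> k - 2 \<Longrightarrow> Q [X (i + 1), X i, X (i + 1)] [X (i + 1), X i]"
    and "1 \<le> i \<Longrightarrow> i \<le> k - 2 \<Longrightarrow> Q [X (i + 1), X i] [X i, X (i + 1), X i]"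
    and "i \<le> k - 1 \<Longrightarrow> Q (map X [i..<k] @ map X [0..<i] @ [X i]) [X i]"
    and "1 \<le> i \<Longrightarrow> i \<le> k - 1 \<Longrightarrow> Q (map X [i + 1..<k] @ map X [0..<i] @ [X i, X i]) [X i, X i]"
  using assms unfolding rels_W_def ball_rels by fast+

lemma rels_U'_all:
  assumes "\<forall>p\<in>rels_U' k m. Q (fst p) (snd p)"
  shows "Q ([C 1] @ [B 1] \<up> (m - 1) @ [X 0]) [X 0]" and "Q [B 1, X 0] [X 0]"
    and "1 \<le> i \<Longrightarrow> i \<le> k - 1 \<Longrightarrow>
      Q ([X 0, C i] @ [B i] \<up> (m - 1)) ([C (i + 1)] @ [B (i + 1)] \<up> (m - 1) @ [X 0])"
    and "1 \<le> i \<Longrightarrow> i \<le> k - 1 \<Longrightarrow> Q [X 0, B i] [B (i + 1), X 0]"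
    and "i \<le> k - 1 \<Longrightarrow> Q ([X i, C (k - i)] @ [B (k - i)] \<up> (m - 1)) [X i]"
    and "i \<le> k - 1 \<Longrightarrow> Q [X i, B (k - i)] [X i]"
    and "2 \<le> i \<Longrightarrow> i \<le> k \<Longrightarrow> Q ([C i] @ [B i] \<up> (m - 1) @ [X (k - i + 1)]) [X (k - i + 1)]"
    and "2 \<le> i \<Longrightarrow> i \<le> k \<Longrightarrow> Q [B i, X (k - i + 1)] [X (k - i + 1)]"
    and "1 \<le> i \<Longrightarrow> i \<le> k - 1 \<Longrightarrow> Q ([X i, C (k - i + 1)] @ [B (k - i + 1)] \<up> (m - 1))
      ([C (k - i)] @ [B (k - i)] \<up> (m - 1) @ [X i])"
    and "1 \<le> i \<Longrightarrow> i \<le> k - 1 \<Longrightarrow> Q [X i, B (k - i + 1)] [B (k - i), X i]"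
    and "1 \<le> i \<Longrightarrow> i \<le> k - 1 \<Longrightarrow> 1 \<le> j \<Longrightarrow> j \<le> k \<Longrightarrow> j \<notin> {k - i, k - i + 1} \<Longrightarrow>
      Q ([X i, C j] @ [B j] \<up> (m - 1)) ([C j] @ [B j] \<up> (m - 1) @ [X i])"
    and "1 \<le> i \<Longrightarrow> i \<le> k - 1 \<Longrightarrow> 1 \<le> j \<Longrightarrow> j \<le> k \<Longrightarrow> j \<notin> {k - i, k - i + 1} \<Longrightarrow>
      Q [X i, B j] [B j, X i]"
  using assms unfolding rels_U'_def ball_rels by fast+

lemma rels_mem:
  "\<forall>p\<in>R. (fst p, snd p) \<in> R"
  by simp

lemmas rels_U_mem = rels_U_all[of k m "\<lambda>l r. (l, r) \<in> rels_U k m" for k m, OF rels_mem]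
lemmas rels_W_mem = rels_W_all[of k "\<lambda>l r. (l, r) \<in> rels_W k" for k, OF rels_mem]
lemmas rels_U'_mem = rels_U'_all[of k m "\<lambda>l r. (l, r) \<in> rels_U' k m" for k m, OF rels_mem]

lemma ev_word_power [simp]: "ev v (w \<up> n) = ev v w ^ n"
  by (induction n) (auto simp: word_power_def)

lemma prod_list_update:
  fixes F :: "'b \<Rightarrow> 'a::monoid_mult"
  assumes "distinct cs" "c \<in> set cs" "\<And>d. d \<in> set cs \<Longrightarrow> d \<noteq> c \<Longrightarrow> y * F d = F d * y"
  shows "prod_list (map (F(c := F c * y)) cs) = prod_list (map F cs) * y"
  using assms
proof (induction cs)
  case (Cons d cs)
  show ?case
  proof (cases "d = c")
    case True
    then have "c \<notin> set cs" using Cons.prems by simp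
    then have "y * prod_list (map F cs) = prod_list (map F cs) * y"
      using Cons.prems(3)
    proof (induction cs)
      case (Cons a cs)
      have 1: "y * F a = F a * y" and 2: "y * prod_list (map F cs) = prod_list (map F cs) * y"
        using Cons by auto
      show ?case by (simp add: mult.assoc 2 assoc2[OF 1])
    qed simp
    moreover have "prod_list (map (F(c := F c * y)) cs) = prod_list (map F cs)"
      using \<open>c \<notin> set cs\<close> by (intro arg_cong[of _ _ prod_list] map_cong) auto
    ultimately show ?thesis
      by (simp add: True mult.assoc fun_upd_same del: fun_upd_apply)
  next
    case False
    then show ?thesis using Cons by (simp add: mult.assoc)
  qed
qed simp

text \<open>As factors at different indices commute, each one can be brought next to
  \<open>t\<close>, where \<open>F\<close> and \<open>F'\<close> have the same effect.\<close>

lemma prod_list_absorb_cong: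
  fixes F F' :: "'b \<Rightarrow> 'a::monoid_mult"
  assumes "distinct cs" "\<And>c. c \<in> set cs \<Longrightarrow> F c * t = F' c * t"
    "\<And>c d. c \<in> set cs \<Longrightarrow> d \<in> set cs \<Longrightarrow> c \<noteq> d \<Longrightarrow> F c * F' d = F' d * F c"
    "\<And>c d. c \<in> set cs \<Longrightarrow> d \<in> set cs \<Longrightarrow> c \<noteq> d \<Longrightarrow> F' c * F' d = F' d * F' c"
  shows "prod_list (map F cs) * t = prod_list (map F' cs) * t"
  using assms
proof (induction cs)
  case (Cons c cs)
  have comm: "y * prod_list (map F' ds) = prod_list (map F' ds) * y"
    if "\<And>d. d \<in> set ds \<Longrightarrow> y * F' d = F' d * y" for y ds
    using that
  proof (induction ds)
    case (Cons a ds)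
    have 1: "y * F' a = F' a * y" and 2: "y * prod_list (map F' ds) = prod_list (map F' ds) * y"
      using Cons by auto
    show ?case by (simp add: mult.assoc 2 assoc2[OF 1])
  qed simp
  have 1: "F c * prod_list (map F' cs) = prod_list (map F' cs) * F c"
    and 2: "F' c * prod_list (map F' cs) = prod_list (map F' cs) * F' c"
    using Cons.prems(1) by (auto intro!: comm Cons.prems(3,4))
  have 3: "prod_list (map F cs) * t = prod_list (map F' cs) * t" using Cons by auto
  have 4: "F c * t = F' c * t" using Cons.prems by simp
  show ?case by (simp add: mult.assoc 3 assoc2[OF 1] assoc2[OF 2] 4)
qed simp

lemma ev_commute:
  "(\<And>p. p \<in> set w \<Longrightarrow> y * f p = f p * y) \<Longrightarrow> y * ev f w = ev f w * y"
proof (induction w)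
  case (Cons p w)
  have 1: "y * f p = f p * y" and 2: "y * ev f w = ev f w * y" using Cons by auto
  show ?case by (simp add: mult.assoc 2 assoc2[OF 1])
qed simp

lemma pick_commute:
  assumes "x * x' = x' * x" "x * y' = y' * x" "y * x' = x' * y" "y * y' = y' * y"
  shows "ev (pick x y) l * ev (pick x' y') l' = ev (pick x' y') l' * ev (pick x y) l"
  by (rule ev_commute, rule sym, rule ev_commute) (use assms in \<open>auto simp: pick_def\<close>)

lemma power_mult_commute: "x * y = y * (x::'a::monoid_mult) \<Longrightarrow> x * y ^ n = y ^ n * x"
  by (metis power_commuting_commutes)

section \<open>Generators acting on pairs of a block and a position\<close>

text \<open>A point is a block \<open>c\<close> with a position \<open>j < m\<close> in it. The
  transposition precedes the cycle for \<open>C i\<close> because \<open>c_i\<close> equals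
  \<open>c_i b_i^(m-1)\<close> followed by \<open>b_i\<close>. The index of \<open>X\<close> is
  translated into that of \<open>step\<close>.\<close>

fun act :: "nat \<Rightarrow> nat \<Rightarrow> gen \<Rightarrow> (nat \<times> nat) option \<Rightarrow> (nat \<times> nat) option" where
  "act k m g None = None"
| "act k m (B i) (Some (c, j)) = Some (c, if c = i then app (cycle m) j else j)"
| "act k m (C i) (Some (c, j)) = Some (c, if c = i then app (swap 0 * cycle m) j else j)"
| "act k m (X p) (Some (c, j)) =
    map_option (\<lambda>c'. (c', j)) (step k (if p = 0 then 0 else k - p) (Some c))"

abbreviation perm :: "nat \<Rightarrow> bool list \<Rightarrow> nat endo"
  where "perm m l \<equiv> ev (pick (swap 0) (cycle m)) l"

lemma app_perm_ge: "m \<ge> 2 \<Longrightarrow> m \<le> j \<Longrightarrow> app (perm m l) j = j"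
  by (induction l) (auto simp: pick_def app_swap cycle_def)

lemma run_inj: "run k w (Some i) = Some j \<Longrightarrow> run k w (Some i') = Some j \<Longrightarrow> i = i'"
  using run_mono[of k w i j i' j] run_mono[of k w i' j i j] by (cases i i' rule: linorder_cases) auto

locale poi_relations =
  fixes k m :: nat and v :: "gen \<Rightarrow> 'a::monoid_mult"
  assumes k2: "2 \<le> k" and m2: "2 \<le> m"
    and rel: "(l, r) \<in> rels k m \<Longrightarrow> ev v l = ev v r"
begin

definition g :: "nat \<Rightarrow> 'a" where "g p = v (X (if p = 0 then 0 else k - p))"
definition b :: "nat \<Rightarrow> 'a" where "b i = v (B i)"
text \<open>The element that stands for a transposition and satisfies Moore's relations together
  with \<open>b i\<close>.\<close>

definition a :: "nat \<Rightarrow> 'a" where "a i = v (C i) * v (B i) ^ (m - 1)"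

lemma relW: "(l, r) \<in> rels_W k \<Longrightarrow> ev v l = ev v r"
  and relU: "(l, r) \<in> rels_U k m \<Longrightarrow> ev v l = ev v r"
  and relU': "(l, r) \<in> rels_U' k m \<Longrightarrow> ev v l = ev v r"
  using rel by (auto simp: rels_def)

lemma v_X: "v (X i) = (if i = 0 then g 0 else g (k - i))" if "i < k"
  using that by (auto simp: g_def)

text \<open>Ascending indices of \<open>X\<close> are descending indices of \<open>g\<close>, which
  is why the products in \<open>W\<close> are values of \<open>down\<close>.\<close>

lemma ev_X_upt: "q \<le> p \<Longrightarrow> p < k \<Longrightarrow> ev v (map X [k - p..<k - q]) = down g (Suc q) (Suc p)"
proof (induction p)
  case (Suc p)
  show ?case
  proof (cases "q = Suc p")
    case False
    have "[k - Suc p..<k - q] = (k - Suc p) # [k - p..<k - q]"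
      using Suc.prems False upt_conv_Cons[of "k - Suc p" "k - q"] by (simp add: Suc_diff_Suc)
    then show ?thesis using Suc False by (simp add: down_Suc g_def)
  qed simp
qed simp

lemma ev_X_upt_0: "p < k \<Longrightarrow> ev v (map X [0..<k - p]) = g 0 * down g (Suc p) k"
  using ev_X_upt[of p "k - 1"] upt_conv_Cons[of 0 "k - p"] by (simp add: g_def)

sublocale order_relations k g
proof
  show "2 \<le> k" by (rule k2)
next
  fix p assume p: "1 \<le> p" "Suc p < k"
  have "([X (k - Suc p), X 0], [X 0, X (k - Suc p + 1)]) \<in> rels_W k"
    by (intro rels_W_mem; use p in auto)
  from relW[OF this] show "g (Suc p) * g 0 = g 0 * g p" using p by (simp add: v_X)
  have i: "1 \<le> k - Suc p" "k - Suc p \<le> k - 2" "Suc (k - Suc p) = k - p" using p by auto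
  then have "([X (k - Suc p + 1), X (k - Suc p), X (k - Suc p + 1)], [X (k - Suc p + 1), X (k - Suc p)]) \<in> rels_W k"
    "([X (k - Suc p + 1), X (k - Suc p)], [X (k - Suc p), X (k - Suc p + 1), X (k - Suc p)]) \<in> rels_W k"
    by (intro rels_W_mem; auto)+
  from this[THEN relW] show "g p * g (Suc p) * g p = g p * g (Suc p)"
    "g (Suc p) * g p * g (Suc p) = g p * g (Suc p)" using p i by (simp_all add: v_X mult.assoc)
next
  fix p q assume p: "1 \<le> p" "Suc p < q" "q < k"
  then have "2 \<le> k - q + 1" "k - q + 1 < k - p" "k - p \<le> k - 1" by auto
  then have "([X (k - p), X (k - q)], [X (k - q), X (k - p)]) \<in> rels_W k"
    by (intro rels_W_mem; auto)
  from relW[OF this] show "g q * g p = g p * g q" using p by (simp add: v_X)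
next
  have "([X 0, X 0, X 1], [X 0, X 0]) \<in> rels_W k" "([X 0, X 0], [X (k - 1), X 0, X 0]) \<in> rels_W k"
    by (intro rels_W_mem; auto)+
  from this[THEN relW] show "g 0 * g 0 * g (k - 1) = g 0 * g 0" "g 1 * g 0 * g 0 = g 0 * g 0"
    using k2 by (simp_all add: v_X mult.assoc)
next
  fix p assume p: "1 \<le> p" "p < k"
  then have i: "k - p \<le> k - 1" "1 \<le> k - p" "k - p < k" by auto
  have "(map X [k - p..<k] @ map X [0..<k - p] @ [X (k - p)], [X (k - p)]) \<in> rels_W k"
    by (intro rels_W_mem; use i(1) in auto)
  from relW[OF this] show "down g 1 (Suc p) * g 0 * down g p k = g p"
    using p i ev_X_upt[of 0 p] ev_X_upt_0[of p] by (simp add: v_X mult.assoc down_last)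
  have "(map X [k - p + 1..<k] @ map X [0..<k - p] @ [X (k - p), X (k - p)], [X (k - p), X (k - p)]) \<in> rels_W k"
    by (intro rels_W_mem; use i(1,2) in auto)
  moreover have "k - p + 1 = k - (p - 1)" using p by simp
  ultimately have "(map X [k - (p - 1)..<k] @ map X [0..<k - p] @ [X (k - p), X (k - p)], [X (k - p), X (k - p)]) \<in> rels_W k"
    by simp
  from relW[OF this] show "down g 1 p * g 0 * down g p k * g p = g p * g p"
    using p i ev_X_upt[of 0 "p - 1"] ev_X_upt_0[of p] by (simp add: v_X mult.assoc down_last)
next
  have "(map X [0..<k] @ map X [0..<0] @ [X 0], [X 0]) \<in> rels_W k"
    by (intro rels_W_mem; auto)
  from relW[OF this] show "g 0 * down g 1 k * g 0 = g 0"
    using ev_X_upt_0[of 0] k2 by (simp add: v_X)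
qed

lemma local_b: "local b"
  unfolding local_def
proof (intro conjI allI impI)
  fix p assume p: "1 \<le> p" "p < k"
  then have i: "k - p \<le> k - 1" "1 \<le> k - p" "k - p < k" "k - (k - p) = p" by auto
  have "([X (k - p), B (k - (k - p))], [X (k - p)]) \<in> rels_U' k m"
    by (intro rels_U'_mem; use i(1) in auto)
  from relU'[OF this] show "g p * b p = g p" using p i by (simp add: v_X b_def)
  have "([B (Suc p), X (k - Suc p + 1)], [X (k - Suc p + 1)]) \<in> rels_U' k m"
    by (intro rels_U'_mem; use p in auto)
  from relU'[OF this] show "b (Suc p) * g p = g p"
    using p by (simp add: v_X b_def Suc_diff_Suc)
  have "([X (k - p), B (k - (k - p) + 1)], [B (k - (k - p)), X (k - p)]) \<in> rels_U' k m"
    by (intro rels_U'_mem; use i(1,2) in auto)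
  from relU'[OF this] show "g p * b (Suc p) = b p * g p" using p i by (simp add: v_X b_def)
next
  fix p c assume p: "1 \<le> p" "p < k" "1 \<le> c" "c \<le> k" "c \<noteq> p" "c \<noteq> Suc p"
  then have i: "k - p \<le> k - 1" "1 \<le> k - p" "k - p < k" "c \<notin> {k - (k - p), k - (k - p) + 1}" by auto
  have "([X (k - p), B c], [B c, X (k - p)]) \<in> rels_U' k m"
    by (intro rels_U'_mem; use i p(3,4) in auto)
  from relU'[OF this] show "g p * b c = b c * g p" using p by (simp add: v_X b_def)
next
  have "([X 0, B (k - 0)], [X 0]) \<in> rels_U' k m" "([B 1, X 0], [X 0]) \<in> rels_U' k m"
    by (intro rels_U'_mem; auto)+
  from this[THEN relU'] show "g 0 * b k = g 0" "b 1 * g 0 = g 0" using k2 by (simp_all add: v_X b_def)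
next
  fix i assume i: "1 \<le> i" "i < k"
  then have "([X 0, B i], [B (i + 1), X 0]) \<in> rels_U' k m"
    by (intro rels_U'_mem; auto)
  from relU'[OF this] show "g 0 * b i = b (Suc i) * g 0" using i by (simp add: v_X b_def)
qed

lemma local_a: "local a"
  unfolding local_def
proof (intro conjI allI impI)
  fix p assume p: "1 \<le> p" "p < k"
  then have i: "k - p \<le> k - 1" "1 \<le> k - p" "k - p < k" "k - (k - p) = p" by auto
  have "([X (k - p), C (k - (k - p))] @ [B (k - (k - p))] \<up> (m - 1), [X (k - p)]) \<in> rels_U' k m"
    by (intro rels_U'_mem; use i(1) in auto)
  from relU'[OF this] show "g p * a p = g p" using p i by (simp add: v_X a_def mult.assoc)
  have "([C (Suc p)] @ [B (Suc p)] \<up> (m - 1) @ [X (k - Suc p + 1)], [X (k - Suc p + 1)]) \<in> rels_U' k m"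
    by (intro rels_U'_mem; use p in auto)
  from relU'[OF this] show "a (Suc p) * g p = g p"
    using p by (simp add: v_X a_def Suc_diff_Suc mult.assoc)
  have "([X (k - p), C (k - (k - p) + 1)] @ [B (k - (k - p) + 1)] \<up> (m - 1),
      [C (k - (k - p))] @ [B (k - (k - p))] \<up> (m - 1) @ [X (k - p)]) \<in> rels_U' k m"
    by (intro rels_U'_mem; use i(1,2) in auto)
  from relU'[OF this] show "g p * a (Suc p) = a p * g p" using p i by (simp add: v_X a_def mult.assoc)
next
  fix p c assume p: "1 \<le> p" "p < k" "1 \<le> c" "c \<le> k" "c \<noteq> p" "c \<noteq> Suc p"
  then have i: "k - p \<le> k - 1" "1 \<le> k - p" "k - p < k" "c \<notin> {k - (k - p), k - (k - p) + 1}" by auto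
  have "([X (k - p), C c] @ [B c] \<up> (m - 1), [C c] @ [B c] \<up> (m - 1) @ [X (k - p)]) \<in> rels_U' k m"
    by (intro rels_U'_mem; use i p(3,4) in auto)
  from relU'[OF this] show "g p * a c = a c * g p" using p by (simp add: v_X a_def mult.assoc)
next
  have "([X 0, C (k - 0)] @ [B (k - 0)] \<up> (m - 1), [X 0]) \<in> rels_U' k m"
    "([C 1] @ [B 1] \<up> (m - 1) @ [X 0], [X 0]) \<in> rels_U' k m"
    by (intro rels_U'_mem; auto)+
  from this[THEN relU'] show "g 0 * a k = g 0" "a 1 * g 0 = g 0"
    using k2 by (simp_all add: v_X a_def mult.assoc)
next
  fix i assume i: "1 \<le> i" "i < k"
  then have "([X 0, C i] @ [B i] \<up> (m - 1), [C (i + 1)] @ [B (i + 1)] \<up> (m - 1) @ [X 0]) \<in> rels_U' k m"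
    by (intro rels_U'_mem; auto)
  from relU'[OF this] show "g 0 * a i = a (Suc i) * g 0" using i by (simp add: v_X a_def mult.assoc)
qed

lemma b_power: "i \<in> {1..k} \<Longrightarrow> b i ^ m = 1"
proof -
  assume "i \<in> {1..k}"
  then have "([B i] \<up> m, []) \<in> rels_U k m" by (intro rels_U_mem; auto)
  from relU[OF this] show ?thesis by (simp add: b_def)
qed

lemma v_C: assumes "i \<in> {1..k}" shows "v (C i) = a i * b i"
proof -
  have "b i ^ (m - 1) * b i = 1" using b_power[OF assms] m2
    by (metis One_nat_def Suc_1 Suc_diff_1 Suc_le_lessD less_trans power_Suc2 zero_less_one)
  then show ?thesis by (simp add: a_def b_def mult.assoc)
qed

text \<open>Substituting \<open>v (C i) = a i * b i\<close> in \<open>U\<close> raises each exponent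
  of \<open>b i\<close> that follows a letter \<open>C i\<close> by one, which gives the exponents
  in \<open>moore\<close>; the products \<open>c b^(m-1)\<close> are \<open>a i\<close>
  itself.\<close>

lemma moore_ab:
  assumes i: "i \<in> {1..k}"
  shows "moore m (a i) (b i)"
  unfolding moore_def
proof (intro conjI allI impI)
  have pow: "b i * b i ^ n = b i ^ Suc n" for n by simp
  have i': "1 \<le> i" "i \<le> k" using i by auto
  have m1: "Suc (m - 2) = m - 1" using m2 by simp
  have bb: "b i * b i ^ (m - 1) = 1" using b_power[OF i] m2 unfolding pow by simp
  have "(([C i] @ [B i] \<up> (m - 1)) \<up> 2, []) \<in> rels_U k m" by (intro rels_U_mem; use i' in auto)
  from relU[OF this] show "a i * a i = 1" by (simp add: a_def power2_eq_square)
  show "b i ^ m = 1" by (rule b_power[OF i])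
  have "(([B i] @ [C i] @ [B i] \<up> (m - 1)) \<up> (m - 1), []) \<in> rels_U k m"
    by (intro rels_U_mem; use i' in auto)
  from relU[OF this] show "(b i * a i) ^ (m - 1) = 1" by (simp add: a_def b_def)
  have "(([C i] @ [B i] \<up> (m - 2) @ [C i]) \<up> 3, []) \<in> rels_U k m" by (intro rels_U_mem; use i' in auto)
  from relU[OF this] have "(v (C i) * (b i ^ (m - 2) * v (C i))) ^ 3 = 1" by (simp add: b_def)
  moreover have "v (C i) * (b i ^ (m - 2) * v (C i)) = a i * b i ^ (m - 1) * a i * b i"
    unfolding v_C[OF i] using assoc2[OF pow[of "m - 2"], unfolded m1] by (simp add: mult.assoc)
  ultimately show "(a i * b i ^ (m - 1) * a i * b i) ^ 3 = 1" by simp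
next
  fix j assume j: "2 \<le> j" "j \<le> m - 2"
  have pow: "b i * b i ^ n = b i ^ Suc n" for n by simp
  have j1: "Suc (m - j - 1) = m - j" "Suc (j - 1) = j" using j m2 by auto
  have "(([C i] @ [B i] \<up> (m - j - 1) @ [C i] @ [B i] \<up> (j - 1)) \<up> 2, []) \<in> rels_U k m"
    by (intro rels_U_mem; use i j in auto)
  from relU[OF this]
  have "(v (C i) * (b i ^ (m - j - 1) * (v (C i) * b i ^ (j - 1)))) ^ 2 = 1" by (simp add: b_def)
  moreover have "v (C i) * (b i ^ (m - j - 1) * (v (C i) * b i ^ (j - 1)))
      = a i * b i ^ (m - j) * a i * b i ^ j"
    unfolding v_C[OF i]
    using assoc2[OF pow[of "m - j - 1"], unfolded j1] pow[of "j - 1", unfolded j1] by (simp add: mult.assoc)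
  ultimately show "(a i * b i ^ (m - j) * a i * b i ^ j) ^ 2 = 1" by simp
qed

definition blk :: "nat \<Rightarrow> bool list \<Rightarrow> 'a" where "blk i l = ev (pick (a i) (b i)) l"

lemma blk_commute:
  assumes "i \<in> {1..k}" "j \<in> {1..k}" "i \<noteq> j"
  shows "blk i l * blk j l' = blk j l' * blk i l"
proof -
  have bb: "v (B i) * v (B j) = v (B j) * v (B i)" and cc: "v (C i) * v (C j) = v (C j) * v (C i)"
    if "i \<in> {1..k}" "j \<in> {1..k}" "i < j" for i j
  proof -
    have "([B i, B j], [B j, B i]) \<in> rels_U k m" "([C i, C j], [C j, C i]) \<in> rels_U k m"
      by (intro rels_U_mem; use that in auto)+
    from this[THEN relU] show "v (B i) * v (B j) = v (B j) * v (B i)" "v (C i) * v (C j) = v (C j) * v (C i)"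
      by simp_all
  qed
  have bc: "v (B i) * v (C j) = v (C j) * v (B i)"
    if "i \<in> {1..k}" "j \<in> {1..k}" "i \<noteq> j" for i j
  proof -
    have "([B i, C j], [C j, B i]) \<in> rels_U k m"
      by (intro rels_U_mem; use that in auto)
    from relU[OF this] show ?thesis by simp
  qed
  have bb': "v (B i) * v (B j) = v (B j) * v (B i)" and cc': "v (C i) * v (C j) = v (C j) * v (C i)"
    using bb[of i j] bb[of j i] cc[of i j] cc[of j i] assms by (cases i j rule: linorder_cases; simp)+
  have bc': "v (B i) * v (C j) = v (C j) * v (B i)" and cb': "v (C i) * v (B j) = v (B j) * v (C i)"
    using bc[of i j] bc[of j i] assms by auto
  have prod: "x * (y * z) = (y * z) * x" if "x * y = y * x" "x * z = z * x" for x y z :: 'a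
    by (simp add: mult.assoc that(2) assoc2[OF that(1)])
  have ba: "b i * a j = a j * b i"
    unfolding a_def b_def by (intro prod bc' power_mult_commute bb')
  have ab: "a i * b j = b j * a i"
    unfolding a_def b_def by (rule sym, intro prod power_mult_commute bb'[symmetric] cb'[symmetric])
  have ca: "v (C i) * a j = a j * v (C i)"
    unfolding a_def by (intro prod cc' power_mult_commute cb')
  have "a j * a i = a i * a j"
    unfolding a_def[of i] using ba ca
    by (intro prod power_mult_commute) (simp_all add: b_def)
  then show ?thesis unfolding blk_def using ba ab bb' by (intro pick_commute) (simp_all add: b_def)
qed

lemma local_blk: "local (\<lambda>i. blk i l)"
proof (induction l)
  case Nil
  show ?case using local_one by (simp add: blk_def)
next
  case (Cons x l)
  have "local (\<lambda>i. pick (a i) (b i) x)" using local_a local_b by (cases x) (auto simp: pick_def)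
  from local_mult[OF this Cons] show ?case by (simp add: blk_def)
qed

definition blks :: "(nat \<Rightarrow> bool list) \<Rightarrow> 'a"
  where "blks h = prod_list (map (\<lambda>i. blk i (h i)) [1..<Suc k])"

lemma blks_append:
  assumes "c \<in> {1..k}"
  shows "blks (h(c := h c @ l)) = blks h * blk c l"
proof -
  let ?F = "\<lambda>i. blk i (h i)"
  have "(\<lambda>i. blk i ((h(c := h c @ l)) i)) = ?F(c := ?F c * blk c l)"
    by (auto simp: blk_def)
  moreover have "prod_list (map (?F(c := ?F c * blk c l)) [1..<Suc k]) = blks h * blk c l"
    unfolding blks_def using assms
    by (intro prod_list_update) (auto intro!: blk_commute simp del: upt_Suc)
  ultimately show ?thesis by (simp add: blks_def)
qed

text \<open>The partial map of the normal form \<open>blks h * ev g x\<close>. The permutation is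
  taken at the source block \<open>c\<close> because the factor \<open>blks h\<close> comes
  first.\<close>

definition sem :: "(nat \<Rightarrow> bool list) \<Rightarrow> nat list \<Rightarrow> nat \<Rightarrow> nat \<Rightarrow> (nat \<times> nat) option"
  where "sem h x c j = map_option (\<lambda>c'. (c', app (perm m (h c)) j)) (run k x (Some c))"

text \<open>A new last letter \<open>b_i\<close> or \<open>c_i\<close> slides through
  \<open>x\<close> to the block that \<open>x\<close> sends to \<open>i\<close> and is appended to
  the word at that block; if there is no such block, it is absorbed. Value and partial map are
  followed in one induction, so that the same \<open>h\<close> and \<open>x\<close> describe
  both.\<close>

lemma blks_normal_form:
  assumes "set u \<subseteq> gens k"
  shows "\<exists>h x. set x \<subseteq> {..<k} \<and> ev v u = blks h * ev g x \<and>
    (\<forall>c\<in>{1..k}. \<forall>j. fold (act k m) u (Some (c, j)) = sem h x c j)"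
  using assms
proof (induction u rule: rev_induct)
  case Nil
  have "blks (\<lambda>_. []) = 1" by (simp add: blks_def blk_def prod_list_replicate map_replicate_const del: upt_Suc)
  then show ?case by (intro exI[of _ "\<lambda>_. []"] exI[of _ "[]"]) (simp add: sem_def)
next
  case (snoc t u)
  then obtain h x where x: "set x \<subseteq> {..<k}" and u: "ev v u = blks h * ev g x"
    and s: "\<And>c j. c \<in> {1..k} \<Longrightarrow> fold (act k m) u (Some (c, j)) = sem h x c j" by auto
  have block: ?case
    if i: "i \<in> {1..k}" and t: "v t = blk i l"
      "\<And>c j. act k m t (Some (c, j)) = Some (c, if c = i then app (perm m l) j else j)" for i l
  proof (cases "\<exists>c. run k x (Some c) = Some i")
    case True
    then obtain c where c: "run k x (Some c) = Some i" by blast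
    have ck: "c \<in> {1..k}" using run_SomeD[OF x c] i by simp
    have "ev v (u @ [t]) = blks h * (ev g x * blk i l)" by (simp add: u t(1) mult.assoc)
    also have "\<dots> = blks (h(c := h c @ l)) * ev g x"
      unfolding local_run[OF local_blk x c] blks_append[OF ck] by (simp add: mult.assoc)
    finally have "ev v (u @ [t]) = blks (h(c := h c @ l)) * ev g x" .
    moreover have "fold (act k m) (u @ [t]) (Some (d, j)) = sem (h(c := h c @ l)) x d j"
      if "d \<in> {1..k}" for d j
    proof (cases "run k x (Some d)")
      case None
      then show ?thesis using s[OF that] by (simp add: sem_def)
    next
      case (Some d')
      have "d' = i \<longleftrightarrow> d = c" using run_inj[of k x d i c] Some c by auto
      then show ?thesis using s[OF that] t(2) Some by (auto simp: sem_def)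
    qed
    ultimately show ?thesis using x by blast
  next
    case False
    have "ev v (u @ [t]) = blks h * (ev g x * blk i l)" by (simp add: u t(1) mult.assoc)
    also have "\<dots> = blks h * ev g x"
      using local_run_ran[OF local_blk x i] False by simp
    finally have "ev v (u @ [t]) = blks h * ev g x" .
    moreover have "fold (act k m) (u @ [t]) (Some (d, j)) = sem h x d j" if "d \<in> {1..k}" for d j
      using s[OF that] t(2) False by (cases "run k x (Some d)") (auto simp: sem_def)
    ultimately show ?thesis using x by blast
  qed
  show ?case
  proof (cases t)
    case (B i)
    then have "i \<in> {1..k}" using snoc.prems by (auto simp: gens_def)
    then show ?thesis by (rule block[of _ "[True]"]) (auto simp: B blk_def pick_def b_def)
  next
    case (C i)
    then have i: "i \<in> {1..k}" using snoc.prems by (auto simp: gens_def)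
    then show ?thesis by (rule block[of _ "[False, True]"]) (auto simp: C blk_def pick_def v_C[OF i])
  next
    case (X i)
    then have i: "i < k" using snoc.prems k2 by (auto simp: gens_def)
    define p where "p = (if i = 0 then 0 else k - i)"
    have "ev v (u @ [t]) = blks h * ev g (x @ [p])"
      using i by (simp add: u X v_X p_def mult.assoc)
    moreover have "set (x @ [p]) \<subseteq> {..<k}" using x i by (auto simp: p_def)
    moreover have "fold (act k m) (u @ [t]) (Some (d, j)) = sem h (x @ [p]) d j"
      if "d \<in> {1..k}" for d j
      using s[OF that] unfolding X sem_def p_def
      by (cases "run k x (Some d)") (simp_all del: step.simps(2) add: option.map_comp comp_def)
    ultimately show ?thesis by blast
  qed
qed

theorem act_complete:
  assumes "set u \<subseteq> gens k" "set w \<subseteq> gens k"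
    and eq: "\<And>c j. c \<in> {1..k} \<Longrightarrow> j < m \<Longrightarrow>
      fold (act k m) u (Some (c, j)) = fold (act k m) w (Some (c, j))"
  shows "ev v u = ev v w"
proof -
  obtain h x where x: "set x \<subseteq> {..<k}" "ev v u = blks h * ev g x"
    "\<And>c j. c \<in> {1..k} \<Longrightarrow> fold (act k m) u (Some (c, j)) = sem h x c j"
    using blks_normal_form[OF assms(1)] by blast
  obtain h' y where y: "set y \<subseteq> {..<k}" "ev v w = blks h' * ev g y"
    "\<And>c j. c \<in> {1..k} \<Longrightarrow> fold (act k m) w (Some (c, j)) = sem h' y c j"
    using blks_normal_form[OF assms(2)] by blast
  have sem: "sem h x c j = sem h' y c j" if "c \<in> {1..k}" "j < m" for c j
    using eq[OF that] x(3) y(3) that by simp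
  have run: "run k x (Some c) = run k y (Some c)" if "c \<in> {1..k}" for c
    using sem[OF that, of 0] m2 unfolding sem_def
    by (cases "run k x (Some c)"; cases "run k y (Some c)") auto
  have ev: "ev g x = ev g y" using run_complete[OF x(1) y(1) run] .
  have perm: "perm m (h c) = perm m (h' c)" if c: "c \<in> {1..k}" "run k x (Some c) \<noteq> None" for c
  proof (rule endo_eqI)
    fix j
    show "app (perm m (h c)) j = app (perm m (h' c)) j"
    proof (cases "j < m")
      case True
      then show ?thesis using sem[OF c(1) True] c(2) run[OF c(1)] by (auto simp: sem_def)
    next
      case False
      then show ?thesis using app_perm_ge m2 by simp
    qed
  qed
  \<comment> \<open>Where \<open>x\<close> is undefined, \<open>h c\<close> and \<open>h' c\<close>
    may be unrelated, but both are absorbed. Elsewhere they define the same permutation.\<close>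
  have "blk c (h c) * ev g x = blk c (h' c) * ev g x" if c: "c \<in> {1..k}" for c
  proof (cases "run k x (Some c)")
    case None
    then show ?thesis using local_run_dom[OF local_blk x(1) c None] by simp
  next
    case (Some d)
    then show ?thesis using moore_complete[OF m2 moore_ab[OF c] perm[OF c]] by (simp add: blk_def)
  qed
  then have "blks h * ev g x = blks h' * ev g x"
    unfolding blks_def by (intro prod_list_absorb_cong) (auto intro!: blk_commute simp del: upt_Suc)
  then show ?thesis using x(2) y(2) ev by simp
qed

end

section \<open>The relations hold for maps\<close>

definition model :: "nat \<Rightarrow> nat \<Rightarrow> gen \<Rightarrow> (nat \<times> nat) option endo"
  where "model k m t = Endo (act k m t)"

lemma app_ev_model: "app (ev (model k m) w) s = fold (act k m) w s"
  by (induction w arbitrary: s) (auto simp: model_def)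

definition on_block :: "nat \<Rightarrow> nat endo \<Rightarrow> (nat \<times> nat) option endo"
  where "on_block i f = Endo (map_option (\<lambda>(c, j). (c, if c = i then app f j else j)))"

definition on_blocks :: "nat \<Rightarrow> nat \<Rightarrow> (nat \<times> nat) option endo"
  where "on_blocks k p = Endo (\<lambda>s. case s of None \<Rightarrow> None
    | Some (c, j) \<Rightarrow> map_option (\<lambda>c'. (c', j)) (step k p (Some c)))"

lemma app_on_block [simp]: "app (on_block i f) None = None"
    "app (on_block i f) (Some (c, j)) = Some (c, if c = i then app f j else j)"
  by (simp_all add: on_block_def)

lemma app_on_blocks [simp]: "app (on_blocks k p) None = None"
    "app (on_blocks k p) (Some (c, j)) = map_option (\<lambda>c'. (c', j)) (step k p (Some c))"
  by (simp_all add: on_blocks_def del: step.simps(2))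

lemma endo_option_eqI:
  "app f None = app h None \<Longrightarrow> (\<And>c j. app f (Some (c, j)) = app h (Some (c, j))) \<Longrightarrow> f = h"
  by (rule endo_eqI) (metis not_Some_eq surj_pair)

lemma on_block_mult: "on_block i (f * f') = on_block i f * on_block i f'"
  by (rule endo_option_eqI) auto

lemma on_block_one [simp]: "on_block i 1 = 1"
  by (rule endo_option_eqI) auto

lemma on_block_power: "on_block i (f ^ n) = on_block i f ^ n"
  by (induction n) (auto simp: on_block_mult)

lemma on_block_commute: "i \<noteq> j \<Longrightarrow> on_block i f * on_block j f' = on_block j f' * on_block i f"
  by (rule endo_option_eqI) auto

lemma model_B: "model k m (B i) = on_block i (cycle m)"
  and model_C: "model k m (C i) = on_block i (swap 0 * cycle m)"
  and model_X: "model k m (X i) = on_blocks k (if i = 0 then 0 else k - i)"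
  by (rule endo_option_eqI; simp add: model_def del: step.simps(2))+

lemma cycle_pow: "cycle m * cycle m ^ n = cycle m ^ Suc n"
  by simp

lemma cycle_cancel: "m \<ge> 2 \<Longrightarrow> cycle m * cycle m ^ (m - 1) = 1"
  using moore_swap_cycle[of m] unfolding cycle_pow by (simp add: moore_def)

lemma model_a: "m \<ge> 2 \<Longrightarrow> model k m (C i) * model k m (B i) ^ (m - 1) = on_block i (swap 0)"
  by (simp add: model_B model_C on_block_mult[symmetric] on_block_power[symmetric] mult.assoc cycle_cancel del: One_nat_def)

lemma model_U:
  assumes m: "m \<ge> 2"
  shows "\<forall>p\<in>rels_U k m. ev (model k m) (fst p) = ev (model k m) (snd p)"
proof -
  have moore: "moore m (swap 0) (cycle m)" by (rule moore_swap_cycle[OF m])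
  have 1: "(model k m (C i) * model k m (B i) ^ (m - 1)) ^ 2 = 1" for i
    unfolding model_a[OF m] using moore
    by (simp add: on_block_mult[symmetric] moore_def power2_eq_square)
  have 2: "model k m (B i) ^ m = 1" for i
    using moore by (simp add: model_B on_block_power[symmetric] moore_def)
  have 3: "(model k m (B i) * (model k m (C i) * model k m (B i) ^ (m - 1))) ^ (m - 1) = 1" for i
    unfolding model_a[OF m] unfolding model_B using moore
    by (simp add: on_block_power[symmetric] on_block_mult[symmetric] moore_def)
  have 4: "(model k m (C i) * (model k m (B i) ^ (m - 2) * model k m (C i))) ^ 3 = 1" for i
  proof -
    have "Suc (m - 2) = m - 1" using m by simp
    then have "swap 0 * cycle m * (cycle m ^ (m - 2) * (swap 0 * cycle m)) =
        swap 0 * cycle m ^ (m - 1) * swap 0 * cycle m"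
      using assoc2[OF cycle_pow[of m "m - 2"]] by (simp add: mult.assoc)
    then show ?thesis using moore
      by (simp add: model_B model_C on_block_power[symmetric] on_block_mult[symmetric] moore_def)
  qed
  have 5: "(model k m (C i) * (model k m (B i) ^ (m - j - 1) *
      (model k m (C i) * model k m (B i) ^ (j - 1)))) ^ 2 = 1" if j: "2 \<le> j" "j \<le> m - 2" for i j
  proof -
    have "Suc (m - j - 1) = m - j" "Suc (j - 1) = j" using j m by auto
    then have "swap 0 * cycle m * (cycle m ^ (m - j - 1) * (swap 0 * cycle m * cycle m ^ (j - 1))) =
        swap 0 * cycle m ^ (m - j) * swap 0 * cycle m ^ j"
      using assoc2[OF cycle_pow[of m "m - j - 1"]] cycle_pow[of m "j - 1"] by (simp add: mult.assoc)
    then show ?thesis using moore j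
      by (simp only: model_B model_C on_block_power[symmetric] on_block_mult[symmetric] moore_def) simp
  qed
  show ?thesis
    unfolding rels_U_def ball_rels ev_word_power ev_simps mult.right_neutral
    using 1 2 3 4 5 on_block_commute by (auto simp: model_B model_C)
qed

lemma on_blocks_before:
  assumes "p < k"
  shows "p \<noteq> 0 \<Longrightarrow> on_block (Suc p) f * on_blocks k p = on_blocks k p"
    and "on_block 1 f * on_blocks k 0 = on_blocks k 0"
  by (rule endo_option_eqI; auto)+

lemma on_blocks_after:
  assumes "p < k"
  shows "p \<noteq> 0 \<Longrightarrow> on_blocks k p * on_block p f = on_blocks k p"
    and "on_blocks k 0 * on_block k f = on_blocks k 0"
  using assms by (intro endo_option_eqI; auto)+

lemma on_blocks_commute:
  assumes "p < k" "i \<in> {1..k}" "i' \<in> {1..k}" "step k p (Some i) = Some i'"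
  shows "on_blocks k p * on_block i' f = on_block i f * on_blocks k p"
proof (rule endo_option_eqI)
  fix c j
  show "app (on_blocks k p * on_block i' f) (Some (c, j)) = app (on_block i f * on_blocks k p) (Some (c, j))"
  proof (cases "step k p (Some c)")
    case None
    then have "c \<noteq> i" using assms(4) by auto
    then show ?thesis using None by (simp del: step.simps(2))
  next
    case (Some c')
    have "c' = i' \<longleftrightarrow> c = i" using step_inj[of k p c i' i] Some assms(4) by auto
    then show ?thesis using Some by (simp del: step.simps(2))
  qed
qed simp

lemma model_U':
  assumes k: "k \<ge> 2" and m: "m \<ge> 2"
  shows "\<forall>p\<in>rels_U' k m. ev (model k m) (fst p) = ev (model k m) (snd p)"
proof -
  have a': "model k m (C i) * (model k m (B i) ^ (m - 1) * t) = on_block i (swap 0) * t" for i t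
    using model_a[OF m, of k i] by (simp add: mult.assoc[symmetric])
  have 1: "on_block 1 f * on_blocks k 0 = on_blocks k 0" for f
    using on_blocks_before(2)[of 0 k] k by simp
  have 2: "on_blocks k 0 * on_block i f = on_block (i + 1) f * on_blocks k 0"
    if "1 \<le> i \<and> i \<le> k - 1" for i f
    using on_blocks_commute[of 0 k "i + 1" i] that k by auto
  have 3: "on_blocks k (if i = 0 then 0 else k - i) * on_block (k - i) f =
      on_blocks k (if i = 0 then 0 else k - i)" if "i \<le> k - 1" for i f
    using that k on_blocks_after[of "k - i" k] on_blocks_after(2)[of 0 k] by (cases "i = 0") simp_all
  have 4: "on_block i f * on_blocks k (if k - i + 1 = 0 then 0 else k - (k - i + 1)) =
      on_blocks k (if k - i + 1 = 0 then 0 else k - (k - i + 1))" if "2 \<le> i \<and> i \<le> k" for i f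
  proof -
    have "k - (k - i + 1) = i - 1" "Suc (i - 1) = i" "i - 1 < k" using that by auto
    then show ?thesis using that on_blocks_before(1)[of "i - 1" k] by simp
  qed
  have 5: "on_blocks k (if i = 0 then 0 else k - i) * on_block (k - i + 1) f =
      on_block (k - i) f * on_blocks k (if i = 0 then 0 else k - i)" if "1 \<le> i \<and> i \<le> k - 1" for i f
    using on_blocks_commute[of "k - i" k "k - i" "k - i + 1"] that k by auto
  have 6: "on_blocks k (if i = 0 then 0 else k - i) * on_block j f =
      on_block j f * on_blocks k (if i = 0 then 0 else k - i)"
    if "1 \<le> i \<and> i \<le> k - 1 \<and> 1 \<le> j \<and> j \<le> k \<and> j \<notin> {k - i, k - i + 1}" for i j f
    using on_blocks_commute[of "k - i" k j j] that k by auto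
  show ?thesis
    unfolding rels_U'_def ball_rels ev_word_power ev_simps append_Cons append_Nil mult.right_neutral
      mult.assoc model_a[OF m] a'
    unfolding model_B model_X
    using 1 2[of 0] 2 3 4 5 6 on_blocks_before(2)[of 0 k] by (intro conjI allI impI) simp_all
qed

text \<open>Translates between the indices of \<open>X\<close> and those of \<open>step\<close>; it
  is its own inverse on \<open>{..<k}\<close>.\<close>

definition letter :: "nat \<Rightarrow> nat \<Rightarrow> nat" where "letter k i = (if i = 0 then 0 else k - i)"

lemma app_ev_model_X:
  "app (ev (model k m) (map X is)) (Some (c, j)) =
    map_option (\<lambda>c'. (c', j)) (run k (map (letter k) is) (Some c))"
proof (induction "is" arbitrary: c)
  case (Cons i "is")
  show ?case
  proof (cases "step k (letter k i) (Some c)")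
    case None
    then have "app (model k m (X i)) (Some (c, j)) = None" by (simp add: model_X letter_def)
    moreover have "app (ev (model k m) w) None = None" for w
      unfolding app_ev_model by (induction w) auto
    ultimately show ?thesis using None by (simp del: step.simps(2))
  next
    case (Some c')
    then have "app (model k m (X i)) (Some (c, j)) = Some (c', j)"
      by (simp add: model_X letter_def del: step.simps(2))
    then show ?thesis using Some Cons by (simp del: step.simps(2))
  qed
qed simp

text \<open>Outside \<open>{1..k}\<close> a nonempty word is undefined while the empty one is the
  identity. With both words nonempty it is enough to compare them on \<open>{1..k}\<close>.\<close>

lemma model_X_eqI:
  assumes "is \<noteq> []" "js \<noteq> []"
    "\<And>c. c \<in> {1..k} \<Longrightarrow> run k (map (letter k) is) (Some c) = run k (map (letter k) js) (Some c)"
  shows "ev (model k m) (map X is) = ev (model k m) (map X js)"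
proof (rule endo_eqI)
  fix s :: "(nat \<times> nat) option"
  have out: "run k w (Some c) = None" if "w \<noteq> []" "c \<notin> {1..k}" for w c
    using that by (cases w) auto
  show "app (ev (model k m) (map X is)) s = app (ev (model k m) (map X js)) s"
  proof (cases s)
    case None
    have "app (ev (model k m) w) None = None" for w
      unfolding app_ev_model by (induction w) auto
    then show ?thesis using None by simp
  next
    case (Some cj)
    obtain c j where cj: "cj = (c, j)" by (cases cj)
    have "run k (map (letter k) is) (Some c) = run k (map (letter k) js) (Some c)"
      using assms out by (cases "c \<in> {1..k}") auto
    then show ?thesis unfolding Some cj app_ev_model_X by simp
  qed
qed

lemma map_letter_upt: "q \<le> p \<Longrightarrow> p < k \<Longrightarrow> map (letter k) [k - p..<k - q] = rev [Suc q..<Suc p]"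
proof (induction p)
  case (Suc p)
  show ?case
  proof (cases "q = Suc p")
    case False
    have "[k - Suc p..<k - q] = (k - Suc p) # [k - p..<k - q]"
      using Suc.prems False upt_conv_Cons[of "k - Suc p" "k - q"] by (simp add: Suc_diff_Suc)
    then show ?thesis using Suc False by (simp add: letter_def)
  qed simp
qed simp

lemma map_letter_upt_0: "p < k \<Longrightarrow> map (letter k) [0..<k - p] = 0 # rev [Suc p..<k]"
  using map_letter_upt[of p "k - 1" k] upt_conv_Cons[of 0 "k - p"] by (simp add: letter_def)

lemma model_W:
  assumes k: "k \<ge> 2"
  shows "\<forall>p\<in>rels_W k. ev (model k m) (fst p) = ev (model k m) (snd p)"
proof -
  let ?e = "\<lambda>is. ev (model k m) (map X is)"
  have shift: "\<exists>p. k = Suc (i + p) \<and> 1 \<le> p" if "1 \<le> i \<and> i \<le> k - 2" for i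
    using that by (intro exI[of _ "k - Suc i"]) auto
  have 1: "?e [i, 0] = ?e [0, i + 1]" if i: "1 \<le> i \<and> i \<le> k - 2" for i
  proof -
    obtain p where "k = Suc (i + p)" "1 \<le> p" using shift[OF i] by blast
    then show ?thesis using i by (intro model_X_eqI) (auto simp: letter_def)
  qed
  have 2: "?e [j, i] = ?e [i, j]" if "2 \<le> i + 1 \<and> i + 1 < j \<and> j \<le> k - 1" for i j
  proof (rule model_X_eqI)
    fix c assume c: "c \<in> {1..k}"
    define p q where "p = k - j" and "q = k - i"
    have "letter k i = q" "letter k j = p" "1 \<le> p" "Suc p < q" "q < k"
      using that k by (auto simp: letter_def p_def q_def)
    moreover have "run k [p, q] (Some c) = run k [q, p] (Some c)"
      using c \<open>1 \<le> p\<close> \<open>Suc p < q\<close> \<open>q < k\<close>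
      by (cases "c = p"; cases "c = Suc p"; cases "c = q"; cases "c = Suc q") simp_all
    ultimately show "run k (map (letter k) [j, i]) (Some c) = run k (map (letter k) [i, j]) (Some c)"
      by simp
  qed simp_all
  have 3: "?e [0, 0, 1] = ?e [0, 0]" "?e [0, 0] = ?e [k - 1, 0, 0]"
    using k by (intro model_X_eqI; auto simp: letter_def)+
  have 4: "?e [i + 1, i, i + 1] = ?e [i + 1, i]" "?e [i + 1, i] = ?e [i, i + 1, i]"
    if i: "1 \<le> i \<and> i \<le> k - 2" for i
  proof -
    obtain p where "k = Suc (i + p)" "1 \<le> p" using shift[OF i] by blast
    then show "?e [i + 1, i, i + 1] = ?e [i + 1, i]" "?e [i + 1, i] = ?e [i, i + 1, i]"
      using i by (intro model_X_eqI; auto simp: letter_def)+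
  qed
  have 5: "?e ([i..<k] @ [0..<i] @ [i]) = ?e [i]" if "i \<le> k - 1" for i
  proof (rule model_X_eqI)
    fix c assume c: "c \<in> {1..k}"
    show "run k (map (letter k) ([i..<k] @ [0..<i] @ [i])) (Some c) = run k (map (letter k) [i]) (Some c)"
    proof (cases "i = 0")
      case True
      consider "c = 1" | d where "c = Suc d" "1 \<le> d" using c by (cases c) force+
      then show ?thesis
        using True map_letter_upt_0[of 0 k] c k by cases (auto simp: run_down letter_def)
    next
      case False
      define p where "p = k - i"
      have p: "i = k - p" "1 \<le> p" "p < k" using that False k by (auto simp: p_def)
      have l: "map (letter k) [i..<k] = rev [1..<Suc p]" "map (letter k) [0..<i] = 0 # rev [Suc p..<k]"
        "letter k i = p"
        using map_letter_upt[of 0 p k] map_letter_upt_0[of p k] p by (auto simp: letter_def)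
      have "run k (rev [1..<Suc p] @ (0 # rev [Suc p..<k]) @ [p]) (Some c) = run k [p] (Some c)"
      proof -
        \<comment> \<open>Above \<open>Suc p\<close> the first factor fixes \<open>c\<close> and the
          letter \<open>0\<close> lowers it, so \<open>c\<close> is written as a successor.\<close>
        consider "c \<le> Suc p" | d where "c = Suc d" "Suc p \<le> d" by (cases c) force+
        then show ?thesis using p(2,3) c by cases (auto simp: run_down simp del: upt_Suc)
      qed
      then show ?thesis unfolding map_append l by (simp add: l)
    qed
  qed simp_all
  have 6: "?e ([i + 1..<k] @ [0..<i] @ [i, i]) = ?e [i, i]" if "1 \<le> i \<and> i \<le> k - 1" for i
  proof (rule model_X_eqI)
    fix c assume c: "c \<in> {1..k}"
    define p where "p = k - i"
    have p: "i = k - p" "1 \<le> p" "p < k" "i + 1 = k - (p - 1)" using that k by (auto simp: p_def)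
    have l: "map (letter k) [i + 1..<k] = rev [1..<p]" "map (letter k) [0..<i] = 0 # rev [Suc p..<k]"
      "letter k i = p"
      using map_letter_upt[of 0 "p - 1" k] map_letter_upt_0[of p k] p by (auto simp: letter_def)
    have "run k (rev [1..<p] @ (0 # rev [Suc p..<k]) @ [p, p]) (Some c) = run k [p, p] (Some c)"
    proof -
      consider "c \<le> p" | "c = Suc p" | d where "c = Suc d" "Suc p \<le> d" by (cases c) force+
      then show ?thesis using p(2,3) c by cases (auto simp: run_down simp del: upt_Suc)
    qed
    then show "run k (map (letter k) ([i + 1..<k] @ [0..<i] @ [i, i])) (Some c) = run k (map (letter k) [i, i]) (Some c)"
      unfolding map_append l by (simp add: l)
  qed simp_all
  show ?thesis
    unfolding rels_W_def ball_rels using 1 2 3 4 5 6 by simp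
qed

lemma poi_relations_model:
  assumes "k \<ge> 2" "m \<ge> 2"
  shows "poi_relations k m (model k m)"
  using assms model_U[of m k] model_W[of k m] model_U'[of k m]
  by unfold_locales (auto simp: rels_def)

section \<open>The isomorphism\<close>

text \<open>Blocks are counted from 1 as in the presentation, but positions from 0, as the
  arithmetic modulo \<open>m\<close> of \<open>cycle\<close> requires.\<close>

definition enc :: "nat \<Rightarrow> nat \<times> nat \<Rightarrow> nat" where "enc m cj = (fst cj - 1) * m + snd cj + 1"
definition dec :: "nat \<Rightarrow> nat \<Rightarrow> nat \<times> nat" where "dec m n = (Suc ((n - 1) div m), (n - 1) mod m)"

lemma dec_enc: "1 \<le> c \<Longrightarrow> j < m \<Longrightarrow> dec m (enc m (c, j)) = (c, j)"
  by (auto simp: enc_def dec_def)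

lemma enc_inj: "1 \<le> c \<Longrightarrow> j < m \<Longrightarrow> 1 \<le> d \<Longrightarrow> i < m \<Longrightarrow> enc m (c, j) = enc m (d, i) \<longleftrightarrow> c = d \<and> j = i"
  by (metis dec_enc prod.inject)

lemma enc_range:
  assumes "c \<in> {1..k}" "j < m"
  shows "enc m (c, j) \<in> {1..k * m}"
proof -
  have "(c - 1) * m + m \<le> k * m"
    using assms(1) mult_le_mono1[of c k m] by (cases c) auto
  then show ?thesis using assms(2) by (simp add: enc_def)
qed

lemma enc_cases:
  assumes "n \<in> {1..k * m}"
  obtains c j where "c \<in> {1..k}" "j < m" "n = enc m (c, j)"
proof -
  have m: "0 < m" using assms by (cases m) auto
  have "(n - 1) div m < k"
    using assms m by (intro less_mult_imp_div_less) auto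
  moreover have "n = enc m (Suc ((n - 1) div m), (n - 1) mod m)"
    using assms by (simp add: enc_def)
  ultimately show thesis using that[of "Suc ((n - 1) div m)" "(n - 1) mod m"] m by simp
qed

lemma block_enc: "1 \<le> c \<Longrightarrow> block m c = (\<lambda>j. enc m (c, j)) ` {..<m}"
proof -
  assume c: "1 \<le> c"
  then have "c * m = (c - 1) * m + m" by (cases c) auto
  moreover have "{l + 1..l + m} = (\<lambda>j. l + j + 1) ` {..<m}" for l :: nat
  proof
    show "{l + 1..l + m} \<subseteq> (\<lambda>j. l + j + 1) ` {..<m}"
    proof
      fix x assume "x \<in> {l + 1..l + m}"
      then show "x \<in> (\<lambda>j. l + j + 1) ` {..<m}" by (intro image_eqI[of _ _ "x - l - 1"]) auto
    qed
  qed auto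
  ultimately show ?thesis by (simp add: block_def enc_def)
qed

lemma block_index_enc:
  assumes "c \<in> {1..k}" "j < m"
  shows "block_index k m (enc m (c, j)) = c"
  unfolding block_index_def
proof (rule the_equality)
  show "c \<in> {1..k} \<and> enc m (c, j) \<in> block m c" using assms by (auto simp: block_enc)
  fix i assume i: "i \<in> {1..k} \<and> enc m (c, j) \<in> block m i"
  then obtain j' where "j' < m" "enc m (c, j) = enc m (i, j')" by (auto simp: block_enc)
  then show "i = c" using i assms enc_inj[of c j m i j'] by auto
qed

section \<open>Elements of the monoid as block maps with permutations\<close>

text \<open>The wreath product description: blocks are moved by the strictly increasing partial map
  \<open>\<beta>\<close>, and \<open>p c\<close> permutes the positions while block \<open>c\<close>
  is moved. Outside \<open>dom \<beta>\<close> the permutation \<open>p c\<close> is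
  arbitrary.\<close>

definition poi_form :: "nat \<Rightarrow> nat \<Rightarrow> (nat \<rightharpoonup> nat) \<Rightarrow> (nat \<rightharpoonup> nat) \<Rightarrow> (nat \<Rightarrow> nat \<Rightarrow> nat) \<Rightarrow> bool"
  where "poi_form k m \<alpha> \<beta> p \<longleftrightarrow>
    (\<forall>n. n \<notin> {1..k * m} \<longrightarrow> \<alpha> n = None) \<and>
    (\<forall>c\<in>{1..k}. \<forall>j<m. \<alpha> (enc m (c, j)) = map_option (\<lambda>c'. enc m (c', p c j)) (\<beta> c)) \<and>
    dom \<beta> \<subseteq> {1..k} \<and> ran \<beta> \<subseteq> {1..k} \<and> strict_mono_on (dom \<beta>) (\<lambda>c. the (\<beta> c)) \<and>
    (\<forall>c. p c permutes {..<m})"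

lemma poi_form_carrier:
  assumes "poi_form k m \<alpha> \<beta> p"
  shows "\<alpha> \<in> POI_carrier k m"
proof -
  have out: "\<And>n. n \<notin> {1..k * m} \<Longrightarrow> \<alpha> n = None"
    and val: "\<And>c j. c \<in> {1..k} \<Longrightarrow> j < m \<Longrightarrow>
        \<alpha> (enc m (c, j)) = map_option (\<lambda>c'. enc m (c', p c j)) (\<beta> c)"
    and ran: "\<And>c c'. \<beta> c = Some c' \<Longrightarrow> c' \<in> {1..k}"
    and mono: "strict_mono_on (dom \<beta>) (\<lambda>c. the (\<beta> c))"
    and perm: "\<And>c. p c permutes {..<m}"
    using assms by (auto simp: poi_form_def ran_def)
  have pl: "p c j < m" if "j < m" for c j using permutes_in_image[OF perm[of c], of j] that by simp
  have D: "\<exists>c j c'. c \<in> {1..k} \<and> j < m \<and> n = enc m (c, j) \<and> \<beta> c = Some c' \<and> c' \<in> {1..k} \<and>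
      \<alpha> n = Some (enc m (c', p c j))" if n: "n \<in> dom \<alpha>" for n
  proof -
    have "n \<in> {1..k * m}" using out[of n] n by (metis domIff)
    then obtain c j where c: "c \<in> {1..k}" "j < m" "n = enc m (c, j)" by (rule enc_cases)
    then obtain c' where b: "\<beta> c = Some c'" using val[OF c(1,2)] n by (cases "\<beta> c") auto
    have "\<alpha> n = Some (enc m (c', p c j))" using val[OF c(1,2)] c(3) b by simp
    then show ?thesis using c b ran[OF b] by blast
  qed
  have 1: "dom \<alpha> \<subseteq> {1..k * m}" using out by (metis domIff subsetI)
  have 2: "ran \<alpha> \<subseteq> {1..k * m}"
  proof
    fix y assume "y \<in> ran \<alpha>"
    then obtain n where n: "\<alpha> n = Some y" by (auto simp: ran_def)
    then show "y \<in> {1..k * m}" using D[of n] enc_range pl by fastforce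
  qed
  have mono': "c < d \<Longrightarrow> \<beta> c = Some c' \<Longrightarrow> \<beta> d = Some d' \<Longrightarrow> c' < d'" for c d c' d'
    using strict_mono_onD[OF mono, of c d] by auto
  have 3: "inj_on \<alpha> (dom \<alpha>)"
  proof (rule inj_onI)
    fix x y assume xy: "x \<in> dom \<alpha>" "y \<in> dom \<alpha>" "\<alpha> x = \<alpha> y"
    obtain c j c' where x: "c \<in> {1..k}" "j < m" "x = enc m (c, j)" "\<beta> c = Some c'" "c' \<in> {1..k}"
      "\<alpha> x = Some (enc m (c', p c j))" using D[OF xy(1)] by blast
    obtain d i d' where y: "d \<in> {1..k}" "i < m" "y = enc m (d, i)" "\<beta> d = Some d'" "d' \<in> {1..k}"
      "\<alpha> y = Some (enc m (d', p d i))" using D[OF xy(2)] by blast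
    have e: "c' = d'" "p c j = p d i"
      using xy(3) x y pl enc_inj[of c' "p c j" m d' "p d i"] by auto
    then have "c = d" using mono'[of c d c' d'] mono'[of d c d' c'] x(4) y(4)
      by (cases c d rule: linorder_cases) auto
    moreover have "inj (p d)" using permutes_inj[OF perm] .
    ultimately show "x = y" using e(2) x(3) y(3) by (simp add: inj_eq)
  qed
  have 4: "block m (block_index k m x) \<subseteq> dom \<alpha> \<and>
      (\<lambda>y. the (\<alpha> y)) ` block m (block_index k m x) = block m (block_index k m (the (\<alpha> x)))"
    if x: "x \<in> dom \<alpha>" for x
  proof -
    obtain c j c' where x: "c \<in> {1..k}" "j < m" "x = enc m (c, j)" "\<beta> c = Some c'" "c' \<in> {1..k}"
      "\<alpha> x = Some (enc m (c', p c j))" using D[OF x] by blast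
    have b: "block_index k m x = c" "block_index k m (the (\<alpha> x)) = c'"
      using x block_index_enc pl by auto
    have v: "\<alpha> (enc m (c, i)) = Some (enc m (c', p c i))" if "i < m" for i
      using val[OF x(1) that] x(4) by simp
    have "block m c = (\<lambda>i. enc m (c, i)) ` {..<m}" "block m c' = (\<lambda>i. enc m (c', i)) ` {..<m}"
      using x by (auto simp: block_enc)
    moreover have "(\<lambda>i. enc m (c', p c i)) ` {..<m} = (\<lambda>i. enc m (c', i)) ` {..<m}"
      using permutes_image[OF perm[of c]] by (metis image_image)
    ultimately show ?thesis unfolding b using v by (auto simp: image_image)
  qed
  have 5: "block_index k m (the (\<alpha> x)) \<le> block_index k m (the (\<alpha> y))"
    if xy: "x \<in> dom \<alpha>" "y \<in> dom \<alpha>" "block_index k m x \<le> block_index k m y" for x y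
  proof -
    obtain c j c' where x: "c \<in> {1..k}" "j < m" "x = enc m (c, j)" "\<beta> c = Some c'" "c' \<in> {1..k}"
      "\<alpha> x = Some (enc m (c', p c j))" using D[OF xy(1)] by blast
    obtain d i d' where y: "d \<in> {1..k}" "i < m" "y = enc m (d, i)" "\<beta> d = Some d'" "d' \<in> {1..k}"
      "\<alpha> y = Some (enc m (d', p d i))" using D[OF xy(2)] by blast
    have "c \<le> d" using xy(3) x y block_index_enc by simp
    then have "c' \<le> d'" using mono'[of c d c' d'] x(4) y(4) by (cases "c = d") auto
    then show ?thesis using x y block_index_enc pl by simp
  qed
  show ?thesis unfolding POI_carrier_def using 1 2 3 4 5 by blast
qed

text \<open>By stability a block lies in the domain completely or not at all and is mapped onto a
  block. Order preservation yields only a weakly increasing map on blocks; strictness comes from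
  injectivity.\<close>

lemma carrier_poi_form:
  assumes \<alpha>: "\<alpha> \<in> POI_carrier k m" and m: "0 < m"
  obtains \<beta> p where "poi_form k m \<alpha> \<beta> p"
proof -
  have dom: "dom \<alpha> \<subseteq> {1..k * m}" and ran: "ran \<alpha> \<subseteq> {1..k * m}" and inj: "inj_on \<alpha> (dom \<alpha>)"
    and stable: "\<And>x. x \<in> dom \<alpha> \<Longrightarrow> block m (block_index k m x) \<subseteq> dom \<alpha>"
      "\<And>x. x \<in> dom \<alpha> \<Longrightarrow> (\<lambda>y. the (\<alpha> y)) ` block m (block_index k m x) =
             block m (block_index k m (the (\<alpha> x)))"
    and order: "\<And>x y. x \<in> dom \<alpha> \<Longrightarrow> y \<in> dom \<alpha> \<Longrightarrow> block_index k m x \<le> block_index k m y \<Longrightarrow>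
           block_index k m (the (\<alpha> x)) \<le> block_index k m (the (\<alpha> y))"
    using \<alpha> unfolding POI_carrier_def by blast+
  \<comment> \<open>The first point of a block decides for the whole block.\<close>
  define \<beta> where "\<beta> c = (if c \<in> {1..k} \<and> enc m (c, 0) \<in> dom \<alpha>
    then Some (block_index k m (the (\<alpha> (enc m (c, 0))))) else None)" for c
  \<comment> \<open>The default value \<open>j\<close> makes \<open>p c\<close> a permutation of
    \<open>{..<m}\<close> also where nothing is prescribed.\<close>
  define p where "p c j = (if j < m \<and> \<beta> c \<noteq> None then snd (dec m (the (\<alpha> (enc m (c, j))))) else j)" for c j
  have blk: "c \<in> {1..k} \<and> c' \<in> {1..k} \<and> block m c \<subseteq> dom \<alpha> \<and> (\<lambda>y. the (\<alpha> y)) ` block m c = block m c'"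
    if c: "\<beta> c = Some c'" for c c'
  proof -
    have ck: "c \<in> {1..k}" "enc m (c, 0) \<in> dom \<alpha>" "c' = block_index k m (the (\<alpha> (enc m (c, 0))))"
      using c by (auto simp: \<beta>_def split: if_splits)
    have "the (\<alpha> (enc m (c, 0))) \<in> ran \<alpha>" using ck(2) by (auto simp: ran_def)
    then have "the (\<alpha> (enc m (c, 0))) \<in> {1..k * m}" using ran by blast
    then obtain d i where "d \<in> {1..k}" "i < m" "the (\<alpha> (enc m (c, 0))) = enc m (d, i)"
      by (rule enc_cases)
    then have "c' \<in> {1..k}" using ck(3) block_index_enc by simp
    then show ?thesis using stable[OF ck(2)] ck block_index_enc[OF ck(1) m] by simp
  qed
  have none: "enc m (c, j) \<notin> dom \<alpha>" if c: "c \<in> {1..k}" "\<beta> c = None" and j: "j < m" for c j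
  proof
    assume "enc m (c, j) \<in> dom \<alpha>"
    then have "block m c \<subseteq> dom \<alpha>" using stable(1) block_index_enc[OF c(1) j] by metis
    then have "enc m (c, 0) \<in> dom \<alpha>" using c m by (auto simp: block_enc)
    then show False using c by (simp add: \<beta>_def)
  qed
  have val: "\<alpha> (enc m (c, j)) = Some (enc m (c', p c j)) \<and> p c j < m"
    if c: "\<beta> c = Some c'" and j: "j < m" for c c' j
  proof -
    have "enc m (c, j) \<in> block m c" using blk[OF c] j by (auto simp: block_enc)
    then have d: "enc m (c, j) \<in> dom \<alpha>" "the (\<alpha> (enc m (c, j))) \<in> block m c'"
      using blk[OF c] by blast+
    then obtain i where i: "i < m" "the (\<alpha> (enc m (c, j))) = enc m (c', i)"
      using blk[OF c] by (auto simp: block_enc)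
    then have "p c j = i" using c j blk[OF c] by (simp add: p_def dec_enc)
    then show ?thesis using i d(1) by auto
  qed
  have perm: "p c permutes {..<m}" for c
  proof (cases "\<beta> c")
    case None
    then have "p c = id" by (auto simp: p_def)
    then show ?thesis using permutes_id by simp
  next
    case (Some c')
    have "p c ` {..<m} = {..<m}"
    proof
      show "p c ` {..<m} \<subseteq> {..<m}" using val[OF Some] by auto
      show "{..<m} \<subseteq> p c ` {..<m}"
      proof
        fix i assume i: "i \<in> {..<m}"
        then have "enc m (c', i) \<in> (\<lambda>y. the (\<alpha> y)) ` block m c"
          using blk[OF Some] by (auto simp: block_enc)
        then obtain y where y: "y \<in> block m c" "enc m (c', i) = the (\<alpha> y)" by blast
        then obtain j where j: "j < m" "enc m (c', i) = the (\<alpha> (enc m (c, j)))"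
          using blk[OF Some] by (auto simp: block_enc)
        then have "enc m (c', i) = enc m (c', p c j)" "p c j < m" using val[OF Some j(1)] by auto
        then have "i = p c j" using enc_inj[of c' i m c' "p c j"] blk[OF Some] i by auto
        then show "i \<in> p c ` {..<m}" using j(1) by auto
      qed
    qed
    moreover from this have "inj_on (p c) {..<m}" by (intro eq_card_imp_inj_on) auto
    ultimately show ?thesis by (intro bij_imp_permutes) (auto simp: bij_betw_def p_def)
  qed
  have "strict_mono_on (dom \<beta>) (\<lambda>c. the (\<beta> c))"
  proof (rule strict_mono_onI)
    fix c d assume cd: "c \<in> dom \<beta>" "d \<in> dom \<beta>" "c < d"
    obtain c' d' where c': "\<beta> c = Some c'" and d': "\<beta> d = Some d'" using cd by blast
    have D: "enc m (c, 0) \<in> dom \<alpha>" "enc m (d, 0) \<in> dom \<alpha>" using val[OF c' m] val[OF d' m] by auto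
    have "c' \<le> d'"
      using order[OF D] cd(3) blk[OF c'] blk[OF d'] m val[OF c' m] val[OF d' m] by (simp add: block_index_enc)
    \<comment> \<open>If blocks \<open>c\<close> and \<open>d\<close> had the same image block, the
      image of the first point of \<open>c\<close> would also be the image of a point of
      \<open>d\<close>, against injectivity.\<close>
    moreover have "c' \<noteq> d'"
    proof
      assume "c' = d'"
      then have "enc m (c', p c 0) \<in> (\<lambda>y. the (\<alpha> y)) ` block m d"
        using blk[OF d'] val[OF c' m] by (auto simp: block_enc)
      then obtain y where "y \<in> block m d" "enc m (c', p c 0) = the (\<alpha> y)" by blast
      then obtain j where j: "j < m" "enc m (c', p c 0) = the (\<alpha> (enc m (d, j)))"
        using blk[OF d'] by (auto simp: block_enc)
      then have "\<alpha> (enc m (c, 0)) = \<alpha> (enc m (d, j))" using val[OF c' m] val[OF d' j(1)] by simp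
      then have "enc m (c, 0) = enc m (d, j)"
        using inj_onD[OF inj _ D(1), of "enc m (d, j)"] val[OF d' j(1)] by auto
      then show False using enc_inj[of c 0 m d j] blk[OF c'] blk[OF d'] m j(1) cd(3) by simp
    qed
    ultimately show "the (\<beta> c) < the (\<beta> d)" using c' d' by simp
  qed
  moreover have "\<alpha> (enc m (c, j)) = map_option (\<lambda>c'. enc m (c', p c j)) (\<beta> c)"
    if "c \<in> {1..k}" "j < m" for c j
    using val[of c _ j] none[of c j] that by (cases "\<beta> c") auto
  moreover have "dom \<beta> \<subseteq> {1..k}" "ran \<beta> \<subseteq> {1..k}" using blk by (force simp: ran_def)+
  ultimately have "poi_form k m \<alpha> \<beta> p" using dom perm unfolding poi_form_def by blast
  then show thesis by (rule that)
qed

section \<open>The partial map of a word in the generators\<close>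

definition poi :: "nat \<Rightarrow> nat \<Rightarrow> gen list \<Rightarrow> (nat \<rightharpoonup> nat)"
  where "poi k m u = (\<lambda>n. if n \<in> {1..k * m}
    then map_option (enc m) (fold (act k m) u (Some (dec m n))) else None)"

lemma poi_outside: "n \<notin> {1..k * m} \<Longrightarrow> poi k m u n = None"
  unfolding poi_def by (rule if_not_P)

lemma poi_enc: "c \<in> {1..k} \<Longrightarrow> j < m \<Longrightarrow>
    poi k m u (enc m (c, j)) = map_option (enc m) (fold (act k m) u (Some (c, j)))"
  using enc_range[of c k j m] by (simp add: poi_def dec_enc)

lemma act_range:
  assumes "t \<in> gens k" "k \<ge> 2" "m \<ge> 2" "act k m t (Some (c, j)) = Some (c', j')" "c \<in> {1..k}" "j < m"
  shows "c' \<in> {1..k} \<and> j' < m"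
proof (cases t)
  case (X i)
  then have "step k (if i = 0 then 0 else k - i) (Some c) = Some c'" "j' = j"
    using assms(4) by (auto simp del: step.simps(2))
  moreover have "(if i = 0 then 0 else k - i) < k" using assms X by (auto simp: gens_def)
  ultimately show ?thesis using step_SomeD assms(6) by blast
next
  case (B i)
  have "app (cycle m) j < m" using assms(3,6) by (auto simp: cycle_def)
  then show ?thesis using assms B by (auto split: if_splits)
next
  case (C i)
  have "app (cycle m) (app (swap 0) j) < m" using assms(3,6) by (auto simp: cycle_def app_swap)
  then show ?thesis using assms C by (auto split: if_splits)
qed

lemma act_word_range:
  assumes "k \<ge> 2" "m \<ge> 2" "set u \<subseteq> gens k" "fold (act k m) u (Some (c, j)) = Some (c', j')"
    "c \<in> {1..k}" "j < m"
  shows "c' \<in> {1..k} \<and> j' < m"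
  using assms(3-)
proof (induction u arbitrary: c j)
  case (Cons t u)
  have none: "fold (act k m) u None = None" for u by (induction u) auto
  obtain d i where di: "act k m t (Some (c, j)) = Some (d, i)"
    using Cons.prems(2) none by (cases "act k m t (Some (c, j))") auto
  have "d \<in> {1..k} \<and> i < m"
    using act_range[OF _ assms(1,2) di] Cons.prems by simp
  then show ?case using Cons.IH[of d i] Cons.prems di by simp
qed simp

text \<open>\<open>enc\<close> is injective only on pairs in range. The words over
  \<open>gens k\<close> keep such pairs in range, so nothing is lost by encoding.\<close>

lemma poi_eq_iff:
  assumes "k \<ge> 2" "m \<ge> 2" "set u \<subseteq> gens k" "set w \<subseteq> gens k"
  shows "poi k m u = poi k m w \<longleftrightarrow> (\<forall>c\<in>{1..k}. \<forall>j<m.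
    fold (act k m) u (Some (c, j)) = fold (act k m) w (Some (c, j)))" (is "?l = ?r")
proof
  assume l: ?l
  show ?r
  proof (intro ballI allI impI)
    fix c j assume c: "c \<in> {1..k}" "j < m"
    have eq: "map_option (enc m) (fold (act k m) u (Some (c, j))) =
        map_option (enc m) (fold (act k m) w (Some (c, j)))"
      using l poi_enc[OF c] by metis
    show "fold (act k m) u (Some (c, j)) = fold (act k m) w (Some (c, j))"
    proof (cases "fold (act k m) u (Some (c, j))")
      case None
      then show ?thesis using eq by simp
    next
      case (Some a)
      then obtain b where b: "fold (act k m) w (Some (c, j)) = Some b" "enc m a = enc m b"
        using eq by (cases "fold (act k m) w (Some (c, j))") auto
      obtain a1 a2 b1 b2 where ab: "a = (a1, a2)" "b = (b1, b2)" by (cases a, cases b) auto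
      have "a1 \<in> {1..k} \<and> a2 < m" "b1 \<in> {1..k} \<and> b2 < m"
        using act_word_range[OF assms(1,2,3) _ c] act_word_range[OF assms(1,2,4) _ c] Some b ab by blast+
      then show ?thesis using b Some ab enc_inj[of a1 a2 m b1 b2] by auto
    qed
  qed
next
  assume r: ?r
  show ?l
  proof
    fix n
    show "poi k m u n = poi k m w n"
    proof (cases "n \<in> {1..k * m}")
      case True
      then obtain c j where "c \<in> {1..k}" "j < m" "n = enc m (c, j)" by (rule enc_cases)
      then show ?thesis using r by (simp add: poi_enc del: atLeastAtMost_iff)
    next
      case False
      then show ?thesis by (simp only: poi_outside[OF False])
    qed
  qed
qed

lemma poi_append:
  assumes "k \<ge> 2" "m \<ge> 2" "set u \<subseteq> gens k"
  shows "poi k m (u @ w) = poi k m w \<circ>\<^sub>m poi k m u"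
proof
  fix n
  show "poi k m (u @ w) n = (poi k m w \<circ>\<^sub>m poi k m u) n"
  proof (cases "n \<in> {1..k * m}")
    case True
    then obtain c j where c: "c \<in> {1..k}" "j < m" "n = enc m (c, j)" by (rule enc_cases)
    have none: "fold (act k m) u None = None" for u by (induction u) auto
    show ?thesis
    proof (cases "fold (act k m) u (Some (c, j))")
      case None
      then show ?thesis using c none by (simp add: poi_enc map_comp_def del: atLeastAtMost_iff)
    next
      case (Some a)
      obtain a1 a2 where a: "a = (a1, a2)" by (cases a)
      then have "a1 \<in> {1..k}" "a2 < m" using act_word_range[OF assms _ c(1,2)] Some by blast+
      then show ?thesis using c Some a by (simp add: poi_enc map_comp_def del: atLeastAtMost_iff)
    qed
  next
    case False
    then show ?thesis by (simp only: poi_outside[OF False] map_comp_simps)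
  qed
qed

lemma swap_permutes: "set w \<subseteq> {..<m - 1} \<Longrightarrow> app (ev swap w) permutes {..<m}"
proof (induction w)
  case Nil
  have "app (ev swap []) = id" by auto
  then show ?case using permutes_id by metis
next
  case (Cons i w)
  have "app (ev swap (i # w)) = app (ev swap w) \<circ> transpose i (Suc i)" by (auto simp: swap_def)
  moreover have "transpose i (Suc i) permutes {..<m}" using Cons.prems by (intro permutes_swap_id) auto
  moreover have "app (ev swap w) permutes {..<m}" using Cons by simp
  ultimately show ?case by (metis permutes_compose)
qed

lemma perm_permutes: "m \<ge> 2 \<Longrightarrow> app (perm m l) permutes {..<m}"
proof (induction l)
  case Nil
  have "app (perm m []) = id" by auto
  then show ?case using permutes_id by metis
next
  case (Cons x l)
  have "app (pick (swap 0) (cycle m) x) permutes {..<m}"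
    using Cons.prems cycle_down[of m] swap_permutes[of "[0]" m] swap_permutes[of "rev [0..<m - 1]" m]
    by (auto simp: pick_def ev_down atLeast0LessThan)
  moreover have "app (perm m (x # l)) = app (perm m l) \<circ> app (pick (swap 0) (cycle m) x)" by auto
  ultimately show ?case using Cons permutes_compose by metis
qed

lemma poi_in_carrier:
  assumes k: "k \<ge> 2" and m: "m \<ge> 2" and u: "set u \<subseteq> gens k"
  shows "poi k m u \<in> POI_carrier k m"
proof -
  interpret poi_relations k m "model k m" by (rule poi_relations_model[OF k m])
  obtain h x where x: "set x \<subseteq> {..<k}"
    "\<And>c j. c \<in> {1..k} \<Longrightarrow> fold (act k m) u (Some (c, j)) = sem h x c j"
    using blks_normal_form[OF u] by blast
  define \<beta> where "\<beta> c = (if c \<in> {1..k} then run k x (Some c) else None)" for c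
  have "poi_form k m (poi k m u) \<beta> (\<lambda>c. app (perm m (h c)))"
    unfolding poi_form_def
  proof (intro conjI allI ballI impI)
    fix n assume "n \<notin> {1..k * m}"
    then show "poi k m u n = None" by (rule poi_outside)
  next
    fix c j assume c: "c \<in> {1..k}" "j < m"
    then show "poi k m u (enc m (c, j)) = map_option (\<lambda>c'. enc m (c', app (perm m (h c)) j)) (\<beta> c)"
      unfolding poi_enc[OF c] x(2)[OF c(1)] sem_def \<beta>_def by (simp add: option.map_comp comp_def)
  next
    show "dom \<beta> \<subseteq> {1..k}" by (auto simp: \<beta>_def split: if_splits)
    show "ran \<beta> \<subseteq> {1..k}" using run_SomeD[OF x(1)] by (fastforce simp: \<beta>_def ran_def split: if_splits)
    show "strict_mono_on (dom \<beta>) (\<lambda>c. the (\<beta> c))"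
    proof (rule strict_mono_onI)
      fix c d assume cd: "c \<in> dom \<beta>" "d \<in> dom \<beta>" "c < d"
      then obtain c' d' where "\<beta> c = Some c'" "\<beta> d = Some d'" by blast
      then show "the (\<beta> c) < the (\<beta> d)"
        using run_mono[of k x c c' d d'] cd(3) by (auto simp: \<beta>_def split: if_splits)
    qed
    show "app (perm m (h c)) permutes {..<m}" for c using perm_permutes[OF m] .
  qed
  then show ?thesis by (rule poi_form_carrier)
qed

text \<open>The letter \<open>False\<close> stands for a transposition, which is not a generator and
  is spelt \<open>c b^(m-1)\<close>.\<close>

definition block_word :: "nat \<Rightarrow> nat \<Rightarrow> bool list \<Rightarrow> gen list"
  where "block_word m c l = concat (map (\<lambda>x. if x then [B c] else C c # [B c] \<up> (m - 1)) l)"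

lemma ev_block_word: "m \<ge> 2 \<Longrightarrow> ev (model k m) (block_word m c l) = on_block c (perm m l)"
  by (induction l) (auto simp: block_word_def model_a[unfolded model_B] pick_def on_block_mult model_B
    mult.assoc[symmetric] simp del: One_nat_def)

lemma poi_surj:
  assumes k: "k \<ge> 2" and m: "m \<ge> 2" and \<alpha>: "\<alpha> \<in> POI_carrier k m"
  obtains u where "set u \<subseteq> gens k" "poi k m u = \<alpha>"
proof -
  interpret poi_relations k m "model k m" by (rule poi_relations_model[OF k m])
  obtain \<beta> p where form: "poi_form k m \<alpha> \<beta> p" using carrier_poi_form[OF \<alpha>] m by auto
  obtain x where x: "set x \<subseteq> {..<k}" "\<And>i. i \<in> {1..k} \<Longrightarrow> run k x (Some i) = \<beta> i"
    using run_surj[of \<beta>] form unfolding poi_form_def by blast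
  have "\<exists>l. \<forall>i. app (perm m l) i = p c i" for c
    using swap_cycle_surj[OF m, of "p c"] form unfolding poi_form_def by metis
  then obtain h where h: "\<And>c i. app (perm m (h c)) i = p c i" by metis
  define bw where "bw = (\<lambda>cs. concat (map (\<lambda>c. block_word m c (h c)) cs))"
  \<comment> \<open>The positions are permuted inside the source blocks first, then the blocks are
    moved. \<open>letter k\<close> translates the word \<open>x\<close> back into indices of
    \<open>X\<close>.\<close>
  define u where "u = bw [1..<Suc k] @ map X (map (letter k) x)"
  have bw: "distinct cs \<Longrightarrow> app (ev (model k m) (bw cs)) (Some (c, j)) =
      Some (c, if c \<in> set cs then p c j else j)" for cs c j
    by (induction cs arbitrary: j) (auto simp: bw_def ev_block_word[OF m] h)
  have letter: "letter k (letter k i) = i" "letter k i \<le> k - 1" if "i < k" for i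
    using that by (auto simp: letter_def)
  have ll: "map (letter k) (map (letter k) x) = x"
    using x(1) letter(1) by (induction x) auto
  have "set (block_word m c l) \<subseteq> {B c, C c}" for c l
    using set_word_power[of "[B c]" "m - 1"] by (auto simp: block_word_def)
  then have "set (bw [1..<Suc k]) \<subseteq> gens k"
    unfolding bw_def gens_def by (fastforce simp: less_Suc_eq_le simp del: upt_Suc)
  moreover have "set (map X (map (letter k) x)) \<subseteq> gens k"
    using x(1) letter(2) by (auto simp: gens_def)
  ultimately have u: "set u \<subseteq> gens k" by (simp add: u_def)
  have "poi k m u = \<alpha>"
  proof
    fix n
    show "poi k m u n = \<alpha> n"
    proof (cases "n \<in> {1..k * m}")
      case True
      then obtain c j where c: "c \<in> {1..k}" "j < m" "n = enc m (c, j)" by (rule enc_cases)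
      have "fold (act k m) u (Some (c, j)) = map_option (\<lambda>c'. (c', p c j)) (\<beta> c)"
        unfolding app_ev_model[symmetric] u_def ev_simps(3) app_simps bw[OF distinct_upt]
          app_ev_model_X ll using c(1) by (simp add: x(2) less_Suc_eq_le del: upt_Suc)
      then show ?thesis unfolding c(3) poi_enc[OF c(1,2)]
        using form c by (simp add: poi_form_def option.map_comp comp_def)
    next
      case False
      then show ?thesis using form unfolding poi_form_def by (metis poi_outside)
    qed
  qed
  then show thesis using that u by blast
qed

text \<open>The right regular action of the presented monoid. Words over \<open>A\<close> fix the sets that are not
  classes, so the relations hold on those sets as well.\<close>

definition class_act :: "'b set \<Rightarrow> ('b list \<times> 'b list) set \<Rightarrow> 'b \<Rightarrow> 'b list set endo"
  where "class_act A r t = Endo (\<lambda>P. if P \<in> lists A // r then r `` {(SOME u. u \<in> P) @ [t]} else P)"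

lemma app_class_act:
  assumes r: "word_congruence A r" and u: "u \<in> lists A" and t: "t \<in> A"
  shows "app (class_act A r t) (r `` {u}) = r `` {u @ [t]}"
proof -
  have eq: "equiv (lists A) r" using r by (simp add: word_congruence_def)
  have "u \<in> r `` {u}" using equiv_class_self[OF eq u] .
  then have "(SOME v. v \<in> r `` {u}) \<in> r `` {u}" by (rule someI)
  then have "(u, SOME v. v \<in> r `` {u}) \<in> r" by simp
  moreover have "([t], [t]) \<in> r" using eq t by (auto simp: equiv_def refl_on_def)
  ultimately have "(u @ [t], (SOME v. v \<in> r `` {u}) @ [t]) \<in> r"
    using r unfolding word_congruence_def by blast
  then have "r `` {u @ [t]} = r `` {(SOME v. v \<in> r `` {u}) @ [t]}"
    using equiv_class_eq[OF eq] by blast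
  then show ?thesis using quotientI[OF u, of r] by (simp add: class_act_def)
qed

lemma app_ev_class_act:
  assumes r: "word_congruence A r" and "u \<in> lists A" "w \<in> lists A"
  shows "app (ev (class_act A r) w) (r `` {u}) = r `` {u @ w}"
  using assms(2,3)
proof (induction w arbitrary: u)
  case (Cons t w)
  then have "app (class_act A r t) (r `` {u}) = r `` {u @ [t]}"
    using app_class_act[OF r] by simp
  then show ?case using Cons.IH[of "u @ [t]"] Cons.prems by simp
qed simp

lemma app_ev_class_act_outside:
  "P \<notin> lists A // r \<Longrightarrow> app (ev (class_act A r) w) P = P"
  by (induction w) (auto simp: class_act_def)

text \<open>Applied to the class of the empty word, the action of \<open>w\<close> returns the class
  of \<open>w\<close>, so the regular action is faithful.\<close>

lemma ev_class_act_iff: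
  assumes r: "word_congruence A r" and w: "w \<in> lists A" "w' \<in> lists A"
  shows "ev (class_act A r) w = ev (class_act A r) w' \<longleftrightarrow> (w, w') \<in> r"
proof
  have eq: "equiv (lists A) r" using r by (simp add: word_congruence_def)
  {
    assume "ev (class_act A r) w = ev (class_act A r) w'"
    then have "r `` {w} = r `` {w'}"
      using app_ev_class_act[OF r, of "[]" w] app_ev_class_act[OF r, of "[]" w'] w by simp
    then show "(w, w') \<in> r" using eq_equiv_class[OF _ eq w(2)] by blast
  next
    assume ww: "(w, w') \<in> r"
    show "ev (class_act A r) w = ev (class_act A r) w'"
    proof (rule endo_eqI)
      fix P
      show "app (ev (class_act A r) w) P = app (ev (class_act A r) w') P"
      proof (cases "P \<in> lists A // r")
        case True
        then obtain u where u: "P = r `` {u}" "u \<in> lists A" by (rule quotientE)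
        have "(u, u) \<in> r" using eq u(2) by (auto simp: equiv_def refl_on_def)
        then have "(u @ w, u @ w') \<in> r" using r ww unfolding word_congruence_def by blast
        then show ?thesis
          using app_ev_class_act[OF r u(2)] w equiv_class_eq[OF eq] u(1) by simp
      qed (simp add: app_ev_class_act_outside)
    qed
  }
qed

text \<open>The kernel of \<open>poi k m\<close> is a congruence that contains the relations, since
  they hold in \<open>model\<close>. Conversely the regular action satisfies the relations, so
  \<open>act_complete\<close> applies to it, and faithfulness turns equal actions into
  congruence.\<close>

theorem generated_congruence_rels:
  assumes k: "k \<ge> 2" and m: "m \<ge> 2"
  shows "generated_congruence (gens k) (rels k m) =
    {(u, w). u \<in> lists (gens k) \<and> w \<in> lists (gens k) \<and> poi k m u = poi k m w}" (is "?R = ?K")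
proof
  have lists: "u \<in> lists (gens k) \<longleftrightarrow> set u \<subseteq> gens k" for u by auto
  have "word_congruence (gens k) ?K"
    unfolding word_congruence_def
  proof (intro conjI allI impI)
    show "equiv (lists (gens k)) ?K"
      by (rule equivI) (auto simp: refl_on_def sym_on_def trans_on_def)
    fix u u' w w' assume "(u, u') \<in> ?K" "(w, w') \<in> ?K"
    then show "(u @ w, u' @ w') \<in> ?K" by (auto simp: poi_append[OF k m] lists)
  qed
  moreover have "rels k m \<subseteq> ?K"
  proof
    fix q assume q: "q \<in> rels k m"
    obtain l r where lr: "q = (l, r)" by (cases q)
    interpret poi_relations k m "model k m" by (rule poi_relations_model[OF k m])
    have "set l \<subseteq> gens k" "set r \<subseteq> gens k" using rels_subset_lists[OF k, of m] q lr by auto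
    moreover have "ev (model k m) l = ev (model k m) r" using rel q lr by simp
    then have "fold (act k m) l s = fold (act k m) r s" for s by (metis app_ev_model)
    ultimately show "q \<in> ?K" unfolding lr using poi_eq_iff[OF k m] by (auto simp: lists)
  qed
  ultimately show "?R \<subseteq> ?K" by (rule generated_congruence_least)
next
  have r: "word_congruence (gens k) ?R"
    by (rule word_congruence_generated[OF rels_subset_lists[OF k]])
  have "poi_relations k m (class_act (gens k) ?R)"
  proof
    fix l r' assume lr: "(l, r') \<in> rels k m"
    then have "l \<in> lists (gens k)" "r' \<in> lists (gens k)" using rels_subset_lists[OF k, of m] by auto
    then show "ev (class_act (gens k) ?R) l = ev (class_act (gens k) ?R) r'"
      using ev_class_act_iff[OF r] generated_congruence_contains[of "rels k m" "gens k"] lr by blast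
  qed (use k m in auto)
  then interpret poi_relations k m "class_act (gens k) ?R" .
  show "?K \<subseteq> ?R"
  proof
    fix q assume q: "q \<in> ?K"
    obtain u w where uw: "q = (u, w)" by (cases q)
    have s: "set u \<subseteq> gens k" "set w \<subseteq> gens k" and e: "poi k m u = poi k m w" using q uw by auto
    have "ev (class_act (gens k) ?R) u = ev (class_act (gens k) ?R) w"
      using e unfolding poi_eq_iff[OF k m s] by (intro act_complete[OF s]) blast
    then show "q \<in> ?R" using ev_class_act_iff[OF r] s uw by auto
  qed
qed

theorem POI_iso_presented:
  assumes k: "k \<ge> 2" and m: "m \<ge> 2"
  shows "POI k m \<cong> presented_monoid (gens k) (rels k m)"
proof -
  let ?A = "gens k" and ?R = "generated_congruence (gens k) (rels k m)"
  \<comment> \<open>All words with map \<open>\<alpha>\<close>. This set is a congruence class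
    because the congruence is the kernel of \<open>poi k m\<close>, so no representative has to be
    chosen.\<close>
  define h where "h \<alpha> = {u \<in> lists ?A. poi k m u = \<alpha>}" for \<alpha>
  have lists: "u \<in> lists ?A \<longleftrightarrow> set u \<subseteq> ?A" for u by auto
  have cls: "?R `` {u} = h (poi k m u)" if "u \<in> lists ?A" for u
    using that unfolding generated_congruence_rels[OF k m] h_def by auto
  have surj: "\<exists>u\<in>lists ?A. poi k m u = \<alpha>" if "\<alpha> \<in> POI_carrier k m" for \<alpha>
    using poi_surj[OF k m that] lists by metis
  have car: "poi k m u \<in> POI_carrier k m" if "u \<in> lists ?A" for u
    using poi_in_carrier[OF k m] that lists by blast
  have "h \<in> hom (POI k m) (presented_monoid ?A (rels k m))"
  proof (rule homI)
    fix \<alpha> assume "\<alpha> \<in> carrier (POI k m)"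
    then obtain u where "u \<in> lists ?A" "poi k m u = \<alpha>" using surj by (auto simp: POI_def)
    then show "h \<alpha> \<in> carrier (presented_monoid ?A (rels k m))"
      using cls[of u] quotientI[of u "lists ?A" ?R] by (simp add: presented_monoid_def)
  next
    fix \<alpha> \<beta> assume "\<alpha> \<in> carrier (POI k m)" "\<beta> \<in> carrier (POI k m)"
    then obtain u w where u: "u \<in> lists ?A" "poi k m u = \<alpha>" and w: "w \<in> lists ?A" "poi k m w = \<beta>"
      using surj unfolding POI_def by (metis partial_object.select_convs(1))
    have uw: "?R `` {u' @ w'} = h (\<beta> \<circ>\<^sub>m \<alpha>)" if "u' \<in> h \<alpha>" "w' \<in> h \<beta>" for u' w'
      using cls[of "u' @ w'"] that poi_append[OF k m] by (auto simp: h_def lists)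
    have "u \<in> h \<alpha>" "w \<in> h \<beta>" using u w by (auto simp: h_def)
    then have "(\<Union>u\<in>h \<alpha>. \<Union>w\<in>h \<beta>. ?R `` {u @ w}) = h (\<beta> \<circ>\<^sub>m \<alpha>)" using uw by blast
    then show "h (\<alpha> \<otimes>\<^bsub>POI k m\<^esub> \<beta>) = h \<alpha> \<otimes>\<^bsub>presented_monoid ?A (rels k m)\<^esub> h \<beta>"
      by (simp add: POI_def presented_monoid_def)
  qed
  moreover have "bij_betw h (carrier (POI k m)) (carrier (presented_monoid ?A (rels k m)))"
    unfolding bij_betw_def
  proof
    show "inj_on h (carrier (POI k m))"
    proof (rule inj_onI)
      fix \<alpha> \<beta> assume "\<alpha> \<in> carrier (POI k m)" and eq: "h \<alpha> = h \<beta>"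
      then obtain u where "u \<in> h \<alpha>" using surj unfolding POI_def h_def by fastforce
      then show "\<alpha> = \<beta>" using eq by (auto simp: h_def)
    qed
    have "lists ?A // ?R = h ` POI_carrier k m"
    proof
      show "lists ?A // ?R \<subseteq> h ` POI_carrier k m"
        using cls car by (auto elim!: quotientE)
      show "h ` POI_carrier k m \<subseteq> lists ?A // ?R"
        using cls surj by (metis image_subsetI quotientI)
    qed
    then show "h ` carrier (POI k m) = carrier (presented_monoid ?A (rels k m))"
      by (simp add: POI_def presented_monoid_def)
  qed
  ultimately show ?thesis unfolding is_iso_def iso_def by blast
qed

section \<open>The number of relations\<close>

lemma family_image: "{F i | i. P i} = F ` {i. P i}"
  and family_image2: "{G i j | i j. Q i j} = (\<lambda>(i, j). G i j) ` {(i, j). Q i j}"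
  by auto

lemma card_family: "inj F \<Longrightarrow> card {F i | i. P i} = card {i. P i}"
  unfolding family_image by (rule card_image) (auto intro: inj_on_subset)

lemma card_family2:
  "inj_on (\<lambda>(i, j). F i j) {(i, j). P i j} \<Longrightarrow> card {F i j | i j. P i j} = card {(i, j). P i j}"
  unfolding family_image2 by (rule card_image)

lemma card_ordered_pairs:
  "2 * card {(i, j). 1 \<le> i \<and> i < j \<and> j \<le> n} = n * (n - 1)"
proof (induction n)
  case 0
  have "{(i, j). 1 \<le> i \<and> i < j \<and> j \<le> 0} = ({} :: (nat \<times> nat) set)" by auto
  then show ?case by (simp only: card.empty mult_0 mult_0_right)
next
  case (Suc n)
  have "{(i, j). 1 \<le> i \<and> i < j \<and> j \<le> Suc n} =
      {(i, j). 1 \<le> i \<and> i < j \<and> j \<le> n} \<union> (\<lambda>i. (i, Suc n)) ` {1..n}"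
    by (auto simp: le_Suc_eq)
  moreover have "finite {(i, j). 1 \<le> i \<and> i < j \<and> j \<le> n}"
    by (rule finite_subset[of _ "{1..n} \<times> {1..n}"]) auto
  moreover have "{(i, j). 1 \<le> i \<and> i < j \<and> j \<le> n} \<inter> (\<lambda>i. (i, Suc n)) ` {1..n} = {}" by auto
  moreover have "card ((\<lambda>i. (i, Suc n)) ` {1..n}) = n" by (subst card_image) (auto simp: inj_on_def)
  ultimately have "card {(i, j). 1 \<le> i \<and> i < j \<and> j \<le> Suc n} =
      card {(i, j). 1 \<le> i \<and> i < j \<and> j \<le> n} + n"
    by (simp add: card_Un_disjoint)
  then show ?case using Suc by (cases n) auto
qed

lemma card_gap_pairs:
  "2 * card {(i, j). 2 \<le> i + 1 \<and> i + 1 < j \<and> j \<le> n} = (n - 1) * (n - 2)"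
proof -
  have "{(i, j). 2 \<le> i + 1 \<and> i + 1 < j \<and> j \<le> n} =
      (\<lambda>(i, j). (i, Suc j)) ` {(i, j). 1 \<le> i \<and> i < j \<and> j \<le> n - 1}"
  proof (rule equalityI; rule subsetI)
    fix q assume "q \<in> {(i, j). 2 \<le> i + 1 \<and> i + 1 < j \<and> j \<le> n}"
    then show "q \<in> (\<lambda>(i, j). (i, Suc j)) ` {(i, j). 1 \<le> i \<and> i < j \<and> j \<le> n - 1}"
      by (cases q) (auto intro!: image_eqI[of _ _ "(fst q, snd q - 1)"])
  qed auto
  then have "card {(i, j). 2 \<le> i + 1 \<and> i + 1 < j \<and> j \<le> n} = card {(i, j). 1 \<le> i \<and> i < j \<and> j \<le> n - 1}"
    by (simp add: card_image inj_on_def split_def prod_eq_iff)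
  then show ?thesis using card_ordered_pairs[of "n - 1"] by (simp add: numeral_2_eq_2)
qed

lemma card_distinct_pairs:
  "card {(i, j). 1 \<le> i \<and> i \<le> n \<and> 1 \<le> j \<and> j \<le> n \<and> i \<noteq> j} = n * (n - 1)"
proof -
  have "{(i, j). 1 \<le> i \<and> i \<le> n \<and> 1 \<le> j \<and> j \<le> n \<and> i \<noteq> j} = (SIGMA i:{1..n}. {1..n} - {i})"
    by auto
  moreover have "card (SIGMA i:{1..n}. {1..n} - {i}) = (\<Sum>i\<in>{1..n}. card ({1..n} - {i}))"
    by (rule card_SigmaI) auto
  moreover have "(\<Sum>i\<in>{1..n}. card ({1..n} - {i})) = (\<Sum>i\<in>{1..n}. n - 1)"
    by (rule sum.cong) auto
  ultimately show ?thesis by simp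
qed

lemma card_far_pairs:
  assumes "k \<ge> 2"
  shows "card {(i, j). 1 \<le> i \<and> i \<le> k - 1 \<and> 1 \<le> j \<and> j \<le> k \<and> j \<notin> {k - i, k - i + 1}} = (k - 1) * (k - 2)"
proof -
  have "{(i, j). 1 \<le> i \<and> i \<le> k - 1 \<and> 1 \<le> j \<and> j \<le> k \<and> j \<notin> {k - i, k - i + 1}} =
      (SIGMA i:{1..k - 1}. {1..k} - {k - i, k - i + 1})"
    by auto
  moreover have "card (SIGMA i:{1..k - 1}. {1..k} - {k - i, k - i + 1}) =
      (\<Sum>i\<in>{1..k - 1}. card ({1..k} - {k - i, k - i + 1}))"
    by (rule card_SigmaI) auto
  moreover have "card ({1..k} - {k - i, k - i + 1}) = k - 2" if "i \<in> {1..k - 1}" for i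
    using that assms by (subst card_Diff_subset) auto
  ultimately show ?thesis by simp
qed

section \<open>Separating and counting the families of relations\<close>

lemma word_power_Suc: "w \<up> Suc n = w @ w \<up> n"
  by (simp add: word_power_def)

lemma word_power_replicate: "[x] \<up> n = replicate n x"
  by (induction n) (auto simp: word_power_def)

lemma replicate_append_eq:
  "replicate a x @ y # r = replicate b x @ y # r' \<Longrightarrow> x \<noteq> y \<Longrightarrow> a = b"
proof (induction a arbitrary: b)
  case 0
  then show ?case by (cases b) auto
next
  case (Suc a)
  then show ?case by (cases b) auto
qed

text \<open>Tells the families of \<open>U\<close> with empty right side apart. Their left sides
  contain 2, 0, \<open>m - 1\<close>, 6 and 4 letters \<open>C\<close>; where \<open>m - 1\<close>
  coincides with 2, 4 or 6, the first letters \<open>B\<close> and \<open>C\<close> differ.\<close>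

definition count_C :: "gen list \<Rightarrow> nat"
  where "count_C w = length (filter (\<lambda>t. \<exists>i. t = C i) w)"

lemma count_C_simps [simp]:
  "count_C [] = 0" "count_C (B i # w) = count_C w" "count_C (X i # w) = count_C w"
  "count_C (C i # w) = Suc (count_C w)" "count_C (u @ w) = count_C u + count_C w"
  "count_C (w \<up> n) = n * count_C w"
  by (simp_all add: count_C_def word_power_def filter_concat length_concat sum_list_replicate)

lemma card_rels_U:
  assumes k: "k \<ge> 2" and m: "m \<ge> 2"
  shows "card (rels_U k m) = 4 * k + (m - 3) * k + 2 * (k * (k - 1)) \<and> finite (rels_U k m)"
proof -
  obtain n where n: "m = Suc (Suc n)" using m by (metis Suc_1 Suc_le_D le_Suc_ex plus_1_eq_Suc add_2_eq_Suc)
  have p2: "w \<up> 2 = w @ w" and p3: "w \<up> 3 = w @ w @ w" for w :: "gen list"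
    by (simp_all add: word_power_def numeral_2_eq_2 numeral_3_eq_3)
  define A1 where "A1 = {(([C i] @ [B i] \<up> (m - 1)) \<up> 2, [] :: gen list) | i. 1 \<le> i \<and> i \<le> k}"
  define A2 where "A2 = {([B i] \<up> m, [] :: gen list) | i. 1 \<le> i \<and> i \<le> k}"
  define A3 where "A3 = {(([B i] @ [C i] @ [B i] \<up> (m - 1)) \<up> (m - 1), [] :: gen list) | i. 1 \<le> i \<and> i \<le> k}"
  define A4 where "A4 = {(([C i] @ [B i] \<up> (m - 2) @ [C i]) \<up> 3, [] :: gen list) | i. 1 \<le> i \<and> i \<le> k}"
  define A5 where "A5 = {(([C i] @ [B i] \<up> (m - j - 1) @ [C i] @ [B i] \<up> (j - 1)) \<up> 2, [] :: gen list) | i j.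
        2 \<le> j \<and> j \<le> m - 2 \<and> 1 \<le> i \<and> i \<le> k}"
  define A6 where "A6 = {([B i, B j], [B j, B i]) | i j. 1 \<le> i \<and> i < j \<and> j \<le> k}"
  define A7 where "A7 = {([C i, C j], [C j, C i]) | i j. 1 \<le> i \<and> i < j \<and> j \<le> k}"
  define A8 where "A8 = {([B i, C j], [C j, B i]) | i j. 1 \<le> i \<and> i \<le> k \<and> 1 \<le> j \<and> j \<le> k \<and> i \<noteq> j}"
  have idx: "{i. a \<le> i \<and> i \<le> k} = {a..k}" for a by auto
  have rU: "rels_U k m = A1 \<union> A2 \<union> A3 \<union> A4 \<union> A5 \<union> A6 \<union> A7 \<union> A8"
    unfolding rels_U_def A1_def A2_def A3_def A4_def A5_def A6_def A7_def A8_def ..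
  have fin1: "finite {i. 1 \<le> i \<and> i \<le> k}" by simp
  have fin2: "finite {(i, j). 1 \<le> i \<and> i < j \<and> j \<le> k}"
    "finite {(i, j). 1 \<le> i \<and> i \<le> k \<and> 1 \<le> j \<and> j \<le> k \<and> i \<noteq> j}"
    by (rule finite_subset[of _ "{1..k} \<times> {1..k}"]; auto)+
  have idx5: "{(i, j). 2 \<le> j \<and> j \<le> m - 2 \<and> 1 \<le> i \<and> i \<le> k} = {1..k} \<times> {2..m - 2}" by auto
  have c1: "card A1 = k" unfolding A1_def by (subst card_family) (auto simp: inj_def p2 idx)
  have c2: "card A2 = k"
    unfolding A2_def n by (subst card_family) (auto simp: inj_def word_power_Suc idx)
  have c3: "card A3 = k"
    unfolding A3_def n by (subst card_family) (auto simp: inj_def word_power_Suc idx)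
  have c4: "card A4 = k" unfolding A4_def by (subst card_family) (auto simp: inj_def p3 idx)
  have c5: "card A5 = (m - 3) * k"
  proof -
    have "inj_on (\<lambda>(i, j). (([C i] @ [B i] \<up> (m - j - 1) @ [C i] @ [B i] \<up> (j - 1)) \<up> 2, [] :: gen list))
        {(i, j). 2 \<le> j \<and> j \<le> m - 2 \<and> 1 \<le> i \<and> i \<le> k}"
    proof (rule inj_onI, clarsimp simp: p2 word_power_replicate)
      fix i j j'
      assume j: "2 \<le> j" "j \<le> m - 2" "2 \<le> j'" "j' \<le> m - 2"
      assume "replicate (m - Suc j) (B i) @ C i # replicate (j - Suc 0) (B i) @
          C i # replicate (m - Suc j) (B i) @ C i # replicate (j - Suc 0) (B i) =
        replicate (m - Suc j') (B i) @ C i # replicate (j' - Suc 0) (B i) @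
          C i # replicate (m - Suc j') (B i) @ C i # replicate (j' - Suc 0) (B i)"
      then have "m - Suc j = m - Suc j'" by (rule replicate_append_eq) simp
      then show "j = j'" using j by linarith
    qed
    \<comment> \<open>The number of values of \<open>j\<close>. Truncated subtraction makes it
      correct for \<open>m = 2\<close> as well, where the family is empty.\<close>
    moreover have "Suc (m - 2) - 2 = m - 3" by linarith
    ultimately show ?thesis unfolding A5_def by (simp only: card_family2 idx5) (simp add: card_cartesian_product)
  qed
  have c6: "card A6 = card {(i, j). 1 \<le> i \<and> i < j \<and> j \<le> k}"
    unfolding A6_def by (rule card_family2) (auto simp: inj_on_def)
  have c7: "card A7 = card {(i, j). 1 \<le> i \<and> i < j \<and> j \<le> k}"
    unfolding A7_def by (rule card_family2) (auto simp: inj_on_def)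
  have c8: "card A8 = k * (k - 1)"
    unfolding A8_def card_distinct_pairs[symmetric] by (rule card_family2) (auto simp: inj_on_def)
  have fin: "finite A1" "finite A2" "finite A3" "finite A4" "finite A5" "finite A6" "finite A7" "finite A8"
    unfolding A1_def A2_def A3_def A4_def A5_def A6_def A7_def A8_def family_image family_image2
    using fin1 fin2 unfolding idx5 by auto
  have C1: "count_C (fst q) = 2 \<and> hd (fst q) \<in> range C \<and> snd q = []" if "q \<in> A1" for q
    using that by (auto simp: A1_def p2 word_power_replicate count_C_def)
  have C2: "count_C (fst q) = 0 \<and> hd (fst q) \<in> range B \<and> snd q = []" if "q \<in> A2" for q
    using that by (auto simp: A2_def n word_power_replicate count_C_def)
  have C3: "count_C (fst q) = m - 1 \<and> hd (fst q) \<in> range B \<and> snd q = []" if "q \<in> A3" for q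
    using that unfolding A3_def n by (auto simp: word_power_Suc)
  have C4: "count_C (fst q) = 6 \<and> hd (fst q) \<in> range C \<and> snd q = []" if "q \<in> A4" for q
    using that by (auto simp: A4_def p3 word_power_replicate count_C_def)
  have C5: "count_C (fst q) = 4 \<and> hd (fst q) \<in> range C \<and> snd q = []" if "q \<in> A5" for q
    using that by (auto simp: A5_def p2 word_power_replicate count_C_def)
  have d: "A1 \<inter> A2 = {}" "(A1 \<union> A2) \<inter> A3 = {}" "(A1 \<union> A2 \<union> A3) \<inter> A4 = {}"
    "(A1 \<union> A2 \<union> A3 \<union> A4) \<inter> A5 = {}"
    using C1 C2 C3 C4 C5 m by fastforce+
  have "snd q = []" if "q \<in> A1 \<union> A2 \<union> A3 \<union> A4 \<union> A5" for q
    using that C1 C2 C3 C4 C5 by blast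
  then have d6: "(A1 \<union> A2 \<union> A3 \<union> A4 \<union> A5) \<inter> A6 = {}" "(A1 \<union> A2 \<union> A3 \<union> A4 \<union> A5) \<inter> A7 = {}"
      "(A1 \<union> A2 \<union> A3 \<union> A4 \<union> A5) \<inter> A8 = {}"
    unfolding A6_def A7_def A8_def by fastforce+
  have "A6 \<inter> A7 = {}" "A6 \<inter> A8 = {}" "A7 \<inter> A8 = {}"
    unfolding A6_def A7_def A8_def by auto
  then have d7: "(A1 \<union> A2 \<union> A3 \<union> A4 \<union> A5 \<union> A6) \<inter> A7 = {}"
      "(A1 \<union> A2 \<union> A3 \<union> A4 \<union> A5 \<union> A6 \<union> A7) \<inter> A8 = {}"
    using d6 by blast+
  show ?thesis
    unfolding rU using fin d d6(1) d7 c1 c2 c3 c4 c5 c6 c7 c8 card_ordered_pairs[of k]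
    by (simp add: card_Un_disjoint)
qed

lemma card_rels_W:
  assumes k: "k \<ge> 2"
  shows "2 * card (rels_W k) = 10 * (k - 1) + (k - 2) * (k - 3) \<and> finite (rels_W k)"
proof -
  define A1 where "A1 = {([X i, X 0], [X 0, X (i + 1)]) | i. 1 \<le> i \<and> i \<le> k - 2}"
  define A2 where "A2 = {([X j, X i], [X i, X j]) | i j. 2 \<le> i + 1 \<and> i + 1 < j \<and> j \<le> k - 1}"
  define A3 where "A3 = {([X 0, X 0, X 1], [X 0, X 0]), ([X 0, X 0], [X (k - 1), X 0, X 0])}"
  define A4 where "A4 = {([X (i + 1), X i, X (i + 1)], [X (i + 1), X i]) | i. 1 \<le> i \<and> i \<le> k - 2}"
  define A5 where "A5 = {([X (i + 1), X i], [X i, X (i + 1), X i]) | i. 1 \<le> i \<and> i \<le> k - 2}"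
  define A6 where "A6 = {(map X [i..<k] @ map X [0..<i] @ [X i], [X i]) | i. i \<le> k - 1}"
  define A7 where "A7 = {(map X [i + 1..<k] @ map X [0..<i] @ [X i, X i], [X i, X i]) | i. 1 \<le> i \<and> i \<le> k - 1}"
  have rW: "rels_W k = A1 \<union> A2 \<union> A3 \<union> A4 \<union> A5 \<union> A6 \<union> A7"
    unfolding rels_W_def A1_def A2_def A3_def A4_def A5_def A6_def A7_def ..
  have i1: "{i. a \<le> i \<and> i \<le> l} = {a..l}" for a l :: nat by auto
  have i0: "{i. i \<le> l} = {0..l}" for l :: nat by auto
  have fin2: "finite {(i, j). 2 \<le> i + 1 \<and> i + 1 < j \<and> j \<le> k - 1}"
    by (rule finite_subset[of _ "{1..k} \<times> {1..k}"]) auto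
  have c1: "card A1 = k - 2" unfolding A1_def by (subst card_family) (auto simp: inj_def i1)
  have c2: "2 * card A2 = (k - 2) * (k - 3)"
  proof -
    have "card A2 = card {(i, j). 2 \<le> i + 1 \<and> i + 1 < j \<and> j \<le> k - 1}"
      unfolding A2_def by (rule card_family2) (auto simp: inj_on_def)
    then show ?thesis using card_gap_pairs[of "k - 1"] by (simp add: numeral_2_eq_2 numeral_3_eq_3)
  qed
  have c3: "card A3 = 2" unfolding A3_def by simp
  have c4: "card A4 = k - 2" unfolding A4_def by (subst card_family) (auto simp: inj_def i1)
  have c5: "card A5 = k - 2" unfolding A5_def by (subst card_family) (auto simp: inj_def i1)
  have c6: "card A6 = k" unfolding A6_def using k by (subst card_family) (auto simp: inj_def i0)
  have c7: "card A7 = k - 1" unfolding A7_def by (subst card_family) (auto simp: inj_def i1)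
  have fin: "finite A1" "finite A2" "finite A3" "finite A4" "finite A5" "finite A6" "finite A7"
    unfolding A1_def A2_def A3_def A4_def A5_def A6_def A7_def family_image family_image2
    using fin2 by (auto simp: i1 i0)
  have d: "A1 \<inter> A2 = {}" "(A1 \<union> A2) \<inter> A3 = {}" "(A1 \<union> A2 \<union> A3) \<inter> A4 = {}"
    "(A1 \<union> A2 \<union> A3 \<union> A4) \<inter> A5 = {}"
    unfolding A1_def A2_def A3_def A4_def A5_def by auto
  have s6: "\<exists>i. snd q = [X i]" if "q \<in> A6" for q
    using that by (auto simp: A6_def)
  \<comment> \<open>The bound on \<open>i\<close> distinguishes these right sides from
    \<open>x\<^sub>0 x\<^sub>0\<close>, which is a right side in \<open>A3\<close>.\<close>
  have s7: "\<exists>i. i \<ge> 1 \<and> snd q = [X i, X i]" if "q \<in> A7" for q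
    using that by (auto simp: A7_def)
  have s: "length (snd q) \<noteq> 1 \<and> (\<forall>i\<ge>1. snd q \<noteq> [X i, X i])" if "q \<in> A1 \<union> A2 \<union> A3 \<union> A4 \<union> A5" for q
    using that by (auto simp: A1_def A2_def A3_def A4_def A5_def)
  have d6: "(A1 \<union> A2 \<union> A3 \<union> A4 \<union> A5) \<inter> A6 = {}" "(A1 \<union> A2 \<union> A3 \<union> A4 \<union> A5 \<union> A6) \<inter> A7 = {}"
    using s s6 s7 by fastforce+
  have "card (rels_W k) = (k - 2) + card A2 + 2 + (k - 2) + (k - 2) + k + (k - 1)"
    unfolding rW using fin d d6 c1 c3 c4 c5 c6 c7 by (simp add: card_Un_disjoint)
  moreover obtain l where "k = Suc (Suc l)" using k by (metis add_2_eq_Suc le_Suc_ex)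
  moreover have "finite (rels_W k)" unfolding rW using fin by simp
  ultimately show ?thesis using c2 by simp
qed

lemma card_rels_U':
  assumes k: "k \<ge> 2" and m: "m \<ge> 2"
  shows "card (rels_U' k m) = 2 + 6 * (k - 1) + 2 * k + 2 * ((k - 1) * (k - 2)) \<and> finite (rels_U' k m)"
proof -
  define A1 where "A1 = {([C 1] @ [B 1] \<up> (m - 1) @ [X 0], [X 0]), ([B 1, X 0], [X 0])}"
  define A2 where "A2 = {([X 0, C i] @ [B i] \<up> (m - 1), [C (i + 1)] @ [B (i + 1)] \<up> (m - 1) @ [X 0]) | i.
        1 \<le> i \<and> i \<le> k - 1}"
  define A3 where "A3 = {([X 0, B i], [B (i + 1), X 0]) | i. 1 \<le> i \<and> i \<le> k - 1}"
  define A4 where "A4 = {([X i, C (k - i)] @ [B (k - i)] \<up> (m - 1), [X i]) | i. i \<le> k - 1}"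
  define A5 where "A5 = {([X i, B (k - i)], [X i]) | i. i \<le> k - 1}"
  define A6 where "A6 = {([C i] @ [B i] \<up> (m - 1) @ [X (k - i + 1)], [X (k - i + 1)]) | i. 2 \<le> i \<and> i \<le> k}"
  define A7 where "A7 = {([B i, X (k - i + 1)], [X (k - i + 1)]) | i. 2 \<le> i \<and> i \<le> k}"
  define A8 where "A8 = {([X i, C (k - i + 1)] @ [B (k - i + 1)] \<up> (m - 1),
      [C (k - i)] @ [B (k - i)] \<up> (m - 1) @ [X i]) | i. 1 \<le> i \<and> i \<le> k - 1}"
  define A9 where "A9 = {([X i, B (k - i + 1)], [B (k - i), X i]) | i. 1 \<le> i \<and> i \<le> k - 1}"
  define A10 where "A10 = {([X i, C j] @ [B j] \<up> (m - 1), [C j] @ [B j] \<up> (m - 1) @ [X i]) | i j.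
        1 \<le> i \<and> i \<le> k - 1 \<and> 1 \<le> j \<and> j \<le> k \<and> j \<notin> {k - i, k - i + 1}}"
  define A11 where "A11 = {([X i, B j], [B j, X i]) | i j.
        1 \<le> i \<and> i \<le> k - 1 \<and> 1 \<le> j \<and> j \<le> k \<and> j \<notin> {k - i, k - i + 1}}"
  note A_defs = A1_def A2_def A3_def A4_def A5_def A6_def A7_def A8_def A9_def A10_def A11_def
  have rU: "rels_U' k m = A1 \<union> A2 \<union> A3 \<union> A4 \<union> A5 \<union> A6 \<union> A7 \<union> A8 \<union> A9 \<union> A10 \<union> A11"
    unfolding rels_U'_def A_defs ..
  have i1: "{i. a \<le> i \<and> i \<le> l} = {a..l}" for a l :: nat by auto
  have i0: "{i. i \<le> l} = {0..l}" for l :: nat by auto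
  have fin2: "finite {(i, j). 1 \<le> i \<and> i \<le> k - 1 \<and> 1 \<le> j \<and> j \<le> k \<and> j \<notin> {k - i, k - i + 1}}"
    by (rule finite_subset[of _ "{1..k} \<times> {1..k}"]) auto
  have c1: "card A1 = 2" unfolding A1_def by simp
  have c2: "card A2 = k - 1" unfolding A2_def by (subst card_family) (auto simp: inj_def i1)
  have c3: "card A3 = k - 1" unfolding A3_def by (subst card_family) (auto simp: inj_def i1)
  have c4: "card A4 = k" unfolding A4_def using k by (subst card_family) (auto simp: inj_def i0)
  have c5: "card A5 = k" unfolding A5_def using k by (subst card_family) (auto simp: inj_def i0)
  have c6: "card A6 = k - 1" unfolding A6_def by (subst card_family) (auto simp: inj_def i1)
  have c7: "card A7 = k - 1" unfolding A7_def by (subst card_family) (auto simp: inj_def i1)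
  have c8: "card A8 = k - 1" unfolding A8_def by (subst card_family) (auto simp: inj_def i1)
  have c9: "card A9 = k - 1" unfolding A9_def by (subst card_family) (auto simp: inj_def i1)
  have c10: "card A10 = (k - 1) * (k - 2)"
    unfolding A10_def card_far_pairs[OF k, symmetric] by (rule card_family2) (auto simp: inj_on_def)
  have c11: "card A11 = (k - 1) * (k - 2)"
    unfolding A11_def card_far_pairs[OF k, symmetric] by (rule card_family2) (auto simp: inj_on_def)
  have fin: "finite A1" "finite A2" "finite A3" "finite A4" "finite A5" "finite A6" "finite A7"
      "finite A8" "finite A9" "finite A10" "finite A11"
    unfolding A_defs family_image family_image2
    using fin2 by (auto simp: i1 i0)
  have d: "A1 \<inter> A2 = {}" "(A1 \<union> A2) \<inter> A3 = {}" "(A1 \<union> A2 \<union> A3) \<inter> A4 = {}"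
    "(A1 \<union> A2 \<union> A3 \<union> A4) \<inter> A5 = {}" "(A1 \<union> A2 \<union> A3 \<union> A4 \<union> A5) \<inter> A6 = {}"
    unfolding A_defs by auto
  have d7: "(A1 \<union> A2 \<union> A3 \<union> A4 \<union> A5 \<union> A6) \<inter> A7 = {}"
    "(A1 \<union> A2 \<union> A3 \<union> A4 \<union> A5 \<union> A6 \<union> A7) \<inter> A8 = {}"
    "(A1 \<union> A2 \<union> A3 \<union> A4 \<union> A5 \<union> A6 \<union> A7 \<union> A8) \<inter> A9 = {}"
    unfolding A_defs by auto
  have d10: "(A1 \<union> A2 \<union> A3 \<union> A4 \<union> A5 \<union> A6 \<union> A7 \<union> A8 \<union> A9) \<inter> A10 = {}"
    "(A1 \<union> A2 \<union> A3 \<union> A4 \<union> A5 \<union> A6 \<union> A7 \<union> A8 \<union> A9 \<union> A10) \<inter> A11 = {}"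
    unfolding A_defs by auto
  show ?thesis
    unfolding rU using fin d d7 d10 c1 c2 c3 c4 c5 c6 c7 c8 c9 c10 c11
    by (simp add: card_Un_disjoint)
qed

text \<open>The left sides separate the three sets: no \<open>X\<close> occurs in \<open>U\<close>,
  only \<open>X\<close> in \<open>W\<close>, and both \<open>X\<close> and other letters in
  \<open>U'\<close>. The term \<open>4\<close> stands on the left to avoid subtraction, and
  \<open>m - 3\<close> is truncated.\<close>

lemma card_rels:
  assumes k: "k \<ge> 2" and m: "m \<ge> 2"
  shows "2 * card (rels k m) + 4 = 9 * k\<^sup>2 + 13 * k + 2 * (m - 3) * k"
proof -
  have U: "X i \<notin> set (fst q)" if "q \<in> rels_U k m" for q i
    using that unfolding rels_U_def by (auto dest!: set_word_power[THEN subsetD])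
  have W: "set (fst q) \<subseteq> range X" "\<exists>i. X i \<in> set (fst q)" if "q \<in> rels_W k" for q
    using that unfolding rels_W_def by auto
  have U': "\<not> set (fst q) \<subseteq> range X" "\<exists>i. X i \<in> set (fst q)" if "q \<in> rels_U' k m" for q
    using that unfolding rels_U'_def by auto
  have "rels_U k m \<inter> rels_W k = {}" using U W(2) by blast
  moreover have "(rels_U k m \<union> rels_W k) \<inter> rels_U' k m = {}"
    using U U' W(1) by blast
  ultimately have "card (rels k m) = card (rels_U k m) + card (rels_W k) + card (rels_U' k m)"
    unfolding rels_def using card_rels_U[OF k m] card_rels_W[OF k] card_rels_U'[OF k m]
    by (simp add: card_Un_disjoint)
  then have "2 * card (rels k m) = 2 * card (rels_U k m) + 2 * card (rels_W k) + 2 * card (rels_U' k m)"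
    by simp
  then have "2 * card (rels k m) =
      2 * (4 * k + (m - 3) * k + 2 * (k * (k - 1))) + (10 * (k - 1) + (k - 2) * (k - 3)) +
      2 * (2 + 6 * (k - 1) + 2 * k + 2 * ((k - 1) * (k - 2)))"
    by (simp only: card_rels_U[OF k m, THEN conjunct1] card_rels_W[OF k, THEN conjunct1]
        card_rels_U'[OF k m, THEN conjunct1])
  moreover obtain l where l: "k = Suc (Suc l)" using k by (metis add_2_eq_Suc le_Suc_ex)
  moreover have "(k - 2) * (k - 3) = l * (l - 1)" using l by simp
  moreover have "l * (l - 1) + l = l * l" by (cases l) auto
  ultimately show ?thesis by (simp add: power2_eq_square algebra_simps)
qed

lemma card_gens: "k \<ge> 1 \<Longrightarrow> card (gens k) = 3 * k"
proof -
  assume k: "k \<ge> 1"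
  have "B ` {1..k} \<inter> C ` {1..k} = {}" "(B ` {1..k} \<union> C ` {1..k}) \<inter> X ` {0..k - 1} = {}" by auto
  moreover have "card (B ` {1..k}) = k" "card (C ` {1..k}) = k" "card (X ` {0..k - 1}) = k"
    using k by (simp_all add: card_image inj_on_def)
  ultimately show ?thesis unfolding gens_def by (simp add: card_Un_disjoint)
qed

theorem theorem3p11:
  fixes k m :: nat
  assumes "k \<ge> 2" and "m \<ge> 2"
  shows "POI k m \<cong> presented_monoid (gens k) (rels k m) \<and>
    card (gens k) = 3 * k \<and>
    (m \<ge> 3 \<longrightarrow>
      real (card (rels k m)) = 1 / 2 * (9 * real k ^ 2 + (2 * real m + 7) * real k - 4)) \<and>
    (m = 2 \<longrightarrow>
      real (card (rels k m)) = 1 / 2 * (9 * real k ^ 2 + (2 * real m + 7) * real k - 4) + real k)"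
proof -
  note k = assms(1) and m = assms(2)
  have "real (2 * card (rels k m) + 4) = real (9 * k\<^sup>2 + 13 * k + 2 * (m - 3) * k)"
    using card_rels[OF k m] by simp
  then have c: "2 * real (card (rels k m)) + 4 = 9 * real k ^ 2 + 13 * real k + 2 * real (m - 3) * real k"
    by simp
  have "real (card (rels k m)) = 1 / 2 * (9 * real k ^ 2 + (2 * real m + 7) * real k - 4)" if "m \<ge> 3"
    using c that by (simp add: of_nat_diff algebra_simps)
  \<comment> \<open>Here the truncated \<open>m - 3\<close> is \<open>0\<close> instead of
    \<open>-1\<close>, so twice the cardinality exceeds the polynomial by
    \<open>2 * k\<close>.\<close>
  moreover have "real (card (rels k m)) =
      1 / 2 * (9 * real k ^ 2 + (2 * real m + 7) * real k - 4) + real k" if "m = 2"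
    using c that by (simp add: algebra_simps)
  moreover have "card (gens k) = 3 * k" using card_gens k by simp
  ultimately show ?thesis using POI_iso_presented[OF k m] by blast
qed

end
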